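(* Let $\mathbf K$ be a rigidly-compactly-generated monoidal triangulated category such that $\mathbf K^c$ is $\mathrm{Spc}$-Noetherian. Then the extended Balmer support $\mathrm{Supp}^{\rm B}$ is tensorial, that is, $$\bigcup_{B\in\mathbf K^c}\mathrm{Supp}^{\rm B}(A\otimes B\otimes C)=\mathrm{Supp}^{\rm B}(A)\cap\mathrm{Supp}^{\rm B}(C)$$ for all $A\in\mathbf K$ and $C\in\mathbf K^c$.
   Context: Setting. A rigidly-compactly-generated ("big") monoidal triangulated category $\mathbf K$ satisfies: it is triangulated with shift $\Sigma$ and has all set-indexed coproducts; it is the smallest localizing subcategory of itself containing the full subcategory $\mathbf K^c$ of compact objects; it has a monoidal structure $(\otimes,\mathbf 1)$, exact in each variable, with $\otimes$ commuting with set-indexed coproducts in each variable; $\mathbf 1\in\mathbf K^c$ and $\mathbf K^c$ is closed under $\otimes$; every object of $\mathbf K^c$ has a left and a right dual. No symmetry or braiding is assumed. Thick subcategory: full triangulated subcategory closed under direct summands. Localizing subcategory: thick and closed under set-indexed coproducts. Balmer spectrum. A thick ideal of $\mathbf K^c$ is a thick subcategory closed under tensoring on either side with objects of $\mathbf K^c$. A proper thick ideal $\mathbf P$ is prime if for thick ideals $\mathbf I,\mathbf J$ of $\mathbf K^c$, $\mathbf I\otimes\mathbf J\subseteq\mathbf P$ implies $\mathbf I\subseteq\mathbf P$ or $\mathbf J\subseteq\mathbf P$. $\mathrm{Spc}\,\mathbf K^c$ is the set of prime ideals, with closed sets $\{\mathbf P:\mathbf P\cap\mathbf S=\varnothing\}$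 for collections $\mathbf S$ of objects of $\mathbf K^c$; the Balmer support is $\mathrm{supp}^{\rm B}(A)=\{\mathbf P:A\notin\mathbf P\}$. $\mathbf K^c$ is $\mathrm{Spc}$-Noetherian if $\mathrm{Spc}\,\mathbf K^c$ is a Noetherian space. Rickard idempotents. For a thick ideal $\mathbf I$ of $\mathbf K^c$, let $\mathrm{Loc}(\mathbf I)$ be the smallest localizing subcategory of $\mathbf K$ containing $\mathbf I$; $\Gamma_{\mathbf I},L_{\mathbf I}:\mathbf K\to\mathbf K$ are the unique functors with distinguished triangles $\Gamma_{\mathbf I}A\to A\to L_{\mathbf I}A\to\Sigma\Gamma_{\mathbf I}A$, where $\Gamma_{\mathbf I}A\in\mathrm{Loc}(\mathbf I)$ and $\mathrm{Hom}_{\mathbf K}(B,L_{\mathbf I}A)=0$ for all $B\in\mathrm{Loc}(\mathbf I)$. For $S\subseteq\mathrm{Spc}\,\mathbf K^c$ specialization-closed, $\Theta(S)=\{A\in\mathbf K^c:\mathrm{supp}^{\rm B}(A)\subseteq S\}$, $\Gamma_S=\Gamma_{\Theta(S)}$, $L_S=L_{\Theta(S)}$. For a point $\mathbf P\in\mathrm{Spc}\,\mathbf K^c$: $\mathcal V(\mathbf P)=\overline{\{\mathbf P\}}$, $\mathcal Z(\mathbf P)=\{\mathbf Q:\mathbf P\notin\overline{\{\mathbf Q\}}\}$, and (treating $\mathbf P$ as a point) $\Gamma_{\mathbf P}A=\Gamma_{\mathcal V(\mathbf P)}\mathbf 1\otimes L_{\mathcal Z(\mathbf P)}\mathbf 1\otimes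 A$. The extended Balmer support of $A\in\mathbf K$ is $\mathrm{Supp}^{\rm B}(A)=\{\mathbf P\in\mathrm{Spc}\,\mathbf K^c:\Gamma_{\mathbf P}A\not\cong0\}$. *)

theory Defs
  imports "HOL-Analysis.Abstract_Topology" "HOL-Algebra.FiniteProduct"
begin

unbundle cardinal_syntax

section \<open>Categories\<close>

record ('o, 'm) cat =
  Ob :: "'o set"
  Mor :: "'m set"
  Dom :: "'m \<Rightarrow> 'o"
  Cod :: "'m \<Rightarrow> 'o"
  Idm :: "'o \<Rightarrow> 'm"
  Cmp :: "'m \<Rightarrow> 'm \<Rightarrow> 'm" (infixr "\<cdot>\<index>" 70)

definition Hom :: "('o, 'm, 'z) cat_scheme \<Rightarrow> 'o \<Rightarrow> 'o \<Rightarrow> 'm set" where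
  "Hom K X Y = {f \<in> Mor K. Dom K f = X \<and> Cod K f = Y}"

locale category =
  fixes K :: "('o, 'm, 'z) cat_scheme" (structure)
  assumes dom_in: "f \<in> Mor K \<Longrightarrow> Dom K f \<in> Ob K"
    and cod_in: "f \<in> Mor K \<Longrightarrow> Cod K f \<in> Ob K"
    and idm_hom: "X \<in> Ob K \<Longrightarrow> Idm K X \<in> Hom K X X"
    and cmp_hom: "\<lbrakk>f \<in> Hom K X Y; g \<in> Hom K Y Z\<rbrakk> \<Longrightarrow> g \<cdot> f \<in> Hom K X Z"
    and idm_left: "f \<in> Hom K X Y \<Longrightarrow> Idm K Y \<cdot> f = f"
    and idm_right: "f \<in> Hom K X Y \<Longrightarrow> f \<cdot> Idm K X = f"
    and cmp_assoc: "\<lbrakk>f \<in> Hom K W X; g \<in> Hom K X Y; h \<in> Hom K Y Z\<rbrakk>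
      \<Longrightarrow> (h \<cdot> g) \<cdot> f = h \<cdot> (g \<cdot> f)"

definition is_inverse :: "('o, 'm, 'z) cat_scheme \<Rightarrow> 'm \<Rightarrow> 'm \<Rightarrow> bool" where
  "is_inverse K f g \<longleftrightarrow> f \<in> Mor K \<and> g \<in> Hom K (Cod K f) (Dom K f)
     \<and> g \<cdot>\<^bsub>K\<^esub> f = Idm K (Dom K f) \<and> f \<cdot>\<^bsub>K\<^esub> g = Idm K (Cod K f)"

definition is_iso :: "('o, 'm, 'z) cat_scheme \<Rightarrow> 'm \<Rightarrow> bool" where
  "is_iso K f \<longleftrightarrow> (\<exists>g. is_inverse K f g)"

definition Inv :: "('o, 'm, 'z) cat_scheme \<Rightarrow> 'm \<Rightarrow> 'm" where
  "Inv K f = (THE g. is_inverse K f g)"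

definition isomorphic :: "('o, 'm, 'z) cat_scheme \<Rightarrow> 'o \<Rightarrow> 'o \<Rightarrow> bool" where
  "isomorphic K X Y \<longleftrightarrow> (\<exists>f \<in> Hom K X Y. is_iso K f)"

definition is_zero :: "('o, 'm, 'z) cat_scheme \<Rightarrow> 'o \<Rightarrow> bool" where
  "is_zero K Z \<longleftrightarrow> Z \<in> Ob K \<and>
     (\<forall>X \<in> Ob K. (\<exists>!f. f \<in> Hom K X Z) \<and> (\<exists>!f. f \<in> Hom K Z X))"

definition is_endofunctor ::
  "('o, 'm, 'z) cat_scheme \<Rightarrow> ('o \<Rightarrow> 'o) \<Rightarrow> ('m \<Rightarrow> 'm) \<Rightarrow> bool" where
  "is_endofunctor K F \<Phi> \<longleftrightarrow>
     (\<forall>X \<in> Ob K. F X \<in> Ob K \<and> \<Phi> (Idm K X) = Idm K (F X)) \<and>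
     (\<forall>X Y. \<forall>f \<in> Hom K X Y. \<Phi> f \<in> Hom K (F X) (F Y)) \<and>
     (\<forall>X Y Z. \<forall>f \<in> Hom K X Y. \<forall>g \<in> Hom K Y Z. \<Phi> (g \<cdot>\<^bsub>K\<^esub> f) = \<Phi> g \<cdot>\<^bsub>K\<^esub> \<Phi> f)"

definition is_coproduct ::
  "('o, 'm, 'z) cat_scheme \<Rightarrow> 'i set \<Rightarrow> ('i \<Rightarrow> 'o) \<Rightarrow> 'o \<Rightarrow> ('i \<Rightarrow> 'm) \<Rightarrow> bool" where
  "is_coproduct K I F P \<iota> \<longleftrightarrow> P \<in> Ob K \<and> (\<forall>i \<in> I. \<iota> i \<in> Hom K (F i) P) \<and>
     (\<forall>T \<in> Ob K. \<forall>f. (\<forall>i \<in> I. f i \<in> Hom K (F i) T) \<longrightarrow>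
        (\<exists>!u. u \<in> Hom K P T \<and> (\<forall>i \<in> I. u \<cdot>\<^bsub>K\<^esub> \<iota> i = f i)))"

section \<open>Additive categories\<close>

record ('o, 'm) addcat = "('o, 'm) cat" +
  Zer :: "'o \<Rightarrow> 'o \<Rightarrow> 'm"
  Add :: "'m \<Rightarrow> 'm \<Rightarrow> 'm"

text \<open>The additive group of morphisms, in the multiplicative notation of the group library:
  the product of this group is the sum of morphisms, and \<open>finprod\<close> is a finite sum.\<close>

definition HomG :: "('o, 'm, 'z) addcat_scheme \<Rightarrow> 'o \<Rightarrow> 'o \<Rightarrow> 'm monoid" where
  "HomG K X Y = \<lparr>carrier = Hom K X Y, monoid.mult = Add K, one = Zer K X Y\<rparr>"

definition Neg :: "('o, 'm, 'z) addcat_scheme \<Rightarrow> 'm \<Rightarrow> 'm" where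
  "Neg K f = inv\<^bsub>HomG K (Dom K f) (Cod K f)\<^esub> f"

definition is_biproduct :: "('o, 'm, 'z) addcat_scheme \<Rightarrow> 'o \<Rightarrow> 'o \<Rightarrow> 'o \<Rightarrow> bool" where
  "is_biproduct K X Y S \<longleftrightarrow> X \<in> Ob K \<and> Y \<in> Ob K \<and> S \<in> Ob K \<and>
     (\<exists>i \<in> Hom K X S. \<exists>j \<in> Hom K Y S. \<exists>p \<in> Hom K S X. \<exists>q \<in> Hom K S Y.
        p \<cdot>\<^bsub>K\<^esub> i = Idm K X \<and> q \<cdot>\<^bsub>K\<^esub> j = Idm K Y \<and>
        p \<cdot>\<^bsub>K\<^esub> j = Zer K Y X \<and> q \<cdot>\<^bsub>K\<^esub> i = Zer K X Y \<and>
        Add K (i \<cdot>\<^bsub>K\<^esub> p) (j \<cdot>\<^bsub>K\<^esub> q) = Idm K S)"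

locale additive_category = category K
  for K :: "('o, 'm, 'z) addcat_scheme" (structure) +
  assumes hom_group: "\<lbrakk>X \<in> Ob K; Y \<in> Ob K\<rbrakk> \<Longrightarrow> comm_group (HomG K X Y)"
    and cmp_add_left: "\<lbrakk>f \<in> Hom K X Y; g \<in> Hom K Y Z; h \<in> Hom K Y Z\<rbrakk>
      \<Longrightarrow> Add K g h \<cdot> f = Add K (g \<cdot> f) (h \<cdot> f)"
    and cmp_add_right: "\<lbrakk>f \<in> Hom K X Y; g \<in> Hom K X Y; h \<in> Hom K Y Z\<rbrakk>
      \<Longrightarrow> h \<cdot> Add K f g = Add K (h \<cdot> f) (h \<cdot> g)"
    and zero_object: "\<exists>Z. is_zero K Z"
    and biproducts: "\<lbrakk>X \<in> Ob K; Y \<in> Ob K\<rbrakk> \<Longrightarrow> \<exists>S. is_biproduct K X Y S"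

definition is_additive_endofunctor ::
  "('o, 'm, 'z) addcat_scheme \<Rightarrow> ('o \<Rightarrow> 'o) \<Rightarrow> ('m \<Rightarrow> 'm) \<Rightarrow> bool" where
  "is_additive_endofunctor K F \<Phi> \<longleftrightarrow> is_endofunctor K F \<Phi> \<and>
     (\<forall>X Y. \<forall>f \<in> Hom K X Y. \<forall>g \<in> Hom K X Y. \<Phi> (Add K f g) = Add K (\<Phi> f) (\<Phi> g))"

section \<open>Triangulated categories\<close>

text \<open>The shift is an additive auto-equivalence, with object part \<open>Sh\<close> and morphism part
  \<open>ShM\<close>. The relation \<open>Tri f g h\<close> says that
  \<open>X \<rightarrow> Y \<rightarrow> Z \<rightarrow> Sh X\<close>, with the three maps \<open>f\<close>, \<open>g\<close>, \<open>h\<close>, is a distinguished triangle.\<close>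

record ('o, 'm) tricat = "('o, 'm) addcat" +
  Sh :: "'o \<Rightarrow> 'o"
  ShM :: "'m \<Rightarrow> 'm"
  Tri :: "'m \<Rightarrow> 'm \<Rightarrow> 'm \<Rightarrow> bool"

definition is_triangle :: "('o, 'm, 'z) tricat_scheme \<Rightarrow> 'm \<Rightarrow> 'm \<Rightarrow> 'm \<Rightarrow> bool" where
  "is_triangle K f g h \<longleftrightarrow>
     f \<in> Mor K \<and> g \<in> Hom K (Cod K f) (Dom K h) \<and> h \<in> Hom K (Cod K g) (Sh K (Dom K f))"

locale triangulated_category = additive_category K
  for K :: "('o, 'm, 'z) tricat_scheme" (structure) +
  assumes shift_functor: "is_additive_endofunctor K (Sh K) (ShM K)"
    and shift_ff: "\<lbrakk>X \<in> Ob K; Y \<in> Ob K\<rbrakk>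
      \<Longrightarrow> bij_betw (ShM K) (Hom K X Y) (Hom K (Sh K X) (Sh K Y))"
    and shift_es: "Y \<in> Ob K \<Longrightarrow> \<exists>X \<in> Ob K. isomorphic K (Sh K X) Y"
    and tri_triangle: "Tri K f g h \<Longrightarrow> is_triangle K f g h"
    and tri_iso: "\<lbrakk>Tri K f g h; is_triangle K f' g' h';
        u \<in> Hom K (Dom K f) (Dom K f'); v \<in> Hom K (Dom K g) (Dom K g');
        w \<in> Hom K (Dom K h) (Dom K h'); is_iso K u; is_iso K v; is_iso K w;
        v \<cdot> f = f' \<cdot> u; w \<cdot> g = g' \<cdot> v; ShM K u \<cdot> h = h' \<cdot> w\<rbrakk> \<Longrightarrow> Tri K f' g' h'"
    and tri_idm: "\<lbrakk>X \<in> Ob K; is_zero K Z\<rbrakk>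
      \<Longrightarrow> Tri K (Idm K X) (Zer K X Z) (Zer K Z (Sh K X))"
    and tri_cone: "f \<in> Mor K \<Longrightarrow> \<exists>g h. Tri K f g h"
    and tri_rotate: "is_triangle K f g h \<Longrightarrow> Tri K f g h \<longleftrightarrow> Tri K g h (Neg K (ShM K f))"
    and tri_fill: "\<lbrakk>Tri K f g h; Tri K f' g' h';
        u \<in> Hom K (Dom K f) (Dom K f'); v \<in> Hom K (Dom K g) (Dom K g'); v \<cdot> f = f' \<cdot> u\<rbrakk>
      \<Longrightarrow> \<exists>w \<in> Hom K (Dom K h) (Dom K h'). w \<cdot> g = g' \<cdot> v \<and> ShM K u \<cdot> h = h' \<cdot> w"
    and tri_octahedral: "\<lbrakk>f \<in> Hom K X Y; g \<in> Hom K Y Z;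
        Tri K f f1 f2; Tri K g g1 g2; Tri K (g \<cdot> f) h1 h2\<rbrakk>
      \<Longrightarrow> \<exists>u v. Tri K u v (ShM K f1 \<cdot> g2) \<and>
            u \<in> Hom K (Cod K f1) (Cod K h1) \<and> v \<in> Hom K (Cod K h1) (Cod K g1) \<and>
            u \<cdot> f1 = h1 \<cdot> g \<and> h2 \<cdot> u = f2 \<and> v \<cdot> h1 = g1 \<and> g2 \<cdot> v = ShM K f \<cdot> h2"

definition is_exact_endofunctor ::
  "('o, 'm, 'z) tricat_scheme \<Rightarrow> ('o \<Rightarrow> 'o) \<Rightarrow> ('m \<Rightarrow> 'm) \<Rightarrow> bool" where
  "is_exact_endofunctor K F \<Phi> \<longleftrightarrow> is_additive_endofunctor K F \<Phi> \<and>
     (\<exists>\<theta>. (\<forall>X \<in> Ob K. \<theta> X \<in> Hom K (F (Sh K X)) (Sh K (F X)) \<and> is_iso K (\<theta> X)) \<and>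
          (\<forall>X Y. \<forall>f \<in> Hom K X Y. \<theta> Y \<cdot>\<^bsub>K\<^esub> \<Phi> (ShM K f) = ShM K (\<Phi> f) \<cdot>\<^bsub>K\<^esub> \<theta> X) \<and>
          (\<forall>f g h. Tri K f g h \<longrightarrow> Tri K (\<Phi> f) (\<Phi> g) (\<theta> (Dom K f) \<cdot>\<^bsub>K\<^esub> \<Phi> h)))"

text \<open>Full subcategories are given by their sets of objects. Closure under isomorphism is
  the case of a zero complement in \<open>summand\<close>.\<close>

definition thick :: "('o, 'm, 'z) tricat_scheme \<Rightarrow> 'o set \<Rightarrow> bool" where
  "thick K T \<longleftrightarrow> T \<subseteq> Ob K \<and> (\<forall>Z. is_zero K Z \<longrightarrow> Z \<in> T) \<and>
     (\<forall>X \<in> Ob K. Sh K X \<in> T \<longleftrightarrow> X \<in> T) \<and>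
     (\<forall>f g h. Tri K f g h \<longrightarrow> Dom K f \<in> T \<longrightarrow> Cod K f \<in> T \<longrightarrow> Cod K g \<in> T) \<and>
     (\<forall>X Y S. is_biproduct K X Y S \<longrightarrow> S \<in> T \<longrightarrow> X \<in> T)"

section \<open>Size, compact objects and localizing subcategories\<close>

text \<open>The cardinal \<open>\<kappa>\<close> plays the role of the size of the set-theoretic universe: a set is
  small if its cardinality is less than \<open>\<kappa>\<close>.\<close>

definition small :: "'u rel \<Rightarrow> 'a set \<Rightarrow> bool" where
  "small \<kappa> S \<longleftrightarrow> |S| <o \<kappa>"

text \<open>The direct sum of the groups \<open>Hom C (F i)\<close>, and the canonical map from it to
  \<open>Hom C P\<close>, where \<open>P\<close> is the coproduct of the \<open>F i\<close>.\<close>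

definition HomSum ::
  "('o, 'm, 'z) addcat_scheme \<Rightarrow> 'o \<Rightarrow> 'i set \<Rightarrow> ('i \<Rightarrow> 'o) \<Rightarrow> ('i \<Rightarrow> 'm) set" where
  "HomSum K C I F = {g \<in> (\<Pi>\<^sub>E i\<in>I. Hom K C (F i)). finite {i \<in> I. g i \<noteq> Zer K C (F i)}}"

definition HomSum_map :: "('o, 'm, 'z) addcat_scheme \<Rightarrow> 'o \<Rightarrow> 'i set \<Rightarrow> ('i \<Rightarrow> 'o)
    \<Rightarrow> 'o \<Rightarrow> ('i \<Rightarrow> 'm) \<Rightarrow> ('i \<Rightarrow> 'm) \<Rightarrow> 'm" where
  "HomSum_map K C I F P \<iota> g =
     finprod (HomG K C P) (\<lambda>i. \<iota> i \<cdot>\<^bsub>K\<^esub> g i) {i \<in> I. g i \<noteq> Zer K C (F i)}"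

definition compacts :: "'u rel \<Rightarrow> ('o, 'm, 'z) addcat_scheme \<Rightarrow> 'o set" where
  "compacts \<kappa> K = {C \<in> Ob K. \<forall>(I :: 'u set) F P \<iota>.
     small \<kappa> I \<longrightarrow> (\<forall>i \<in> I. F i \<in> Ob K) \<longrightarrow> is_coproduct K I F P \<iota> \<longrightarrow>
     bij_betw (HomSum_map K C I F P \<iota>) (HomSum K C I F) (Hom K C P)}"

definition localizing :: "'u rel \<Rightarrow> ('o, 'm, 'z) tricat_scheme \<Rightarrow> 'o set \<Rightarrow> bool" where
  "localizing \<kappa> K T \<longleftrightarrow> thick K T \<and> (\<forall>(I :: 'u set) F P \<iota>.
     small \<kappa> I \<longrightarrow> (\<forall>i \<in> I. F i \<in> T) \<longrightarrow> is_coproduct K I F P \<iota> \<longrightarrow> P \<in> T)"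

definition Loc :: "'u rel \<Rightarrow> ('o, 'm, 'z) tricat_scheme \<Rightarrow> 'o set \<Rightarrow> 'o set" where
  "Loc \<kappa> K S = \<Inter>{T. localizing \<kappa> K T \<and> S \<subseteq> T}"

section \<open>Monoidal triangulated categories\<close>

text \<open>The associator goes from \<open>(X \<boxtimes> Y) \<boxtimes> Z\<close> to \<open>X \<boxtimes> (Y \<boxtimes> Z)\<close>, and the unitors
  \<open>LUn\<close>, \<open>RUn\<close> from \<open>Unt \<boxtimes> X\<close> and from \<open>X \<boxtimes> Unt\<close> to \<open>X\<close>. The operation \<open>\<star>\<close> is the
  tensor product of morphisms.\<close>

record ('o, 'm) mtcat = "('o, 'm) tricat" +
  Ten :: "'o \<Rightarrow> 'o \<Rightarrow> 'o" (infixl "\<boxtimes>\<index>" 75)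
  TenM :: "'m \<Rightarrow> 'm \<Rightarrow> 'm" (infixl "\<star>\<index>" 75)
  Unt :: "'o"
  Asc :: "'o \<Rightarrow> 'o \<Rightarrow> 'o \<Rightarrow> 'm"
  LUn :: "'o \<Rightarrow> 'm"
  RUn :: "'o \<Rightarrow> 'm"

locale monoidal_triangulated_category = triangulated_category K
  for K :: "('o, 'm, 'z) mtcat_scheme" (structure) +
  assumes unt_ob: "Unt K \<in> Ob K"
    and ten_ob: "\<lbrakk>X \<in> Ob K; Y \<in> Ob K\<rbrakk> \<Longrightarrow> X \<boxtimes> Y \<in> Ob K"
    and ten_hom: "\<lbrakk>f \<in> Hom K X Y; g \<in> Hom K X' Y'\<rbrakk> \<Longrightarrow> f \<star> g \<in> Hom K (X \<boxtimes> X') (Y \<boxtimes> Y')"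
    and ten_idm: "\<lbrakk>X \<in> Ob K; Y \<in> Ob K\<rbrakk> \<Longrightarrow> Idm K X \<star> Idm K Y = Idm K (X \<boxtimes> Y)"
    and ten_cmp: "\<lbrakk>f \<in> Hom K X Y; g \<in> Hom K Y Z; f' \<in> Hom K X' Y'; g' \<in> Hom K Y' Z'\<rbrakk>
      \<Longrightarrow> (g \<cdot> f) \<star> (g' \<cdot> f') = (g \<star> g') \<cdot> (f \<star> f')"
    and asc_hom: "\<lbrakk>X \<in> Ob K; Y \<in> Ob K; Z \<in> Ob K\<rbrakk>
      \<Longrightarrow> Asc K X Y Z \<in> Hom K (X \<boxtimes> Y \<boxtimes> Z) (X \<boxtimes> (Y \<boxtimes> Z)) \<and> is_iso K (Asc K X Y Z)"
    and asc_nat: "\<lbrakk>f \<in> Hom K X X'; g \<in> Hom K Y Y'; h \<in> Hom K Z Z'\<rbrakk>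
      \<Longrightarrow> Asc K X' Y' Z' \<cdot> (f \<star> g \<star> h) = (f \<star> (g \<star> h)) \<cdot> Asc K X Y Z"
    and lun_hom: "X \<in> Ob K \<Longrightarrow> LUn K X \<in> Hom K (Unt K \<boxtimes> X) X \<and> is_iso K (LUn K X)"
    and lun_nat: "f \<in> Hom K X Y \<Longrightarrow> LUn K Y \<cdot> (Idm K (Unt K) \<star> f) = f \<cdot> LUn K X"
    and run_hom: "X \<in> Ob K \<Longrightarrow> RUn K X \<in> Hom K (X \<boxtimes> Unt K) X \<and> is_iso K (RUn K X)"
    and run_nat: "f \<in> Hom K X Y \<Longrightarrow> RUn K Y \<cdot> (f \<star> Idm K (Unt K)) = f \<cdot> RUn K X"
    and pentagon: "\<lbrakk>W \<in> Ob K; X \<in> Ob K; Y \<in> Ob K; Z \<in> Ob K\<rbrakk> \<Longrightarrow>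
        Asc K W X (Y \<boxtimes> Z) \<cdot> Asc K (W \<boxtimes> X) Y Z =
        (Idm K W \<star> Asc K X Y Z) \<cdot> Asc K W (X \<boxtimes> Y) Z \<cdot> (Asc K W X Y \<star> Idm K Z)"
    and unit_triangle: "\<lbrakk>X \<in> Ob K; Y \<in> Ob K\<rbrakk> \<Longrightarrow>
        (Idm K X \<star> LUn K Y) \<cdot> Asc K X (Unt K) Y = RUn K X \<star> Idm K Y"
    and ten_exact_right: "X \<in> Ob K
      \<Longrightarrow> is_exact_endofunctor K (\<lambda>Y. X \<boxtimes> Y) (\<lambda>f. Idm K X \<star> f)"
    and ten_exact_left: "Y \<in> Ob K
      \<Longrightarrow> is_exact_endofunctor K (\<lambda>X. X \<boxtimes> Y) (\<lambda>f. f \<star> Idm K Y)"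

definition is_left_dual :: "('o, 'm, 'z) mtcat_scheme \<Rightarrow> 'o \<Rightarrow> 'o \<Rightarrow> bool" where
  "is_left_dual K D X \<longleftrightarrow>
     (\<exists>ev \<in> Hom K (D \<boxtimes>\<^bsub>K\<^esub> X) (Unt K). \<exists>coev \<in> Hom K (Unt K) (X \<boxtimes>\<^bsub>K\<^esub> D).
        RUn K X \<cdot>\<^bsub>K\<^esub> (Idm K X \<star>\<^bsub>K\<^esub> ev) \<cdot>\<^bsub>K\<^esub> Asc K X D X
          \<cdot>\<^bsub>K\<^esub> (coev \<star>\<^bsub>K\<^esub> Idm K X) = LUn K X \<and>
        LUn K D \<cdot>\<^bsub>K\<^esub> (ev \<star>\<^bsub>K\<^esub> Idm K D) \<cdot>\<^bsub>K\<^esub> Inv K (Asc K D X D)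
          \<cdot>\<^bsub>K\<^esub> (Idm K D \<star>\<^bsub>K\<^esub> coev) = RUn K D)"

text \<open>The assumptions \<open>univ_card\<close>, \<open>univ_uncountable\<close>, \<open>univ_regular\<close> make finite and countable
  sets small, and small unions of small sets small; inaccessibility of \<open>\<kappa>\<close> is not needed.
  Together with \<open>ess_small\<close> (the compact objects form an essentially small category, so that
  the spectrum is a small set) they imply that \<open>Hom C X\<close> is small for \<open>C\<close> compact and \<open>X\<close>
  arbitrary. Smallness of all \<open>Hom X Y\<close> is not assumed: for a nonzero category with small
  coproducts it would force \<open>\<kappa>\<close> to be a strong limit.\<close>

locale rigidly_compactly_generated = monoidal_triangulated_category K
  for \<kappa> :: "'u rel" and K :: "('o, 'm, 'z) mtcat_scheme" (structure) +
  assumes univ_card: "Card_order \<kappa>"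
    and univ_uncountable: "natLeq <o \<kappa>"
    and univ_regular: "regularCard \<kappa>"
    and ess_small: "\<exists>R \<subseteq> compacts \<kappa> K. small \<kappa> R \<and>
      (\<forall>C \<in> compacts \<kappa> K. \<exists>D \<in> R. isomorphic K C D) \<and>
      (\<forall>C \<in> compacts \<kappa> K. \<forall>D \<in> compacts \<kappa> K. small \<kappa> (Hom K C D))"
    and coproducts: "\<And>(I :: 'u set) F. \<lbrakk>small \<kappa> I; \<And>i. i \<in> I \<Longrightarrow> F i \<in> Ob K\<rbrakk>
      \<Longrightarrow> \<exists>P \<iota>. is_coproduct K I F P \<iota>"
    and generated: "Loc \<kappa> K (compacts \<kappa> K) = Ob K"
    and ten_coproduct_right: "\<And>(I :: 'u set) F P \<iota> X.
      \<lbrakk>small \<kappa> I; \<And>i. i \<in> I \<Longrightarrow> F i \<in> Ob K; is_coproduct K I F P \<iota>; X \<in> Ob K\<rbrakk>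
      \<Longrightarrow> is_coproduct K I (\<lambda>i. X \<boxtimes> F i) (X \<boxtimes> P) (\<lambda>i. Idm K X \<star> \<iota> i)"
    and ten_coproduct_left: "\<And>(I :: 'u set) F P \<iota> X.
      \<lbrakk>small \<kappa> I; \<And>i. i \<in> I \<Longrightarrow> F i \<in> Ob K; is_coproduct K I F P \<iota>; X \<in> Ob K\<rbrakk>
      \<Longrightarrow> is_coproduct K I (\<lambda>i. F i \<boxtimes> X) (P \<boxtimes> X) (\<lambda>i. \<iota> i \<star> Idm K X)"
    and unit_compact: "Unt K \<in> compacts \<kappa> K"
    and ten_compact: "\<lbrakk>C \<in> compacts \<kappa> K; D \<in> compacts \<kappa> K\<rbrakk> \<Longrightarrow> C \<boxtimes> D \<in> compacts \<kappa> K"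
    and left_duals: "C \<in> compacts \<kappa> K \<Longrightarrow> \<exists>D \<in> compacts \<kappa> K. is_left_dual K D C"
    and right_duals: "C \<in> compacts \<kappa> K \<Longrightarrow> \<exists>D \<in> compacts \<kappa> K. is_left_dual K C D"

section \<open>The Balmer spectrum\<close>

definition thick_ideal :: "'u rel \<Rightarrow> ('o, 'm, 'z) mtcat_scheme \<Rightarrow> 'o set \<Rightarrow> bool" where
  "thick_ideal \<kappa> K I \<longleftrightarrow> I \<subseteq> compacts \<kappa> K \<and> thick K I \<and>
     (\<forall>A \<in> I. \<forall>C \<in> compacts \<kappa> K. A \<boxtimes>\<^bsub>K\<^esub> C \<in> I \<and> C \<boxtimes>\<^bsub>K\<^esub> A \<in> I)"

definition prime_ideal :: "'u rel \<Rightarrow> ('o, 'm, 'z) mtcat_scheme \<Rightarrow> 'o set \<Rightarrow> bool" where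
  "prime_ideal \<kappa> K P \<longleftrightarrow> thick_ideal \<kappa> K P \<and> P \<noteq> compacts \<kappa> K \<and>
     (\<forall>I J. thick_ideal \<kappa> K I \<longrightarrow> thick_ideal \<kappa> K J \<longrightarrow>
        (\<forall>A \<in> I. \<forall>B \<in> J. A \<boxtimes>\<^bsub>K\<^esub> B \<in> P) \<longrightarrow> I \<subseteq> P \<or> J \<subseteq> P)"

definition Spc :: "'u rel \<Rightarrow> ('o, 'm, 'z) mtcat_scheme \<Rightarrow> 'o set set" where
  "Spc \<kappa> K = {P. prime_ideal \<kappa> K P}"

definition Spc_topology :: "'u rel \<Rightarrow> ('o, 'm, 'z) mtcat_scheme \<Rightarrow> 'o set topology" where
  "Spc_topology \<kappa> K = topology (\<lambda>U. \<exists>S \<subseteq> compacts \<kappa> K.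
     U = Spc \<kappa> K - {P \<in> Spc \<kappa> K. P \<inter> S = {}})"

definition supp :: "'u rel \<Rightarrow> ('o, 'm, 'z) mtcat_scheme \<Rightarrow> 'o \<Rightarrow> 'o set set" where
  "supp \<kappa> K A = {P \<in> Spc \<kappa> K. A \<notin> P}"

definition noetherian_space :: "'a topology \<Rightarrow> bool" where
  "noetherian_space X \<longleftrightarrow> (\<forall>Z :: nat \<Rightarrow> 'a set.
     (\<forall>n. closedin X (Z n) \<and> Z (Suc n) \<subseteq> Z n) \<longrightarrow> (\<exists>N. \<forall>n \<ge> N. Z n = Z N))"

section \<open>Rickard idempotents and the extended support\<close>

definition rickard_triangle ::
  "'u rel \<Rightarrow> ('o, 'm, 'z) mtcat_scheme \<Rightarrow> 'o set \<Rightarrow> 'o \<Rightarrow> 'o \<Rightarrow> 'o \<Rightarrow> bool" where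
  "rickard_triangle \<kappa> K I A G L \<longleftrightarrow>
     (\<exists>f \<in> Hom K G A. \<exists>g \<in> Hom K A L. \<exists>h \<in> Hom K L (Sh K G). Tri K f g h) \<and>
     G \<in> Loc \<kappa> K I \<and> (\<forall>B \<in> Loc \<kappa> K I. Hom K B L = {Zer K B L})"

text \<open>The triangle is unique up to unique isomorphism, so that these are the values on objects
  of the two localization functors, up to natural isomorphism.\<close>

definition Gamma :: "'u rel \<Rightarrow> ('o, 'm, 'z) mtcat_scheme \<Rightarrow> 'o set \<Rightarrow> 'o \<Rightarrow> 'o" where
  "Gamma \<kappa> K I A = (SOME G. \<exists>L. rickard_triangle \<kappa> K I A G L)"

definition Lcl :: "'u rel \<Rightarrow> ('o, 'm, 'z) mtcat_scheme \<Rightarrow> 'o set \<Rightarrow> 'o \<Rightarrow> 'o" where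
  "Lcl \<kappa> K I A = (SOME L. \<exists>G. rickard_triangle \<kappa> K I A G L)"

definition Theta :: "'u rel \<Rightarrow> ('o, 'm, 'z) mtcat_scheme \<Rightarrow> 'o set set \<Rightarrow> 'o set" where
  "Theta \<kappa> K S = {A \<in> compacts \<kappa> K. supp \<kappa> K A \<subseteq> S}"

definition VP :: "'u rel \<Rightarrow> ('o, 'm, 'z) mtcat_scheme \<Rightarrow> 'o set \<Rightarrow> 'o set set" where
  "VP \<kappa> K P = Spc_topology \<kappa> K closure_of {P}"

definition ZP :: "'u rel \<Rightarrow> ('o, 'm, 'z) mtcat_scheme \<Rightarrow> 'o set \<Rightarrow> 'o set set" where
  "ZP \<kappa> K P = {Q \<in> Spc \<kappa> K. P \<notin> Spc_topology \<kappa> K closure_of {Q}}"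

definition Gamma_pt :: "'u rel \<Rightarrow> ('o, 'm, 'z) mtcat_scheme \<Rightarrow> 'o set \<Rightarrow> 'o \<Rightarrow> 'o" where
  "Gamma_pt \<kappa> K P A =
     Gamma \<kappa> K (Theta \<kappa> K (VP \<kappa> K P)) (Unt K) \<boxtimes>\<^bsub>K\<^esub>
     Lcl \<kappa> K (Theta \<kappa> K (ZP \<kappa> K P)) (Unt K) \<boxtimes>\<^bsub>K\<^esub> A"

definition Supp :: "'u rel \<Rightarrow> ('o, 'm, 'z) mtcat_scheme \<Rightarrow> 'o \<Rightarrow> 'o set set" where
  "Supp \<kappa> K A = {P \<in> Spc \<kappa> K. \<not> is_zero K (Gamma_pt \<kappa> K P A)}"

end

theory Submission
  imports Defs
begin

text \<open>
  Write \<open>V = Theta (VP P)\<close>, let \<open>G\<close> be the colocalization of the unit at \<open>V\<close> and \<open>L\<close> its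
  localization at \<open>Theta (ZP P) = P\<close>, so that \<open>P\<close> lies in the support of \<open>A\<close> iff
  \<open>G \<otimes> L \<otimes> A \<noteq> 0\<close>. If \<open>C \<in> P\<close>, then \<open>L \<otimes> X \<otimes> C = 0\<close> for all \<open>X\<close>.

  Let \<open>C \<notin> P\<close> be compact. By the Noetherian hypothesis \<open>V\<close> contains some \<open>D \<notin> P\<close>, and
  primeness gives a compact \<open>F\<close> with \<open>Y = C \<otimes> F \<otimes> D \<notin> P\<close>. If \<open>G \<otimes> L \<otimes> C\<close> vanished, then
  \<open>L \<otimes> C\<close>, and hence \<open>L \<otimes> Y\<close>, would be right orthogonal to \<open>V\<close>, so that \<open>Y \<rightarrow> L \<otimes> Y\<close> would
  be zero and \<open>Y\<close> a compact object of \<open>Loc P\<close>, that is, an object of \<open>P\<close>.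

  If moreover \<open>N = G \<otimes> L \<otimes> A\<close> satisfies \<open>N \<otimes> B \<otimes> C = 0\<close> for all compact \<open>B\<close>, then the thick
  ideal of all compact \<open>X\<close> with \<open>N \<otimes> B \<otimes> X = 0\<close> for all \<open>B\<close> contains \<open>P\<close> and \<open>C\<close>. By rigidity
  it is an intersection of primes, none of which is contained in \<open>P\<close>, so it contains \<open>V\<close>.
  By duality \<open>N\<close> is right orthogonal to \<open>V\<close>; but \<open>N \<in> Loc V\<close>, hence \<open>N = 0\<close>.
\<close>

section \<open>Additive categories\<close>

text \<open>Two facts taken for granted above carry most of the work. \<open>Gamma\<close> and
  \<open>Lcl\<close> are mere choices, so Rickard triangles must be constructed: \<open>X\<close> is
  approximated from \<open>Loc S\<close> by a countable tower of cones whose telescope has the same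
  maps from \<open>S\<close> as \<open>X\<close>. Each stage uses a coproduct over maps from
  representatives of the objects of \<open>S\<close>, which is why morphism sets out of compact
  objects must be shown to be small. And a compact object of \<open>Loc P\<close> must be brought
  back into \<open>P\<close>, by a calculus of fractions with compact denominators. The absence of a
  braiding shapes the rest. Primeness speaks of ideals, so passing to objects costs an arbitrary
  compact factor in the middle; annihilators carry the same factor in order to be two-sided. Right
  orthogonals of ideals are shown to be stable under tensoring on the right, which fits
  \<open>G\<close> and \<open>L\<close> standing on the left and is why \<open>C\<close> comes first
  in \<open>Y\<close>. The conclusions concern zero objects and thick subcategories, so bracketings
  matter only up to isomorphism; coherence has to be tracked in the duality lemmas alone.\<close>

text \<open>The \<open>cat\<close> rules are stated for \<open>Mor\<close>, \<open>Dom\<close> and \<open>Cod\<close> instead of \<open>Hom\<close>: their side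
  conditions then contain no variables that the simplifier would have to guess.\<close>

named_theorems cat

declare Hom_def [cat]

context category begin

lemma cat_ob [cat]:
  "f \<in> Mor K \<Longrightarrow> Dom K f \<in> Ob K" "f \<in> Mor K \<Longrightarrow> Cod K f \<in> Ob K"
  using dom_in cod_in by auto

lemma cat_idm [cat]:
  "X \<in> Ob K \<Longrightarrow> Idm K X \<in> Mor K" "X \<in> Ob K \<Longrightarrow> Dom K (Idm K X) = X"
  "X \<in> Ob K \<Longrightarrow> Cod K (Idm K X) = X"
  using idm_hom[of X] by (auto simp: Hom_def)

lemma cat_cmp [cat]:
  assumes "f \<in> Mor K" "g \<in> Mor K" "Cod K f = Dom K g"
  shows "g \<cdot> f \<in> Mor K" "Dom K (g \<cdot> f) = Dom K f" "Cod K (g \<cdot> f) = Cod K g"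
  using cmp_hom[of f "Dom K f" "Dom K g" g "Cod K g"] assms by (auto simp: Hom_def)

lemma cat_unit [cat]:
  "f \<in> Mor K \<Longrightarrow> Cod K f = Y \<Longrightarrow> Idm K Y \<cdot> f = f"
  "f \<in> Mor K \<Longrightarrow> Dom K f = X \<Longrightarrow> f \<cdot> Idm K X = f"
  using idm_left[of f] idm_right[of f] by (auto simp: Hom_def)

lemma cat_assoc [cat]:
  assumes "f \<in> Mor K" "g \<in> Mor K" "h \<in> Mor K" "Cod K f = Dom K g" "Cod K g = Dom K h"
  shows "(h \<cdot> g) \<cdot> f = h \<cdot> (g \<cdot> f)"
  using cmp_assoc[of f "Dom K f" "Dom K g" g "Dom K h" h "Cod K h"] assms by (auto simp: Hom_def)

text \<open>The \<open>cat\<close> rules associate every chain to the right, where an equation for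
  \<open>g \<cdot> f\<close> no longer matches; this is its form inside a longer chain.\<close>

lemma cmp_reassoc:
  assumes "g \<cdot> f = k" "f \<in> Hom K X Y" "g \<in> Hom K Y Z"
  shows "x \<in> Mor K \<Longrightarrow> Cod K x = X \<Longrightarrow> g \<cdot> (f \<cdot> x) = k \<cdot> x"
  using assms cmp_assoc[OF _ assms(2,3)] by (auto simp: Hom_def)

lemma hom_ob:
  assumes "f \<in> Hom K X Y" shows "X \<in> Ob K" "Y \<in> Ob K"
  using assms dom_in cod_in by (auto simp: Hom_def)

lemma hom_dom: "f \<in> Hom K X Y \<Longrightarrow> Dom K f = X"
  and hom_cod: "f \<in> Hom K X Y \<Longrightarrow> Cod K f = Y"
  and hom_mor: "f \<in> Hom K X Y \<Longrightarrow> f \<in> Mor K"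
  by (auto simp: Hom_def)

lemma mor_hom: "f \<in> Mor K \<Longrightarrow> f \<in> Hom K (Dom K f) (Cod K f)"
  by (simp add: Hom_def)

lemma is_inverse_iff:
  "f \<in> Hom K X Y \<Longrightarrow>
    is_inverse K f g \<longleftrightarrow> g \<in> Hom K Y X \<and> g \<cdot> f = Idm K X \<and> f \<cdot> g = Idm K Y"
  by (auto simp: is_inverse_def Hom_def)

lemma is_iso_iff:
  "f \<in> Hom K X Y \<Longrightarrow>
    is_iso K f \<longleftrightarrow> (\<exists>g \<in> Hom K Y X. g \<cdot> f = Idm K X \<and> f \<cdot> g = Idm K Y)"
  by (auto simp: is_iso_def is_inverse_iff)

lemma Inv_eq:
  assumes "f \<in> Hom K X Y" "g \<in> Hom K Y X" "g \<cdot> f = Idm K X" "f \<cdot> g = Idm K Y"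
  shows "Inv K f = g"
  unfolding Inv_def
proof (rule the_equality)
  show "is_inverse K f g" using assms by (simp add: is_inverse_iff)
  fix h assume "is_inverse K f h"
  then have h: "h \<in> Hom K Y X" "h \<cdot> f = Idm K X" using assms(1) by (auto simp: is_inverse_iff)
  have "h = h \<cdot> (f \<cdot> g)" using idm_right[OF h(1)] assms(4) by simp
  also have "\<dots> = (h \<cdot> f) \<cdot> g" using cmp_assoc[OF assms(2,1) h(1)] by simp
  also have "\<dots> = g" using h(2) idm_left[OF assms(2)] by simp
  finally show "h = g" .
qed

lemma Inv_props:
  assumes "f \<in> Hom K X Y" "is_iso K f"
  shows "Inv K f \<in> Hom K Y X" "Inv K f \<cdot> f = Idm K X" "f \<cdot> Inv K f = Idm K Y"
proof -
  obtain g where g: "g \<in> Hom K Y X" "g \<cdot> f = Idm K X" "f \<cdot> g = Idm K Y"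
    using assms is_iso_iff by blast
  then have "Inv K f = g" using Inv_eq assms(1) by blast
  then show "Inv K f \<in> Hom K Y X" "Inv K f \<cdot> f = Idm K X" "f \<cdot> Inv K f = Idm K Y"
    using g by auto
qed

lemma isomorphic_iff:
  "isomorphic K X Y \<longleftrightarrow>
    (\<exists>f \<in> Hom K X Y. \<exists>g \<in> Hom K Y X. g \<cdot> f = Idm K X \<and> f \<cdot> g = Idm K Y)"
  unfolding isomorphic_def using is_iso_iff by blast

lemma isomorphicE:
  assumes "isomorphic K X Y"
  obtains f g where "f \<in> Hom K X Y" "g \<in> Hom K Y X" "g \<cdot> f = Idm K X" "f \<cdot> g = Idm K Y"
  using assms isomorphic_iff by blast

lemma isomorphic_sym: "isomorphic K X Y \<Longrightarrow> isomorphic K Y X"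
  unfolding isomorphic_iff by blast

lemma isomorphic_trans:
  assumes "isomorphic K X Y" "isomorphic K Y Z" shows "isomorphic K X Z"
proof -
  obtain f g where f: "f \<in> Hom K X Y" "g \<in> Hom K Y X" "g \<cdot> f = Idm K X" "f \<cdot> g = Idm K Y"
    using assms(1) by (rule isomorphicE)
  obtain h k where h: "h \<in> Hom K Y Z" "k \<in> Hom K Z Y" "k \<cdot> h = Idm K Y" "h \<cdot> k = Idm K Z"
    using assms(2) by (rule isomorphicE)
  have "(g \<cdot> k) \<cdot> (h \<cdot> f) = Idm K X" "(h \<cdot> f) \<cdot> (g \<cdot> k) = Idm K Z"
    using f h cmp_reassoc[OF h(3,1,2)] cmp_reassoc[OF f(4,2,1)] by (simp_all add: cat)
  then show ?thesis unfolding isomorphic_iff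
    using cmp_hom[OF f(1) h(1)] cmp_hom[OF h(2) f(2)] by blast
qed

end

text \<open>Plays the role of direct summands: \<open>thick\<close> asks for complements, and in a
  triangulated category a retract always has one, by \<open>retract_biproduct\<close>.\<close>

definition retract :: "('o, 'm, 'z) cat_scheme \<Rightarrow> 'o \<Rightarrow> 'o \<Rightarrow> bool" where
  "retract K X S \<longleftrightarrow> (\<exists>i \<in> Hom K X S. \<exists>p \<in> Hom K S X. p \<cdot>\<^bsub>K\<^esub> i = Idm K X)"

lemma (in category) isomorphic_retract: "isomorphic K X Y \<Longrightarrow> retract K X Y"
  unfolding retract_def isomorphic_iff by blast

context additive_category begin

lemma HomG_simps [simp]:
  "carrier (HomG K X Y) = Hom K X Y" "monoid.mult (HomG K X Y) = Add K"
  "one (HomG K X Y) = Zer K X Y"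
  by (simp_all add: HomG_def)

lemma zer_hom: "X \<in> Ob K \<Longrightarrow> Y \<in> Ob K \<Longrightarrow> Zer K X Y \<in> Hom K X Y"
proof -
  assume "X \<in> Ob K" "Y \<in> Ob K"
  then interpret comm_group "HomG K X Y" by (rule hom_group)
  show ?thesis using one_closed by simp
qed

lemma add_hom:
  assumes "f \<in> Hom K X Y" "g \<in> Hom K X Y"
  shows "Add K f g \<in> Hom K X Y"
proof -
  interpret comm_group "HomG K X Y" using assms(1) hom_group hom_ob by blast
  show ?thesis using m_closed[of f g] assms by simp
qed

lemma neg_hom:
  assumes "f \<in> Hom K X Y"
  shows "Neg K f \<in> Hom K X Y"
proof -
  interpret comm_group "HomG K X Y" using assms(1) hom_group hom_ob by blast
  show ?thesis using inv_closed[of f] assms by (simp add: Neg_def hom_dom[OF assms(1)] hom_cod[OF assms(1)])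
qed

lemma add_assoc:
  assumes "f \<in> Hom K X Y" "g \<in> Hom K X Y" "h \<in> Hom K X Y"
  shows "Add K (Add K f g) h = Add K f (Add K g h)"
proof -
  interpret comm_group "HomG K X Y" using assms(1) hom_group hom_ob by blast
  show ?thesis using m_assoc[of f g h] assms by simp
qed

lemma add_comm:
  assumes "f \<in> Hom K X Y" "g \<in> Hom K X Y"
  shows "Add K f g = Add K g f"
proof -
  interpret comm_group "HomG K X Y" using assms(1) hom_group hom_ob by blast
  show ?thesis using m_comm[of f g] assms by simp
qed

lemma add_zer_left:
  assumes "f \<in> Hom K X Y"
  shows "Add K (Zer K X Y) f = f"
proof -
  interpret comm_group "HomG K X Y" using assms(1) hom_group hom_ob by blast
  show ?thesis using l_one[of f] assms by simp
qed

lemma add_zer_right: "f \<in> Hom K X Y \<Longrightarrow> Add K f (Zer K X Y) = f"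
  using add_zer_left add_comm zer_hom hom_ob by metis

lemma add_neg_left:
  assumes "f \<in> Hom K X Y"
  shows "Add K (Neg K f) f = Zer K X Y"
proof -
  interpret comm_group "HomG K X Y" using assms(1) hom_group hom_ob by blast
  show ?thesis using l_inv[of f] assms by (simp add: Neg_def hom_dom[OF assms(1)] hom_cod[OF assms(1)])
qed

lemma add_neg_right: "f \<in> Hom K X Y \<Longrightarrow> Add K f (Neg K f) = Zer K X Y"
  using add_neg_left add_comm neg_hom by metis

lemma neg_add_cancel:
  assumes "f \<in> Hom K X Y" "g \<in> Hom K X Y" shows "Add K (Neg K f) (Add K f g) = g"
  using add_assoc[OF neg_hom[OF assms(1)] assms] add_neg_left[OF assms(1)] add_zer_left[OF assms(2)]
  by simp

lemma add_left_cancel: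
  assumes "f \<in> Hom K X Y" "g \<in> Hom K X Y" "h \<in> Hom K X Y"
  shows "Add K f g = Add K f h \<longleftrightarrow> g = h"
  using neg_add_cancel[OF assms(1,2)] neg_add_cancel[OF assms(1,3)] by metis

lemma sub_add:
  assumes "f \<in> Hom K X Y" "g \<in> Hom K X Y"
  shows "Add K (Add K f (Neg K g)) g = f"
  using add_assoc[OF assms(1) neg_hom[OF assms(2)] assms(2)] add_neg_left[OF assms(2)]
    add_zer_right[OF assms(1)] by simp

lemma sub_eq_zer_iff:
  assumes "f \<in> Hom K X Y" "g \<in> Hom K X Y"
  shows "Add K f (Neg K g) = Zer K X Y \<longleftrightarrow> f = g"
  using sub_add[OF assms] add_zer_left[OF assms(2)] add_neg_right[OF assms(1)] by metis

lemma neg_unique: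
  assumes "f \<in> Hom K X Y" "g \<in> Hom K X Y" "Add K f g = Zer K X Y" shows "g = Neg K f"
  using add_left_cancel[OF assms(1,2) neg_hom[OF assms(1)]] add_neg_right[OF assms(1)] assms(3)
  by simp

lemma neg_neg: assumes "f \<in> Hom K X Y" shows "Neg K (Neg K f) = f"
  using neg_unique[OF neg_hom[OF assms] assms add_neg_left[OF assms]] by simp

text \<open>Cancellation in the group of morphisms; this is how composition and additive functors
  are seen to preserve zero.\<close>

lemma self_add_zer:
  assumes "f \<in> Hom K X Y" "Add K f f = f" shows "f = Zer K X Y"
  using neg_add_cancel[OF assms(1,1)] assms(2) add_neg_left[OF assms(1)] by simp

lemma cmp_zer_left:
  assumes "f \<in> Hom K X Y" "Z \<in> Ob K" shows "Zer K Y Z \<cdot> f = Zer K X Z"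
proof (rule self_add_zer)
  have z: "Zer K Y Z \<in> Hom K Y Z" using assms zer_hom hom_ob by blast
  show "Zer K Y Z \<cdot> f \<in> Hom K X Z" using cmp_hom assms(1) z by blast
  show "Add K (Zer K Y Z \<cdot> f) (Zer K Y Z \<cdot> f) = Zer K Y Z \<cdot> f"
    using cmp_add_left[OF assms(1) z z] add_zer_left[OF z] by simp
qed

lemma cmp_zer_right:
  assumes "f \<in> Hom K X Y" "W \<in> Ob K" shows "f \<cdot> Zer K W X = Zer K W Y"
proof (rule self_add_zer)
  have z: "Zer K W X \<in> Hom K W X" using assms zer_hom hom_ob by blast
  show "f \<cdot> Zer K W X \<in> Hom K W Y" using cmp_hom assms(1) z by blast
  show "Add K (f \<cdot> Zer K W X) (f \<cdot> Zer K W X) = f \<cdot> Zer K W X"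
    using cmp_add_right[OF z z assms(1)] add_zer_left[OF z] by simp
qed

lemma cmp_neg_left:
  assumes "f \<in> Hom K X Y" "g \<in> Hom K Y Z" shows "Neg K g \<cdot> f = Neg K (g \<cdot> f)"
proof (rule neg_unique)
  show "g \<cdot> f \<in> Hom K X Z" "Neg K g \<cdot> f \<in> Hom K X Z" using assms cmp_hom neg_hom by blast+
  show "Add K (g \<cdot> f) (Neg K g \<cdot> f) = Zer K X Z"
    using cmp_add_left[OF assms neg_hom[OF assms(2)]] add_neg_right[OF assms(2)]
      cmp_zer_left[OF assms(1) hom_ob(2)[OF assms(2)]] by simp
qed

lemma cmp_neg_right:
  assumes "f \<in> Hom K X Y" "g \<in> Hom K Y Z" shows "g \<cdot> Neg K f = Neg K (g \<cdot> f)"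
proof (rule neg_unique)
  show "g \<cdot> f \<in> Hom K X Z" "g \<cdot> Neg K f \<in> Hom K X Z" using assms cmp_hom neg_hom by blast+
  show "Add K (g \<cdot> f) (g \<cdot> Neg K f) = Zer K X Z"
    using cmp_add_right[OF assms(1) neg_hom[OF assms(1)] assms(2)] add_neg_right[OF assms(1)]
      cmp_zer_right[OF assms(2) hom_ob(1)[OF assms(1)]] by simp
qed

lemma neg_zer:
  assumes "X \<in> Ob K" "Y \<in> Ob K" shows "Neg K (Zer K X Y) = Zer K X Y"
  using neg_unique[OF zer_hom[OF assms] zer_hom[OF assms] add_zer_left[OF zer_hom[OF assms]]]
  by simp

lemma neg_eq_zer_iff:
  assumes "f \<in> Hom K X Y" shows "Neg K f = Zer K X Y \<longleftrightarrow> f = Zer K X Y"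
  using neg_neg[OF assms] neg_zer[OF hom_ob[OF assms]] by metis

lemma cat_zer [cat]:
  assumes "X \<in> Ob K" "Y \<in> Ob K"
  shows "Zer K X Y \<in> Mor K" "Dom K (Zer K X Y) = X" "Cod K (Zer K X Y) = Y"
  using zer_hom[OF assms] by (auto simp: Hom_def)

lemma cat_add [cat]:
  assumes "f \<in> Mor K" "g \<in> Mor K" "Dom K f = Dom K g" "Cod K f = Cod K g"
  shows "Add K f g \<in> Mor K" "Dom K (Add K f g) = Dom K g" "Cod K (Add K f g) = Cod K g"
  using add_hom[of f "Dom K g" "Cod K g" g] assms by (auto simp: Hom_def)

lemma cat_neg [cat]:
  assumes "f \<in> Mor K"
  shows "Neg K f \<in> Mor K" "Dom K (Neg K f) = Dom K f" "Cod K (Neg K f) = Cod K f"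
  using neg_hom[OF mor_hom[OF assms]] by (auto simp: Hom_def)

lemma cat_cmp_zer [cat]:
  "f \<in> Mor K \<Longrightarrow> Cod K f = Y \<Longrightarrow> Z \<in> Ob K \<Longrightarrow> Zer K Y Z \<cdot> f = Zer K (Dom K f) Z"
  "f \<in> Mor K \<Longrightarrow> Dom K f = X \<Longrightarrow> W \<in> Ob K \<Longrightarrow> f \<cdot> Zer K W X = Zer K W (Cod K f)"
  using cmp_zer_left[of f] cmp_zer_right[of f] by (auto simp: Hom_def)

lemma cat_add_zer [cat]:
  "f \<in> Mor K \<Longrightarrow> X = Dom K f \<Longrightarrow> Y = Cod K f \<Longrightarrow> Add K (Zer K X Y) f = f"
  "f \<in> Mor K \<Longrightarrow> X = Dom K f \<Longrightarrow> Y = Cod K f \<Longrightarrow> Add K f (Zer K X Y) = f"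
  using add_zer_left[of f] add_zer_right[of f] by (auto simp: Hom_def)

lemma cat_cmp_add [cat]:
  assumes "f \<in> Mor K" "g \<in> Mor K" "h \<in> Mor K"
  shows "Cod K f = Dom K g \<Longrightarrow> Dom K g = Dom K h \<Longrightarrow> Cod K g = Cod K h
      \<Longrightarrow> Add K g h \<cdot> f = Add K (g \<cdot> f) (h \<cdot> f)"
    "Cod K f = Cod K g \<Longrightarrow> Dom K f = Dom K g \<Longrightarrow> Dom K h = Cod K g
      \<Longrightarrow> h \<cdot> Add K f g = Add K (h \<cdot> f) (h \<cdot> g)"
  using cmp_add_left[of f "Dom K f" "Dom K h" g "Cod K h" h]
    cmp_add_right[of f "Dom K g" "Cod K g" g h "Cod K h"] assms by (auto simp: Hom_def)

lemma cat_cmp_neg [cat]: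
  assumes "f \<in> Mor K" "g \<in> Mor K" "Cod K f = Dom K g"
  shows "Neg K g \<cdot> f = Neg K (g \<cdot> f)" "g \<cdot> Neg K f = Neg K (g \<cdot> f)"
  using cmp_neg_left[of f "Dom K f" "Dom K g" g "Cod K g"]
    cmp_neg_right[of f "Dom K f" "Dom K g" g "Cod K g"] assms by (auto simp: Hom_def)

lemma cat_neg_neg [cat]: "f \<in> Mor K \<Longrightarrow> Neg K (Neg K f) = f"
  using neg_neg mor_hom by blast

lemma cat_add_neg [cat]:
  "f \<in> Mor K \<Longrightarrow> Add K f (Neg K f) = Zer K (Dom K f) (Cod K f)"
  "f \<in> Mor K \<Longrightarrow> Add K (Neg K f) f = Zer K (Dom K f) (Cod K f)"
  using add_neg_right add_neg_left mor_hom by blast+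

lemma is_zero_ob: "is_zero K Z \<Longrightarrow> Z \<in> Ob K" by (simp add: is_zero_def)

lemma is_zero_into: "is_zero K Z \<Longrightarrow> f \<in> Hom K X Z \<Longrightarrow> f = Zer K X Z"
  unfolding is_zero_def using zer_hom hom_ob by metis

lemma is_zero_from: "is_zero K Z \<Longrightarrow> f \<in> Hom K Z X \<Longrightarrow> f = Zer K Z X"
  unfolding is_zero_def using zer_hom hom_ob by metis

lemma is_zero_iff: "is_zero K Z \<longleftrightarrow> Z \<in> Ob K \<and> Idm K Z = Zer K Z Z"
proof
  assume "is_zero K Z" then show "Z \<in> Ob K \<and> Idm K Z = Zer K Z Z"
    using is_zero_into is_zero_ob idm_hom by blast
next
  assume z: "Z \<in> Ob K \<and> Idm K Z = Zer K Z Z"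
  have "f = Zer K X Z" if "f \<in> Hom K X Z" for X f
    using idm_left[OF that] cmp_zer_left[OF that] z by simp
  moreover have "f = Zer K Z X" if "f \<in> Hom K Z X" for X f
    using idm_right[OF that] cmp_zer_right[OF that] z by simp
  ultimately show "is_zero K Z" unfolding is_zero_def using z zer_hom by metis
qed

lemma retract_zero:
  assumes "retract K X S" "is_zero K S" shows "is_zero K X"
proof -
  obtain i p where "i \<in> Hom K X S" "p \<in> Hom K S X" "p \<cdot> i = Idm K X"
    using assms(1) unfolding retract_def by blast
  then show ?thesis unfolding is_zero_iff
    using is_zero_into[OF assms(2)] cmp_zer_right hom_ob by metis
qed

lemma is_biproduct_retract:
  assumes "is_biproduct K X Y S" shows "retract K X S"
  using assms unfolding is_biproduct_def retract_def by blast

lemma is_biproduct_sym: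
  assumes "is_biproduct K X Y S" shows "is_biproduct K Y X S"
proof -
  obtain i j p q where h: "i \<in> Hom K X S" "j \<in> Hom K Y S" "p \<in> Hom K S X" "q \<in> Hom K S Y"
    "p \<cdot> i = Idm K X" "q \<cdot> j = Idm K Y" "p \<cdot> j = Zer K Y X" "q \<cdot> i = Zer K X Y"
    "Add K (i \<cdot> p) (j \<cdot> q) = Idm K S"
    using assms unfolding is_biproduct_def by blast
  have "Add K (j \<cdot> q) (i \<cdot> p) = Idm K S"
    using add_comm h(9) cmp_hom[OF h(3,1)] cmp_hom[OF h(4,2)] by metis
  with h assms show ?thesis unfolding is_biproduct_def by blast
qed

end

section \<open>Exact triangles\<close>

context additive_category begin

lemma add_endo_ob: "is_additive_endofunctor K F \<Phi> \<Longrightarrow> X \<in> Ob K \<Longrightarrow> F X \<in> Ob K"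
  and add_endo_hom: "is_additive_endofunctor K F \<Phi> \<Longrightarrow> f \<in> Hom K X Y \<Longrightarrow> \<Phi> f \<in> Hom K (F X) (F Y)"
  and add_endo_idm: "is_additive_endofunctor K F \<Phi> \<Longrightarrow> X \<in> Ob K \<Longrightarrow> \<Phi> (Idm K X) = Idm K (F X)"
  and add_endo_cmp: "is_additive_endofunctor K F \<Phi> \<Longrightarrow> f \<in> Hom K X Y \<Longrightarrow> g \<in> Hom K Y Z \<Longrightarrow>
    \<Phi> (g \<cdot> f) = \<Phi> g \<cdot> \<Phi> f"
  and add_endo_add: "is_additive_endofunctor K F \<Phi> \<Longrightarrow> f \<in> Hom K X Y \<Longrightarrow> g \<in> Hom K X Y \<Longrightarrow>
    \<Phi> (Add K f g) = Add K (\<Phi> f) (\<Phi> g)"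
  unfolding is_additive_endofunctor_def is_endofunctor_def by blast+

lemma add_endo_zer:
  assumes "is_additive_endofunctor K F \<Phi>" "X \<in> Ob K" "Y \<in> Ob K"
  shows "\<Phi> (Zer K X Y) = Zer K (F X) (F Y)"
proof (rule self_add_zer)
  have z: "Zer K X Y \<in> Hom K X Y" using assms zer_hom by blast
  then show "\<Phi> (Zer K X Y) \<in> Hom K (F X) (F Y)" using assms add_endo_hom by blast
  show "Add K (\<Phi> (Zer K X Y)) (\<Phi> (Zer K X Y)) = \<Phi> (Zer K X Y)"
    using add_endo_add[OF assms(1) z z] add_zer_left[OF z] by simp
qed

lemma add_endo_neg:
  assumes "is_additive_endofunctor K F \<Phi>" "f \<in> Hom K X Y"
  shows "\<Phi> (Neg K f) = Neg K (\<Phi> f)"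
proof (rule neg_unique)
  show "\<Phi> f \<in> Hom K (F X) (F Y)" "\<Phi> (Neg K f) \<in> Hom K (F X) (F Y)"
    using assms add_endo_hom neg_hom by blast+
  show "Add K (\<Phi> f) (\<Phi> (Neg K f)) = Zer K (F X) (F Y)"
    using add_endo_add[OF assms neg_hom[OF assms(2)]] add_neg_right[OF assms(2)]
      add_endo_zer[OF assms(1) hom_ob[OF assms(2)]] by simp
qed

lemma add_endo_zero:
  assumes "is_additive_endofunctor K F \<Phi>" "is_zero K Z" shows "is_zero K (F Z)"
  using assms add_endo_ob[OF assms(1)] add_endo_idm[OF assms(1), of Z] add_endo_zer[OF assms(1), of Z Z]
  by (simp add: is_zero_iff)

lemma add_endo_retract:
  assumes "is_additive_endofunctor K F \<Phi>" "retract K X S" shows "retract K (F X) (F S)"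
proof -
  obtain i p where ip: "i \<in> Hom K X S" "p \<in> Hom K S X" "p \<cdot> i = Idm K X"
    using assms(2) unfolding retract_def by blast
  then have "\<Phi> p \<cdot> \<Phi> i = Idm K (F X)"
    using add_endo_cmp[OF assms(1) ip(1,2)] add_endo_idm[OF assms(1) hom_ob(1)[OF ip(1)]] by simp
  then show ?thesis unfolding retract_def using add_endo_hom[OF assms(1)] ip by blast
qed

lemma add_endo_isomorphic:
  assumes "is_additive_endofunctor K F \<Phi>" "isomorphic K X Y" shows "isomorphic K (F X) (F Y)"
proof -
  obtain f g where f: "f \<in> Hom K X Y" "g \<in> Hom K Y X" "g \<cdot> f = Idm K X" "f \<cdot> g = Idm K Y"
    using assms(2) by (rule isomorphicE)
  have "\<Phi> g \<cdot> \<Phi> f = Idm K (F X)" "\<Phi> f \<cdot> \<Phi> g = Idm K (F Y)"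
    using add_endo_cmp[OF assms(1)] add_endo_idm[OF assms(1)] hom_ob[OF f(1)] f by metis+
  then show ?thesis unfolding isomorphic_iff using add_endo_hom[OF assms(1)] f by blast
qed

lemma zero_ob_ex: obtains Z where "is_zero K Z" "Z \<in> Ob K"
  using zero_object is_zero_ob by blast

lemma cat_is_zero [cat]: "is_zero K Z \<Longrightarrow> Z \<in> Ob K" by (rule is_zero_ob)

end

context triangulated_category begin

lemma sh_ob: "X \<in> Ob K \<Longrightarrow> Sh K X \<in> Ob K"
  using add_endo_ob[OF shift_functor] .

lemma shm_hom: "f \<in> Hom K X Y \<Longrightarrow> ShM K f \<in> Hom K (Sh K X) (Sh K Y)"
  using add_endo_hom[OF shift_functor] .

lemma cat_sh [cat]:
  "X \<in> Ob K \<Longrightarrow> Sh K X \<in> Ob K"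
  "f \<in> Mor K \<Longrightarrow> ShM K f \<in> Mor K"
  "f \<in> Mor K \<Longrightarrow> Dom K (ShM K f) = Sh K (Dom K f)"
  "f \<in> Mor K \<Longrightarrow> Cod K (ShM K f) = Sh K (Cod K f)"
  using sh_ob shm_hom[OF mor_hom] by (auto simp: Hom_def)

lemma shm_cmp: "f \<in> Hom K X Y \<Longrightarrow> g \<in> Hom K Y Z \<Longrightarrow> ShM K (g \<cdot> f) = ShM K g \<cdot> ShM K f"
  using add_endo_cmp[OF shift_functor] .

lemma cat_shm [cat]:
  "X \<in> Ob K \<Longrightarrow> ShM K (Idm K X) = Idm K (Sh K X)"
  "f \<in> Mor K \<Longrightarrow> g \<in> Mor K \<Longrightarrow> Cod K f = Dom K g \<Longrightarrow> ShM K (g \<cdot> f) = ShM K g \<cdot> ShM K f"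
  "f \<in> Mor K \<Longrightarrow> g \<in> Mor K \<Longrightarrow> Dom K f = Dom K g \<Longrightarrow> Cod K f = Cod K g \<Longrightarrow>
    ShM K (Add K f g) = Add K (ShM K f) (ShM K g)"
  "X \<in> Ob K \<Longrightarrow> Y \<in> Ob K \<Longrightarrow> ShM K (Zer K X Y) = Zer K (Sh K X) (Sh K Y)"
  "f \<in> Mor K \<Longrightarrow> ShM K (Neg K f) = Neg K (ShM K f)"
  using add_endo_idm[OF shift_functor] add_endo_zer[OF shift_functor]
    add_endo_cmp[OF shift_functor, of f "Dom K f" "Cod K f" g "Cod K g"]
    add_endo_add[OF shift_functor, of f "Dom K f" "Cod K f" g]
    add_endo_neg[OF shift_functor, of f "Dom K f" "Cod K f"]
  by (auto simp: Hom_def)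

lemma shm_inj: "f \<in> Hom K X Y \<Longrightarrow> g \<in> Hom K X Y \<Longrightarrow> ShM K f = ShM K g \<Longrightarrow> f = g"
  using shift_ff[OF hom_ob[of f X Y]] unfolding bij_betw_def inj_on_def by blast

lemma shm_surj:
  assumes "k \<in> Hom K (Sh K X) (Sh K Y)" "X \<in> Ob K" "Y \<in> Ob K"
  obtains f where "f \<in> Hom K X Y" "ShM K f = k"
proof -
  have "k \<in> ShM K ` Hom K X Y" using shift_ff[OF assms(2,3)] assms(1) by (simp add: bij_betw_def)
  then show ?thesis using that by blast
qed

lemma desuspend:
  assumes "Y \<in> Ob K"
  obtains X where "X \<in> Ob K" "isomorphic K (Sh K X) Y"
  using shift_es assms by blast

lemma triE:
  assumes "Tri K f g h"
  obtains X Y Z where "f \<in> Hom K X Y" "g \<in> Hom K Y Z" "h \<in> Hom K Z (Sh K X)"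
    "X \<in> Ob K" "Y \<in> Ob K" "Z \<in> Ob K"
proof -
  have t: "is_triangle K f g h" using assms tri_triangle by blast
  then have "f \<in> Mor K" and g': "g \<in> Hom K (Cod K f) (Dom K h)"
    and h: "h \<in> Hom K (Cod K g) (Sh K (Dom K f))"
    unfolding is_triangle_def by blast+
  then have f: "f \<in> Hom K (Dom K f) (Cod K f)" using mor_hom by blast
  have g: "g \<in> Hom K (Cod K f) (Cod K g)" using g' hom_cod[OF g'] by simp
  show ?thesis by (rule that[OF f g h hom_ob[OF f] hom_ob(2)[OF g]])
qed

lemma tri_homs:
  assumes "Tri K f g h" "f \<in> Hom K X Y"
  shows "g \<in> Hom K Y (Cod K g)" "h \<in> Hom K (Cod K g) (Sh K X)"
proof -
  obtain X' Y' Z where t: "f \<in> Hom K X' Y'" "g \<in> Hom K Y' Z" "h \<in> Hom K Z (Sh K X')"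
    using triE[OF assms(1)] .
  have "X' = X" "Y' = Y" "Cod K g = Z" using t assms(2) by (auto simp: Hom_def)
  then show "g \<in> Hom K Y (Cod K g)" "h \<in> Hom K (Cod K g) (Sh K X)" using t by auto
qed

lemma is_triangleI:
  "f \<in> Hom K X Y \<Longrightarrow> g \<in> Hom K Y Z \<Longrightarrow> h \<in> Hom K Z (Sh K X) \<Longrightarrow> is_triangle K f g h"
  by (auto simp: is_triangle_def Hom_def)

lemma tri_rot: "Tri K f g h \<Longrightarrow> Tri K g h (Neg K (ShM K f))"
  using tri_rotate tri_triangle by blast

lemma tri_unrot:
  "Tri K g h (Neg K (ShM K f)) \<Longrightarrow> f \<in> Hom K X Y \<Longrightarrow> g \<in> Hom K Y Z \<Longrightarrow> h \<in> Hom K Z (Sh K X)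
    \<Longrightarrow> Tri K f g h"
  using tri_rotate is_triangleI by blast

text \<open>The identity triangle rotated backwards, with the zero object in front. Mapping a
  triangle into it turns a vanishing composite into a factorization.\<close>

lemma tri_idm': 
  assumes "X \<in> Ob K" "is_zero K Z" shows "Tri K (Zer K Z X) (Idm K X) (Zer K X (Sh K Z))"
proof (rule tri_unrot)
  note z = is_zero_ob[OF assms(2)]
  have sz: "is_zero K (Sh K Z)" using add_endo_zero[OF shift_functor assms(2)] .
  have "Neg K (ShM K (Zer K Z X)) = Zer K (Sh K Z) (Sh K X)"
    using assms z neg_zer by (simp add: cat)
  then show "Tri K (Idm K X) (Zer K X (Sh K Z)) (Neg K (ShM K (Zer K Z X)))"
    using tri_idm[OF assms(1) sz] by simp
qed (use assms is_zero_ob in \<open>auto intro: zer_hom idm_hom sh_ob\<close>)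

text \<open>Completing the pair \<open>Idm K X\<close>, \<open>f\<close> to a map from the triangle
  on \<open>Idm K X\<close> makes \<open>g \<cdot> f\<close> factor through a zero object.\<close>

lemma tri_cmp_zer:
  assumes "Tri K f g h" "f \<in> Hom K X Y" "g \<in> Hom K Y Z"
  shows "g \<cdot> f = Zer K X Z"
proof -
  obtain Z0 where Z0: "is_zero K Z0" "Z0 \<in> Ob K" by (rule zero_ob_ex)
  have X: "X \<in> Ob K" and Z: "Z \<in> Ob K" using assms hom_ob by blast+
  have h: "h \<in> Hom K Z (Sh K X)" using tri_homs[OF assms(1,2)] assms(3) by (simp add: Hom_def)
  have "\<exists>w \<in> Hom K (Dom K (Zer K Z0 (Sh K X))) (Dom K h). w \<cdot> Zer K X Z0 = g \<cdot> f \<and>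
      ShM K (Idm K X) \<cdot> Zer K Z0 (Sh K X) = h \<cdot> w"
    by (rule tri_fill[OF tri_idm[OF X Z0(1)] assms(1)]) (use assms X Z0 in \<open>simp_all add: cat\<close>)
  then obtain w where w: "w \<in> Hom K Z0 Z" "w \<cdot> Zer K X Z0 = g \<cdot> f"
    using h X Z0 by (auto simp: cat)
  then show ?thesis using X Z0 by (simp add: cat)
qed

lemma tri_factor_cone:
  assumes "Tri K f g h" "f \<in> Hom K X Y" "g \<in> Hom K Y Z" "x \<in> Hom K Y A" "x \<cdot> f = Zer K X A"
  obtains y where "y \<in> Hom K Z A" "y \<cdot> g = x"
proof -
  obtain Z0 where Z0: "is_zero K Z0" "Z0 \<in> Ob K" by (rule zero_ob_ex)
  have ob: "X \<in> Ob K" "Z \<in> Ob K" "A \<in> Ob K" "Y \<in> Ob K" using assms hom_ob by blast+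
  have h: "h \<in> Hom K Z (Sh K X)" using tri_homs[OF assms(1,2)] assms(3) by (simp add: Hom_def)
  have "\<exists>w \<in> Hom K (Dom K h) (Dom K (Zer K A (Sh K Z0))). w \<cdot> g = Idm K A \<cdot> x \<and>
      ShM K (Zer K X Z0) \<cdot> h = Zer K A (Sh K Z0) \<cdot> w"
    by (rule tri_fill[OF assms(1) tri_idm'[OF ob(3) Z0(1)]]) (use assms ob Z0 in \<open>simp_all add: cat\<close>)
  then obtain w where "w \<in> Hom K Z A" "w \<cdot> g = x"
    using h ob Z0 assms(4) by (auto simp: cat)
  then show ?thesis using that by blast
qed

text \<open>\<open>tri_fill\<close> supplies only third maps, so both triangles are rotated until
  the wanted map is the third one. It then lies between shifts and is brought down by full
  faithfulness of the shift.\<close>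

lemma tri_lift:
  assumes "Tri K f g h" "f \<in> Hom K X Y" "g \<in> Hom K Y Z" "x \<in> Hom K A Y" "g \<cdot> x = Zer K A Z"
  obtains y where "y \<in> Hom K A X" "f \<cdot> y = x"
proof -
  obtain Z0 where Z0: "is_zero K Z0" "Z0 \<in> Ob K" by (rule zero_ob_ex)
  have ob: "X \<in> Ob K" "Z \<in> Ob K" "A \<in> Ob K" "Y \<in> Ob K" using assms hom_ob by blast+
  have h: "h \<in> Hom K Z (Sh K X)" using tri_homs[OF assms(1,2)] assms(3) by (simp add: Hom_def)
  have "\<exists>w \<in> Hom K (Dom K (Neg K (ShM K (Idm K A)))) (Dom K (Neg K (ShM K f))).
      w \<cdot> Zer K Z0 (Sh K A) = h \<cdot> Zer K Z0 Z \<and>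
      ShM K x \<cdot> Neg K (ShM K (Idm K A)) = Neg K (ShM K f) \<cdot> w"
    by (rule tri_fill[OF tri_rot[OF tri_idm[OF ob(3) Z0(1)]] tri_rot[OF assms(1)]])
      (use assms ob Z0 h in \<open>simp_all add: cat\<close>)
  then obtain w where w: "w \<in> Hom K (Sh K A) (Sh K X)" "Neg K (ShM K x) = Neg K (ShM K f \<cdot> w)"
    using h ob Z0 assms(2,4) by (auto simp: cat)
  obtain y where y: "y \<in> Hom K A X" "ShM K y = w" using shm_surj[OF w(1) ob(3,1)] .
  have "ShM K x = ShM K f \<cdot> w"
    using arg_cong[OF w(2), of "Neg K"] w(1) assms by (simp add: cat)
  then have "ShM K (f \<cdot> y) = ShM K x" using y assms by (simp add: cat)
  then have "f \<cdot> y = x" using shm_inj cmp_hom[OF y(1) assms(2)] assms(4) by blast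
  with y show ?thesis using that by blast
qed

lemma tri_cmp_zer2:
  assumes "Tri K f g h" "g \<in> Hom K Y Z" "h \<in> Hom K Z W" shows "h \<cdot> g = Zer K Y W"
  using tri_cmp_zer[OF tri_rot[OF assms(1)] assms(2,3)] .

lemma tri_factor_shift:
  assumes "Tri K f g h" "g \<in> Hom K Y Z" "h \<in> Hom K Z W" "x \<in> Hom K Z A" "x \<cdot> g = Zer K Y A"
  obtains y where "y \<in> Hom K W A" "y \<cdot> h = x"
  using tri_factor_cone[OF tri_rot[OF assms(1)] assms(2-5)] .

lemma tri_lift2:
  assumes "Tri K f g h" "g \<in> Hom K Y Z" "h \<in> Hom K Z W" "x \<in> Hom K A Z" "h \<cdot> x = Zer K A W"
  obtains y where "y \<in> Hom K A Y" "g \<cdot> y = x"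
  using tri_lift[OF tri_rot[OF assms(1)] assms(2-5)] .

lemma tri_cmp_zer3:
  assumes "Tri K f g h" "f \<in> Hom K X Y" "h \<in> Hom K Z (Sh K X)" 
  shows "ShM K f \<cdot> h = Zer K Z (Sh K Y)"
proof -
  have n: "Neg K (ShM K f) \<in> Hom K (Sh K X) (Sh K Y)" using assms(2) neg_hom shm_hom by blast
  have "Neg K (ShM K f) \<cdot> h = Zer K Z (Sh K Y)"
    using tri_cmp_zer2[OF tri_rot[OF assms(1)] assms(3) n] .
  moreover have "Neg K (ShM K f) \<cdot> h = Neg K (ShM K f \<cdot> h)" using assms by (simp add: cat)
  ultimately show ?thesis
    using neg_eq_zer_iff cmp_hom[OF assms(3) shm_hom[OF assms(2)]] by metis
qed

lemma tri_cone_ex: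
  assumes "f \<in> Hom K X Y"
  obtains Z g h where "Tri K f g h" "g \<in> Hom K Y Z" "h \<in> Hom K Z (Sh K X)" "Z \<in> Ob K"
proof -
  obtain g h where t: "Tri K f g h" using tri_cone[OF hom_mor[OF assms]] by blast
  from t tri_homs[OF t assms] show ?thesis using that hom_ob by metis
qed

text \<open>A weak uniqueness of cones, sufficient because thick subcategories are closed under
  retracts. The comparison maps \<open>w\<close> and \<open>v\<close> need not be inverse to each
  other, but \<open>n = 1 - v w\<close> satisfies \<open>n g = 0\<close> and \<open>h n = 0\<close>.
  The first makes it factor through \<open>h\<close>, the second then gives \<open>n n = 0\<close>,
  so \<open>1 + n\<close> inverts \<open>v w\<close>.\<close>

lemma tri_cone_retract:
  assumes "Tri K f g h" "Tri K f g' h'" "f \<in> Hom K X Y" "g \<in> Hom K Y Z" "g' \<in> Hom K Y Z'"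
  shows "retract K Z Z'"
proof -
  have ob: "X \<in> Ob K" "Y \<in> Ob K" "Z \<in> Ob K" "Z' \<in> Ob K" using assms hom_ob by blast+
  have h: "h \<in> Hom K Z (Sh K X)" "h' \<in> Hom K Z' (Sh K X)"
    using tri_homs[OF assms(1,3)] tri_homs[OF assms(2,3)] assms by (auto simp: Hom_def)
  have "\<exists>w \<in> Hom K (Dom K h) (Dom K h'). w \<cdot> g = g' \<cdot> Idm K Y \<and> ShM K (Idm K X) \<cdot> h = h' \<cdot> w"
    by (rule tri_fill[OF assms(1,2)]) (use assms ob in \<open>simp_all add: cat\<close>)
  then obtain w where w: "w \<in> Hom K Z Z'" "w \<cdot> g = g'" "h' \<cdot> w = h"
    using ob h assms by (auto simp: cat)
  have "\<exists>w \<in> Hom K (Dom K h') (Dom K h). w \<cdot> g' = g \<cdot> Idm K Y \<and> ShM K (Idm K X) \<cdot> h' = h \<cdot> w"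
    by (rule tri_fill[OF assms(2,1)]) (use assms ob in \<open>simp_all add: cat\<close>)
  then obtain v where v: "v \<in> Hom K Z' Z" "v \<cdot> g' = g" "h \<cdot> v = h'"
    using ob h assms by (auto simp: cat)
  define n where "n = Add K (Idm K Z) (Neg K (v \<cdot> w))"
  have n: "n \<in> Hom K Z Z" unfolding n_def using v w ob by (simp add: cat)
  have "n \<cdot> g = Zer K Y Z" unfolding n_def using v w ob assms by (simp add: cat)
  then obtain y where y: "y \<in> Hom K (Sh K X) Z" "y \<cdot> h = n"
    using tri_factor_shift[OF assms(1,4) h(1) n] by blast
  have "h \<cdot> n = Zer K Z (Sh K X)"
    unfolding n_def using v w ob h cmp_reassoc[OF v(3,1) h(1)] by (simp add: cat)
  then have "n \<cdot> n = Zer K Z Z" using y h n ob by (metis cat_assoc cmp_zer_right hom_ob hom_dom hom_cod hom_mor)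
  moreover have "n \<cdot> n = Add K n (Neg K (n \<cdot> (v \<cdot> w)))"
    apply (subst (2) n_def) using v w ob n by (simp add: cat)
  ultimately have "n \<cdot> (v \<cdot> w) = n" using sub_eq_zer_iff[OF n cmp_hom[OF cmp_hom[OF w(1) v(1)] n]] by simp
  then have "Add K (Idm K Z) n \<cdot> (v \<cdot> w) = Add K (v \<cdot> w) n" using v w ob n by (simp add: cat)
  also have "\<dots> = Add K n (v \<cdot> w)" using add_comm cmp_hom n v w by blast
  also have "\<dots> = Idm K Z" unfolding n_def using sub_add idm_hom ob cmp_hom v w by blast
  finally have "(Add K (Idm K Z) n \<cdot> v) \<cdot> w = Idm K Z" using v w ob n by (simp add: cat)
  moreover have "Add K (Idm K Z) n \<cdot> v \<in> Hom K Z' Z"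
    using v n ob by (simp add: cat)
  ultimately show ?thesis unfolding retract_def using w by blast
qed

text \<open>The fiber is a desuspension of the cone. The sign in \<open>ShM K f\<close> cancels the
  one introduced by rotation, so that \<open>tri_unrot\<close> applies.\<close>

lemma tri_fiber_ex:
  assumes "g \<in> Hom K Y Z"
  obtains X f h where "Tri K f g h" "f \<in> Hom K X Y" "h \<in> Hom K Z (Sh K X)" "X \<in> Ob K"
proof -
  obtain W a b where t: "Tri K g a b" "a \<in> Hom K Z W" "b \<in> Hom K W (Sh K Y)" "W \<in> Ob K"
    using tri_cone_ex[OF assms] .
  obtain X where X: "X \<in> Ob K" "isomorphic K (Sh K X) W" using desuspend t(4) by blast
  obtain p q where p: "p \<in> Hom K (Sh K X) W" "q \<in> Hom K W (Sh K X)"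
    "q \<cdot> p = Idm K (Sh K X)" "p \<cdot> q = Idm K W" using X(2) by (rule isomorphicE)
  have Y: "Y \<in> Ob K" "Z \<in> Ob K" using assms hom_ob by blast+
  obtain f where f: "f \<in> Hom K X Y" "ShM K f = Neg K (b \<cdot> p)"
    using shm_surj[OF neg_hom[OF cmp_hom[OF p(1) t(3)]] X(1) Y(1)] by blast
  have "Tri K g (q \<cdot> a) (Neg K (ShM K f))"
  proof (rule tri_iso[OF t(1), where u = "Idm K Y" and v = "Idm K Z" and w = q])
    show "is_triangle K g (q \<cdot> a) (Neg K (ShM K f))"
      using assms cmp_hom[OF t(2) p(2)] neg_hom[OF shm_hom[OF f(1)]] by (rule is_triangleI)
    show "is_iso K q" using is_iso_iff[OF p(2)] p by blast
    show "is_iso K (Idm K Y)" "is_iso K (Idm K Z)"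
      using is_iso_iff[OF idm_hom[OF Y(1)]] is_iso_iff[OF idm_hom[OF Y(2)]]
        idm_hom[OF Y(1)] idm_left[OF idm_hom[OF Y(1)]]
        idm_hom[OF Y(2)] idm_left[OF idm_hom[OF Y(2)]] by blast+
  qed (use assms t p Y f X in \<open>simp_all add: cat\<close>)
  then have "Tri K f g (q \<cdot> a)" using tri_unrot f(1) assms cmp_hom[OF t(2) p(2)] by blast
  with f X p t show ?thesis using that cmp_hom by blast
qed

text \<open>A split monomorphism \<open>i\<close> has a cone with \<open>h = 0\<close>:
  \<open>ShM K i\<close> is split too and annihilates \<open>h\<close>. Hence \<open>g\<close> has a
  section, and the cone is the complement.\<close>

lemma retract_biproduct:
  assumes "retract K X S" shows "\<exists>Z. is_biproduct K X Z S"
proof -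
  obtain i p where i: "i \<in> Hom K X S" "p \<in> Hom K S X" "p \<cdot> i = Idm K X"
    using assms unfolding retract_def by blast
  obtain Z g h where t: "Tri K i g h" "g \<in> Hom K S Z" "h \<in> Hom K Z (Sh K X)" "Z \<in> Ob K"
    using tri_cone_ex[OF i(1)] .
  have ob: "X \<in> Ob K" "S \<in> Ob K" using i hom_ob by blast+
  have "ShM K p \<cdot> ShM K i = Idm K (Sh K X)"
    using i ob by (simp add: shm_cmp[OF i(1,2), symmetric] cat)
  then have "h = ShM K p \<cdot> (ShM K i \<cdot> h)"
    using cmp_reassoc[OF _ shm_hom[OF i(1)] shm_hom[OF i(2)], of "Idm K (Sh K X)" h] t ob
    by (simp add: cat)
  also have "\<dots> = Zer K Z (Sh K X)" using tri_cmp_zer3[OF t(1) i(1) t(3)] i t ob by (simp add: cat)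
  finally have h0: "h = Zer K Z (Sh K X)" .
  then have "h \<cdot> Idm K Z = Zer K Z (Sh K X)" using t by (simp add: cat)
  then obtain s where s: "s \<in> Hom K Z S" "g \<cdot> s = Idm K Z"
    using tri_lift2[OF t(1-3) idm_hom[OF t(4)]] by blast
  \<comment> \<open>Subtracting the component along \<open>i\<close> leaves a section of
    \<open>g\<close> that \<open>p\<close> annihilates.\<close>
  define j where "j = Add K s (Neg K (i \<cdot> (p \<cdot> s)))"
  have j: "j \<in> Hom K Z S" unfolding j_def using s i t by (simp add: cat)
  have gi: "g \<cdot> i = Zer K X Z" using tri_cmp_zer[OF t(1) i(1) t(2)] .
  have pj: "p \<cdot> j = Zer K Z X" unfolding j_def using s i t ob cmp_reassoc[OF i(3,1,2)] by (simp add: cat)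
  have gj: "g \<cdot> j = Idm K Z"
    unfolding j_def using s i t ob cmp_reassoc[OF gi i(1) t(2)] neg_zer by (simp add: cat)
  \<comment> \<open>The defect of the biproduct equation. It factors through \<open>i\<close> since
    \<open>g e = 0\<close>, and \<open>p e = 0\<close> then makes the factor vanish.\<close>
  define e where "e = Add K (Idm K S) (Neg K (Add K (i \<cdot> p) (j \<cdot> g)))"
  have e: "e \<in> Hom K S S" unfolding e_def using i j t ob by (simp add: cat)
  have "g \<cdot> e = Zer K S Z" unfolding e_def
    using i j t ob cmp_reassoc[OF gi i(1) t(2)] cmp_reassoc[OF gj j t(2)] by (simp add: cat)
  then obtain x where x: "x \<in> Hom K S X" "i \<cdot> x = e" using tri_lift[OF t(1) i(1) t(2) e] by blast
  have "p \<cdot> e = Zer K S X" unfolding e_def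
    using i j t ob cmp_reassoc[OF i(3,1,2)] cmp_reassoc[OF pj j i(2)] by (simp add: cat)
  moreover have "p \<cdot> e = x" using cmp_reassoc[OF i(3,1,2)] x ob by (auto simp: cat)
  ultimately have "e = Zer K S S" using x i ob by (simp add: cat)
  then have "Add K (i \<cdot> p) (j \<cdot> g) = Idm K S"
    using sub_eq_zer_iff[OF idm_hom[OF ob(2)], of "Add K (i \<cdot> p) (j \<cdot> g)"] i j t ob
    unfolding e_def by (simp add: cat)
  then show ?thesis unfolding is_biproduct_def using i j t ob gi pj gj by blast
qed

end

section \<open>Thick subcategories and coproducts\<close>

text \<open>An inclusion, so that it can be checked one morphism at a time; between objects it
  amounts to equality, by \<open>hom0_eq\<close>.\<close>

definition hom0 :: "('o, 'm, 'z) addcat_scheme \<Rightarrow> 'o \<Rightarrow> 'o \<Rightarrow> bool" where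
  "hom0 K X Y \<longleftrightarrow> Hom K X Y \<subseteq> {Zer K X Y}"

definition perp_right :: "('o, 'm, 'z) addcat_scheme \<Rightarrow> 'o set \<Rightarrow> 'o set" where
  "perp_right K S = {X \<in> Ob K. \<forall>Y \<in> S. hom0 K Y X}"

definition perp_left :: "('o, 'm, 'z) addcat_scheme \<Rightarrow> 'o set \<Rightarrow> 'o set" where
  "perp_left K S = {X \<in> Ob K. \<forall>Y \<in> S. hom0 K X Y}"

text \<open>\<open>hom0\<close> tests morphisms in degree zero only. Orthogonals are thick when the
  testing class is stable under shift and, up to isomorphism, under desuspension.\<close>

definition shift_closed :: "('o, 'm, 'z) tricat_scheme \<Rightarrow> 'o set \<Rightarrow> bool" where
  "shift_closed K S \<longleftrightarrow> S \<subseteq> Ob K \<and> (\<forall>X \<in> S. Sh K X \<in> S \<and> (\<exists>Y \<in> S. isomorphic K (Sh K Y) X))"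

context additive_category begin

lemma hom0_eq: "X \<in> Ob K \<Longrightarrow> Y \<in> Ob K \<Longrightarrow> hom0 K X Y \<longleftrightarrow> Hom K X Y = {Zer K X Y}"
  unfolding hom0_def using zer_hom by blast

lemma hom0D: "hom0 K X Y \<Longrightarrow> f \<in> Hom K X Y \<Longrightarrow> f = Zer K X Y"
  unfolding hom0_def by blast

lemma hom0_retract_left:
  assumes "retract K X X'" "hom0 K X' Y" shows "hom0 K X Y"
proof -
  obtain i p where ip: "i \<in> Hom K X X'" "p \<in> Hom K X' X" "p \<cdot> i = Idm K X"
    using assms(1) unfolding retract_def by blast
  have "f = Zer K X Y" if f: "f \<in> Hom K X Y" for f
  proof -
    have "f \<cdot> p = Zer K X' Y" using hom0D[OF assms(2)] cmp_hom[OF ip(2) f] by blast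
    moreover have "(f \<cdot> p) \<cdot> i = f" using cmp_assoc[OF ip(1,2) f] ip(3) idm_right[OF f] by simp
    ultimately show ?thesis using cmp_zer_left[OF ip(1) hom_ob(2)[OF f]] by simp
  qed
  then show ?thesis unfolding hom0_def by blast
qed

lemma hom0_retract_right:
  assumes "retract K Y Y'" "hom0 K X Y'" shows "hom0 K X Y"
proof -
  obtain i p where ip: "i \<in> Hom K Y Y'" "p \<in> Hom K Y' Y" "p \<cdot> i = Idm K Y"
    using assms(1) unfolding retract_def by blast
  have "f = Zer K X Y" if f: "f \<in> Hom K X Y" for f
  proof -
    have "i \<cdot> f = Zer K X Y'" using hom0D[OF assms(2)] cmp_hom[OF f ip(1)] by blast
    moreover have "p \<cdot> (i \<cdot> f) = f" using cmp_assoc[OF f ip(1,2)] ip(3) idm_left[OF f] by simp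
    ultimately show ?thesis using cmp_zer_right[OF ip(2) hom_ob(1)[OF f]] by simp
  qed
  then show ?thesis unfolding hom0_def by blast
qed

lemma hom0_self_zero: "X \<in> Ob K \<Longrightarrow> hom0 K X X \<Longrightarrow> is_zero K X"
  unfolding is_zero_iff hom0_def using idm_hom by blast

text \<open>Meant for composition with a fixed morphism as \<open>\<phi>\<close>;
  \<open>finprod\<close> is a finite sum of morphisms here.\<close>

lemma finsum_additive:
  assumes "X \<in> Ob K" "Y \<in> Ob K" "X' \<in> Ob K" "Y' \<in> Ob K"
    and "\<And>x. x \<in> Hom K X Y \<Longrightarrow> \<phi> x \<in> Hom K X' Y'"
    and "\<And>x y. x \<in> Hom K X Y \<Longrightarrow> y \<in> Hom K X Y \<Longrightarrow> \<phi> (Add K x y) = Add K (\<phi> x) (\<phi> y)"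
    and "finite S" "\<And>k. k \<in> S \<Longrightarrow> a k \<in> Hom K X Y"
  shows "\<phi> (finprod (HomG K X Y) a S) = finprod (HomG K X' Y') (\<lambda>k. \<phi> (a k)) S"
proof -
  interpret A: comm_group "HomG K X Y" using hom_group assms by blast
  interpret B: comm_group "HomG K X' Y'" using hom_group assms by blast
  show ?thesis using assms(7,8)
  proof (induction S rule: finite_induct)
    case empty
    have "Zer K X Y \<in> Hom K X Y" using zer_hom assms by blast
    then have "\<phi> (Zer K X Y) = Zer K X' Y'"
      using self_add_zer[OF assms(5)] assms(6) add_zer_left by metis
    then show ?case by simp
  next
    case (insert k S)
    have "a \<in> S \<rightarrow> carrier (HomG K X Y)" "(\<lambda>k. \<phi> (a k)) \<in> S \<rightarrow> carrier (HomG K X' Y')"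
      using insert.prems assms(5) by auto
    moreover from this have "finprod (HomG K X Y) a S \<in> Hom K X Y"
      using A.finprod_closed by fastforce
    ultimately show ?case using insert assms(5,6) by simp
  qed
qed

end

section \<open>Coproducts and changes of their index set\<close>

context category begin

lemma coproduct_ob: "is_coproduct K I F P \<iota> \<Longrightarrow> P \<in> Ob K"
  unfolding is_coproduct_def by blast

lemma coproduct_hom: "is_coproduct K I F P \<iota> \<Longrightarrow> i \<in> I \<Longrightarrow> \<iota> i \<in> Hom K (F i) P"
  unfolding is_coproduct_def by blast

lemma coproduct_map:
  assumes "is_coproduct K I F P \<iota>" "T \<in> Ob K" "\<And>i. i \<in> I \<Longrightarrow> f i \<in> Hom K (F i) T"
  obtains u where "u \<in> Hom K P T" "\<And>i. i \<in> I \<Longrightarrow> u \<cdot> \<iota> i = f i"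
proof -
  have "\<exists>!u. u \<in> Hom K P T \<and> (\<forall>i \<in> I. u \<cdot> \<iota> i = f i)"
    using assms unfolding is_coproduct_def by blast
  then show ?thesis using that by blast
qed

lemma coproduct_eqI:
  assumes "is_coproduct K I F P \<iota>" "u \<in> Hom K P T" "v \<in> Hom K P T"
    "\<And>i. i \<in> I \<Longrightarrow> u \<cdot> \<iota> i = v \<cdot> \<iota> i"
  shows "u = v"
proof -
  have "\<forall>i \<in> I. v \<cdot> \<iota> i \<in> Hom K (F i) T" using coproduct_hom[OF assms(1)] cmp_hom assms(3) by blast
  then have "\<exists>!u. u \<in> Hom K P T \<and> (\<forall>i \<in> I. u \<cdot> \<iota> i = v \<cdot> \<iota> i)"
    using assms(1) hom_ob(2)[OF assms(2)] unfolding is_coproduct_def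
    by (elim conjE, elim ballE[of _ _ T] allE[of _ "\<lambda>i. v \<cdot> \<iota> i"]) auto
  then show ?thesis using assms by blast
qed

lemma is_coproductI:
  assumes "P \<in> Ob K" "\<And>i. i \<in> I \<Longrightarrow> \<iota> i \<in> Hom K (F i) P"
    and "\<And>T f. T \<in> Ob K \<Longrightarrow> (\<And>i. i \<in> I \<Longrightarrow> f i \<in> Hom K (F i) T) \<Longrightarrow>
      \<exists>u \<in> Hom K P T. \<forall>i \<in> I. u \<cdot> \<iota> i = f i"
    and "\<And>T u v. u \<in> Hom K P T \<Longrightarrow> v \<in> Hom K P T \<Longrightarrow>
      (\<And>i. i \<in> I \<Longrightarrow> u \<cdot> \<iota> i = v \<cdot> \<iota> i) \<Longrightarrow> u = v"
  shows "is_coproduct K I F P \<iota>"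
  unfolding is_coproduct_def
proof (intro conjI ballI allI impI)
  fix T f assume T: "T \<in> Ob K" "\<forall>i \<in> I. f i \<in> Hom K (F i) T"
  then obtain u where u: "u \<in> Hom K P T" "\<forall>i \<in> I. u \<cdot> \<iota> i = f i" using assms(3)[of T f] by blast
  moreover have "v = u" if "v \<in> Hom K P T" "\<forall>i \<in> I. v \<cdot> \<iota> i = f i" for v
    using assms(4)[OF that(1) u(1)] that(2) u(2) by simp
  ultimately show "\<exists>!u. u \<in> Hom K P T \<and> (\<forall>i \<in> I. u \<cdot> \<iota> i = f i)" by blast
qed (fact assms)+

text \<open>Existence of coproducts, compactness and localizing subcategories are formulated for
  index sets inside the type \<open>'u\<close>; this moves coproducts to and from index sets of
  other types.\<close>

lemma coproduct_reindex:
  assumes "bij_betw e J I"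
  shows "is_coproduct K J (\<lambda>j. F (e j)) P (\<lambda>j. \<iota> (e j)) \<longleftrightarrow> is_coproduct K I F P \<iota>"
proof
  have e: "\<And>j. j \<in> J \<Longrightarrow> e j \<in> I" "\<And>i. i \<in> I \<Longrightarrow> \<exists>j\<in>J. i = e j"
    using assms unfolding bij_betw_def by auto
  define d where "d = inv_into J e"
  have d: "\<And>i. i \<in> I \<Longrightarrow> d i \<in> J \<and> e (d i) = i" "\<And>j. j \<in> J \<Longrightarrow> d (e j) = j"
    using assms unfolding d_def bij_betw_def by (auto simp: inv_into_into f_inv_into_f)
  {
    assume c: "is_coproduct K J (\<lambda>j. F (e j)) P (\<lambda>j. \<iota> (e j))"
    show "is_coproduct K I F P \<iota>"
    proof (rule is_coproductI)
      show "P \<in> Ob K" using coproduct_ob[OF c] .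
      show "\<iota> i \<in> Hom K (F i) P" if "i \<in> I" for i using coproduct_hom[OF c, of "d i"] d(1)[OF that] by simp
      show "\<exists>u \<in> Hom K P T. \<forall>i \<in> I. u \<cdot> \<iota> i = f i"
        if T: "T \<in> Ob K" and f: "\<And>i. i \<in> I \<Longrightarrow> f i \<in> Hom K (F i) T" for T f
      proof -
        obtain u where "u \<in> Hom K P T" "\<And>j. j \<in> J \<Longrightarrow> u \<cdot> \<iota> (e j) = f (e j)"
          using coproduct_map[OF c T, of "\<lambda>j. f (e j)"] f e by blast
        then show ?thesis using d by (metis)
      qed
      show "u = v" if "u \<in> Hom K P T" "v \<in> Hom K P T" "\<And>i. i \<in> I \<Longrightarrow> u \<cdot> \<iota> i = v \<cdot> \<iota> i" for T u v
        using coproduct_eqI[OF c that(1,2)] that(3) e by blast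
    qed
  }
  {
    assume c: "is_coproduct K I F P \<iota>"
    show "is_coproduct K J (\<lambda>j. F (e j)) P (\<lambda>j. \<iota> (e j))"
    proof (rule is_coproductI)
      show "P \<in> Ob K" using coproduct_ob[OF c] .
      show "\<iota> (e j) \<in> Hom K (F (e j)) P" if "j \<in> J" for j using coproduct_hom[OF c] e that by blast
      show "\<exists>u \<in> Hom K P T. \<forall>j \<in> J. u \<cdot> \<iota> (e j) = f j"
        if T: "T \<in> Ob K" and f: "\<And>j. j \<in> J \<Longrightarrow> f j \<in> Hom K (F (e j)) T" for T f
      proof -
        have "f (d i) \<in> Hom K (F i) T" if "i \<in> I" for i using f[of "d i"] d(1)[OF that] by simp
        then obtain u where "u \<in> Hom K P T" "\<And>i. i \<in> I \<Longrightarrow> u \<cdot> \<iota> i = f (d i)"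
          using coproduct_map[OF c T, of "\<lambda>i. f (d i)"] by blast
        then show ?thesis using d e by metis
      qed
      show "u = v" if "u \<in> Hom K P T" "v \<in> Hom K P T"
        "\<And>j. j \<in> J \<Longrightarrow> u \<cdot> \<iota> (e j) = v \<cdot> \<iota> (e j)" for T u v
        using coproduct_eqI[OF c that(1,2)] that(3) e by metis
    qed
  }
qed

end

context additive_category begin

text \<open>Zero morphisms supply the off-diagonal components of the projections.\<close>

lemma coproduct_proj:
  assumes "is_coproduct K I F P \<iota>" "\<And>i. i \<in> I \<Longrightarrow> F i \<in> Ob K"
  obtains \<pi> where "\<forall>i \<in> I. \<pi> i \<in> Hom K P (F i)"
    "\<forall>i \<in> I. \<forall>j \<in> I. \<pi> i \<cdot> \<iota> j = (if i = j then Idm K (F i) else Zer K (F j) (F i))"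
proof -
  have "\<exists>p. p \<in> Hom K P (F i) \<and> (\<forall>j \<in> I. p \<cdot> \<iota> j = (if i = j then Idm K (F i) else Zer K (F j) (F i)))"
    if "i \<in> I" for i
    using coproduct_map[OF assms(1) assms(2)[OF that], of "\<lambda>j. if i = j then Idm K (F i) else Zer K (F j) (F i)"]
      assms(2) that idm_hom zer_hom by (smt (verit))
  then show ?thesis using that by metis
qed

end

context triangulated_category begin

lemma hom0_sh:
  assumes "X \<in> Ob K" "Y \<in> Ob K" shows "hom0 K (Sh K X) (Sh K Y) \<longleftrightarrow> hom0 K X Y"
proof
  assume h: "hom0 K (Sh K X) (Sh K Y)"
  have "f = Zer K X Y" if "f \<in> Hom K X Y" for f
    using shm_inj[OF that zer_hom[OF assms]] hom0D[OF h shm_hom[OF that]] assms by (simp add: cat)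
  then show "hom0 K X Y" unfolding hom0_def by blast
next
  assume h: "hom0 K X Y"
  have "g = Zer K (Sh K X) (Sh K Y)" if g: "g \<in> Hom K (Sh K X) (Sh K Y)" for g
  proof -
    obtain f where f: "f \<in> Hom K X Y" "ShM K f = g" using shm_surj[OF g assms] .
    then have "g = ShM K (Zer K X Y)" using hom0D[OF h f(1)] by simp
    then show ?thesis using assms by (simp add: cat_shm)
  qed
  then show "hom0 K (Sh K X) (Sh K Y)" unfolding hom0_def by blast
qed

lemma hom0_ext_right:
  assumes "Tri K f g h" "f \<in> Hom K X Y" "g \<in> Hom K Y Z" "hom0 K A X" "hom0 K A Z"
  shows "hom0 K A Y"
proof -
  have "x = Zer K A Y" if x: "x \<in> Hom K A Y" for x
  proof -
    have "g \<cdot> x = Zer K A Z" using hom0D[OF assms(5)] cmp_hom[OF x assms(3)] by blast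
    then obtain y where y: "y \<in> Hom K A X" "f \<cdot> y = x" using tri_lift[OF assms(1-3) x] by blast
    then show ?thesis using hom0D[OF assms(4)] cmp_zer_right[OF assms(2)] hom_ob(1)[OF x] by metis
  qed
  then show ?thesis unfolding hom0_def by blast
qed

lemma hom0_ext_left:
  assumes "Tri K f g h" "f \<in> Hom K X Y" "g \<in> Hom K Y Z" "hom0 K X A" "hom0 K Z A"
  shows "hom0 K Y A"
proof -
  have "x = Zer K Y A" if x: "x \<in> Hom K Y A" for x
  proof -
    have "x \<cdot> f = Zer K X A" using hom0D[OF assms(4)] cmp_hom[OF assms(2) x] by blast
    then obtain y where y: "y \<in> Hom K Z A" "y \<cdot> g = x" using tri_factor_cone[OF assms(1-3) x] by blast
    then show ?thesis using hom0D[OF assms(5)] cmp_zer_left[OF assms(3)] hom_ob(2)[OF x] by metis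
  qed
  then show ?thesis unfolding hom0_def by blast
qed

section \<open>Thick subcategories and their closure properties\<close>

lemma thick_ob: "thick K T \<Longrightarrow> X \<in> T \<Longrightarrow> X \<in> Ob K"
  unfolding thick_def by blast

lemma thick_zero: "thick K T \<Longrightarrow> is_zero K Z \<Longrightarrow> Z \<in> T"
  unfolding thick_def by blast

lemma thick_sh: "thick K T \<Longrightarrow> X \<in> Ob K \<Longrightarrow> Sh K X \<in> T \<longleftrightarrow> X \<in> T"
  unfolding thick_def by blast

lemma thick_retract: "thick K T \<Longrightarrow> S \<in> T \<Longrightarrow> retract K X S \<Longrightarrow> X \<in> T"
  using retract_biproduct unfolding thick_def by blast

lemma thick_iso: "thick K T \<Longrightarrow> isomorphic K X Y \<Longrightarrow> X \<in> T \<longleftrightarrow> Y \<in> T"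
  using thick_retract isomorphic_retract isomorphic_sym by blast

lemma thick_cone:
  assumes "thick K T" "Tri K f g h" "f \<in> Hom K X Y" "g \<in> Hom K Y Z" "X \<in> T" "Y \<in> T"
  shows "Z \<in> T"
  using assms hom_dom[OF assms(3)] hom_cod[OF assms(3)] hom_cod[OF assms(4)]
  unfolding thick_def by metis

lemma thick_ext:
  assumes "thick K T" "Tri K f g h" "f \<in> Hom K X Y" "g \<in> Hom K Y Z" "X \<in> T" "Z \<in> T"
  shows "Y \<in> T"
proof -
  have h: "h \<in> Hom K Z (Sh K X)" using tri_homs[OF assms(2,3)] assms(4) by (simp add: Hom_def)
  have "Sh K Y \<in> T"
    using thick_cone[OF assms(1) tri_rot[OF tri_rot[OF assms(2)]] h] assms thick_sh[OF assms(1)]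
      hom_ob[OF assms(3)] neg_hom[OF shm_hom[OF assms(3)]] by blast
  then show ?thesis using thick_sh[OF assms(1)] hom_ob[OF assms(3)] by blast
qed

lemma thick_fiber:
  assumes "thick K T" "Tri K f g h" "f \<in> Hom K X Y" "g \<in> Hom K Y Z" "Y \<in> T" "Z \<in> T"
  shows "X \<in> T"
proof -
  have h: "h \<in> Hom K Z (Sh K X)" using tri_homs[OF assms(2,3)] assms(4) by (simp add: Hom_def)
  have "Sh K X \<in> T" using thick_cone[OF assms(1) tri_rot[OF assms(2)] assms(4) h] assms by blast
  then show ?thesis using thick_sh[OF assms(1)] hom_ob[OF assms(3)] by blast
qed

text \<open>Trades cones for extensions: the cone of a map from \<open>X\<close> to \<open>Y\<close>
  is the middle term of the rotated triangle, between \<open>Y\<close> and \<open>Sh K X\<close>.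
  Extensions are easier to check for orthogonals and preimages.\<close>

lemma thickI:
  assumes "T \<subseteq> Ob K" "T \<noteq> {}"
    and "\<And>X S. retract K X S \<Longrightarrow> S \<in> T \<Longrightarrow> X \<in> T"
    and "\<And>X. X \<in> Ob K \<Longrightarrow> Sh K X \<in> T \<longleftrightarrow> X \<in> T"
    and "\<And>f g h X Y Z. Tri K f g h \<Longrightarrow> f \<in> Hom K X Y \<Longrightarrow> g \<in> Hom K Y Z \<Longrightarrow> X \<in> T \<Longrightarrow> Z \<in> T \<Longrightarrow> Y \<in> T"
  shows "thick K T"
  unfolding thick_def
proof (intro conjI allI impI ballI)
  show "T \<subseteq> Ob K" by fact
  fix Z assume Z: "is_zero K Z"
  obtain X where X: "X \<in> T" using assms(2) by blast
  have ob: "Z \<in> Ob K" "X \<in> Ob K" using is_zero_ob[OF Z] X assms(1) by blast+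
  have "Zer K X Z \<cdot> Zer K Z X = Idm K Z"
    using Z ob unfolding is_zero_iff by (simp add: cat)
  then have "retract K Z X" unfolding retract_def using zer_hom ob by blast
  then show "Z \<in> T" using assms(3) X by blast
next
  fix X assume "X \<in> Ob K" then show "Sh K X \<in> T \<longleftrightarrow> X \<in> T" by (rule assms(4))
next
  fix f g h assume t: "Tri K f g h" "Dom K f \<in> T" "Cod K f \<in> T"
  obtain X Y Z where o: "f \<in> Hom K X Y" "g \<in> Hom K Y Z" "h \<in> Hom K Z (Sh K X)" "X \<in> Ob K"
    using triE[OF t(1)] .
  have "Z \<in> T"
    using assms(5)[OF tri_rot[OF t(1)] o(2,3)] t hom_dom[OF o(1)] hom_cod[OF o(1)] assms(4)[OF o(4)] by simp
  then show "Cod K g \<in> T" using hom_cod[OF o(2)] by simp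
next
  fix X Y S assume "is_biproduct K X Y S" "S \<in> T"
  then show "X \<in> T" using assms(3) is_biproduct_retract by blast
qed

text \<open>The cone of the inclusion of \<open>X\<close> should be \<open>Y\<close>; a retract of
  \<open>Y\<close> is enough to show that thick subcategories contain biproducts of their objects.
  The map \<open>a\<close> induced by \<open>q\<close> has the left inverse \<open>g j\<close>: the
  difference \<open>g j a - 1\<close> kills \<open>g\<close>, so it factors through
  \<open>h\<close>, and \<open>h\<close> is zero because the inclusion splits.\<close>

lemma tri_biproduct_retract:
  assumes "is_biproduct K X Y S"
  obtains f g h Z where "Tri K f g h" "f \<in> Hom K X S" "g \<in> Hom K S Z" "retract K Z Y"
proof -
  obtain i j p q where i: "i \<in> Hom K X S" "j \<in> Hom K Y S" "p \<in> Hom K S X" "q \<in> Hom K S Y"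
    "p \<cdot> i = Idm K X" "q \<cdot> i = Zer K X Y" "Add K (i \<cdot> p) (j \<cdot> q) = Idm K S"
    using assms unfolding is_biproduct_def by blast
  obtain Z g h where t: "Tri K i g h" "g \<in> Hom K S Z" "h \<in> Hom K Z (Sh K X)" "Z \<in> Ob K"
    using tri_cone_ex[OF i(1)] .
  have ob: "X \<in> Ob K" "S \<in> Ob K" "Y \<in> Ob K" using i hom_ob by blast+
  obtain a where a: "a \<in> Hom K Z Y" "a \<cdot> g = q" using tri_factor_cone[OF t(1) i(1) t(2) i(4,6)] .
  have gi: "g \<cdot> i = Zer K X Z" using tri_cmp_zer[OF t(1) i(1) t(2)] .
  have "g = g \<cdot> Add K (i \<cdot> p) (j \<cdot> q)" using i t by (simp add: cat)
  also have "\<dots> = g \<cdot> (j \<cdot> q)" 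
    using i(1-4) t ob cmp_reassoc[OF gi i(1) t(2)] by (simp add: cat del: cat_unit)
  finally have gjq: "g \<cdot> (j \<cdot> q) = g" by simp
  define n where "n = Add K (g \<cdot> (j \<cdot> a)) (Neg K (Idm K Z))"
  have n: "n \<in> Hom K Z Z" unfolding n_def using i t a by (simp add: cat)
  have "n \<cdot> g = Zer K S Z" unfolding n_def using i(1-4) t a gjq by (simp add: cat)
  then obtain y where y: "y \<in> Hom K (Sh K X) Z" "y \<cdot> h = n"
    using tri_factor_shift[OF t(1-3) n] by blast
  have "ShM K p \<cdot> ShM K i = Idm K (Sh K X)"
    using i ob by (simp add: shm_cmp[OF i(1,3), symmetric] cat)
  then have "h = ShM K p \<cdot> (ShM K i \<cdot> h)"
    using cmp_reassoc[OF _ shm_hom[OF i(1)] shm_hom[OF i(3)], of "Idm K (Sh K X)" h] t ob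
    by (simp add: cat)
  also have "\<dots> = Zer K Z (Sh K X)" using tri_cmp_zer3[OF t(1) i(1) t(3)] i t ob by (simp add: cat)
  finally have "n = Zer K Z Z" using y t ob by (auto simp: cat)
  then have "g \<cdot> (j \<cdot> a) = Idm K Z" unfolding n_def
    using sub_eq_zer_iff[OF _ idm_hom[OF t(4)], of "g \<cdot> (j \<cdot> a)"] i t a by (simp add: cat)
  then have "(g \<cdot> j) \<cdot> a = Idm K Z" using i t a by (simp add: cat)
  then have "retract K Z Y" unfolding retract_def using a(1) cmp_hom[OF i(2) t(2)] by blast
  with that t i show ?thesis by blast
qed

lemma thick_biproduct:
  assumes "thick K T" "is_biproduct K X Y S"
  shows "S \<in> T \<longleftrightarrow> X \<in> T \<and> Y \<in> T"
proof
  assume "S \<in> T" then show "X \<in> T \<and> Y \<in> T"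
    using assms thick_retract is_biproduct_retract is_biproduct_sym by blast
next
  assume "X \<in> T \<and> Y \<in> T"
  moreover obtain f g h Z where "Tri K f g h" "f \<in> Hom K X S" "g \<in> Hom K S Z" "retract K Z Y"
    using tri_biproduct_retract[OF assms(2)] .
  ultimately show "S \<in> T" using thick_ext[OF assms(1)] thick_retract[OF assms(1)] by blast
qed

lemma thick_Ob: "thick K (Ob K)"
  by (rule thickI) (use hom_ob zero_ob_ex sh_ob in \<open>auto simp: retract_def\<close>)

lemma thick_Inter:
  assumes "\<And>T. T \<in> M \<Longrightarrow> thick K T" "M \<noteq> {}" shows "thick K (\<Inter>M)"
proof (rule thickI)
  obtain T where "T \<in> M" using assms(2) by blast
  then show "\<Inter>M \<subseteq> Ob K" using assms(1) thick_ob by blast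
  obtain Z where "is_zero K Z" using zero_ob_ex .
  then show "\<Inter>M \<noteq> {}" using thick_zero assms(1) by blast
  show "X \<in> \<Inter>M" if "retract K X S" "S \<in> \<Inter>M" for X S using that thick_retract assms(1) by blast
  show "Sh K X \<in> \<Inter>M \<longleftrightarrow> X \<in> \<Inter>M" if "X \<in> Ob K" for X using thick_sh[OF assms(1) that] by blast
  show "Y \<in> \<Inter>M" if "Tri K f g h" "f \<in> Hom K X Y" "g \<in> Hom K Y Z" "X \<in> \<Inter>M" "Z \<in> \<Inter>M" for f g h X Y Z
    using that thick_ext[OF assms(1) that(1-3)] by blast
qed

lemma thick_preimage:
  assumes "is_exact_endofunctor K F \<Phi>" "thick K T" shows "thick K {X \<in> Ob K. F X \<in> T}"
proof (rule thickI)
  have add: "is_additive_endofunctor K F \<Phi>" using assms(1) unfolding is_exact_endofunctor_def by blast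
  obtain \<theta> where \<theta>: "\<And>X. X \<in> Ob K \<Longrightarrow> \<theta> X \<in> Hom K (F (Sh K X)) (Sh K (F X)) \<and> is_iso K (\<theta> X)"
    "\<And>f g h. Tri K f g h \<Longrightarrow> Tri K (\<Phi> f) (\<Phi> g) (\<theta> (Dom K f) \<cdot> \<Phi> h)"
    using assms(1) unfolding is_exact_endofunctor_def by blast
  show "{X \<in> Ob K. F X \<in> T} \<subseteq> Ob K" by blast
  obtain Z where "is_zero K Z" "Z \<in> Ob K" using zero_ob_ex .
  then show "{X \<in> Ob K. F X \<in> T} \<noteq> {}" using thick_zero[OF assms(2)] add_endo_zero[OF add] by blast
  show "X \<in> {X \<in> Ob K. F X \<in> T}" if "retract K X S" "S \<in> {X \<in> Ob K. F X \<in> T}" for X S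
    using that thick_retract[OF assms(2)] add_endo_retract[OF add that(1)] hom_ob
    unfolding retract_def by blast
  show "Sh K X \<in> {X \<in> Ob K. F X \<in> T} \<longleftrightarrow> X \<in> {X \<in> Ob K. F X \<in> T}" if X: "X \<in> Ob K" for X
  proof -
    have "isomorphic K (F (Sh K X)) (Sh K (F X))" unfolding isomorphic_def using \<theta>(1)[OF X] by blast
    then show ?thesis
      using thick_iso[OF assms(2)] thick_sh[OF assms(2) add_endo_ob[OF add X]] sh_ob[OF X] X by blast
  qed
  show "Y \<in> {X \<in> Ob K. F X \<in> T}" if t: "Tri K f g h" "f \<in> Hom K X Y" "g \<in> Hom K Y Z"
    "X \<in> {X \<in> Ob K. F X \<in> T}" "Z \<in> {X \<in> Ob K. F X \<in> T}" for f g h X Y Z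
    using thick_ext[OF assms(2) \<theta>(2)[OF t(1)] add_endo_hom[OF add t(2)] add_endo_hom[OF add t(3)]]
      t hom_ob by blast
qed

lemma thick_is_zero: "thick K {Z. is_zero K Z}"
proof (rule thickI)
  show "{Z. is_zero K Z} \<subseteq> Ob K" using is_zero_ob by blast
  show "{Z. is_zero K Z} \<noteq> {}" using zero_object by blast
  show "X \<in> {Z. is_zero K Z}" if "retract K X S" "S \<in> {Z. is_zero K Z}" for X S
    using that retract_zero by blast
  show "Sh K X \<in> {Z. is_zero K Z} \<longleftrightarrow> X \<in> {Z. is_zero K Z}" if "X \<in> Ob K" for X
    using that hom0_sh[OF that that] hom0_self_zero sh_ob is_zero_into unfolding hom0_def by blast
  show "Y \<in> {Z. is_zero K Z}" if t: "Tri K f g h" "f \<in> Hom K X Y" "g \<in> Hom K Y Z"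
    "X \<in> {Z. is_zero K Z}" "Z \<in> {Z. is_zero K Z}" for f g h X Y Z
    using hom0_ext_right[OF t(1-3), of Y] t hom0_self_zero[of Y] hom_ob is_zero_into
    unfolding hom0_def by blast
qed

lemma thick_shift_closed:
  assumes "thick K T" shows "shift_closed K T"
  unfolding shift_closed_def
proof (intro conjI ballI)
  show "T \<subseteq> Ob K" using assms thick_ob by blast
  fix X assume X: "X \<in> T"
  then have "X \<in> Ob K" using assms thick_ob by blast
  then show "Sh K X \<in> T" using thick_sh[OF assms] X by blast
  obtain Y where Y: "Y \<in> Ob K" "isomorphic K (Sh K Y) X" using desuspend[OF \<open>X \<in> Ob K\<close>] .
  then have "Y \<in> T" using thick_iso[OF assms] thick_sh[OF assms] X by blast
  with Y show "\<exists>Y \<in> T. isomorphic K (Sh K Y) X" by blast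
qed

lemma thick_perp_right:
  assumes "shift_closed K S" shows "thick K (perp_right K S)"
proof (rule thickI)
  have S: "S \<subseteq> Ob K" using assms unfolding shift_closed_def by blast
  show "perp_right K S \<subseteq> Ob K" unfolding perp_right_def by blast
  obtain Z where "is_zero K Z" "Z \<in> Ob K" using zero_ob_ex .
  then have "Z \<in> perp_right K S" unfolding perp_right_def hom0_def using is_zero_into by blast
  then show "perp_right K S \<noteq> {}" by blast
  show "X \<in> perp_right K S" if "retract K X Y" "Y \<in> perp_right K S" for X Y
    using that hom0_retract_right[OF that(1)] hom_ob unfolding perp_right_def retract_def by blast
  show "Sh K X \<in> perp_right K S \<longleftrightarrow> X \<in> perp_right K S" if X: "X \<in> Ob K" for X
  proof
    assume h: "Sh K X \<in> perp_right K S"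
    then show "X \<in> perp_right K S" using assms S X hom0_sh unfolding perp_right_def shift_closed_def by blast
  next
    assume h: "X \<in> perp_right K S"
    have "hom0 K Y (Sh K X)" if Y: "Y \<in> S" for Y
    proof -
      obtain W where W: "W \<in> S" "isomorphic K (Sh K W) Y" using assms Y unfolding shift_closed_def by blast
      then have "hom0 K (Sh K W) (Sh K X)" using hom0_sh h S X unfolding perp_right_def by blast
      then show ?thesis using hom0_retract_left[OF isomorphic_retract[OF isomorphic_sym[OF W(2)]]] by blast
    qed
    then show "Sh K X \<in> perp_right K S" unfolding perp_right_def using X sh_ob by blast
  qed
  show "Y \<in> perp_right K S" if t: "Tri K f g h" "f \<in> Hom K X Y" "g \<in> Hom K Y Z"
    "X \<in> perp_right K S" "Z \<in> perp_right K S" for f g h X Y Z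
    using hom0_ext_right[OF t(1-3)] t hom_ob unfolding perp_right_def by blast
qed

lemma thick_perp_left:
  assumes "shift_closed K S" shows "thick K (perp_left K S)"
proof (rule thickI)
  have S: "S \<subseteq> Ob K" using assms unfolding shift_closed_def by blast
  show "perp_left K S \<subseteq> Ob K" unfolding perp_left_def by blast
  obtain Z where "is_zero K Z" "Z \<in> Ob K" using zero_ob_ex .
  then have "Z \<in> perp_left K S" unfolding perp_left_def hom0_def using is_zero_from by blast
  then show "perp_left K S \<noteq> {}" by blast
  show "X \<in> perp_left K S" if "retract K X Y" "Y \<in> perp_left K S" for X Y
    using that hom0_retract_left[OF that(1)] hom_ob unfolding perp_left_def retract_def by blast
  show "Sh K X \<in> perp_left K S \<longleftrightarrow> X \<in> perp_left K S" if X: "X \<in> Ob K" for X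
  proof
    assume h: "Sh K X \<in> perp_left K S"
    then show "X \<in> perp_left K S" using assms S X hom0_sh unfolding perp_left_def shift_closed_def by blast
  next
    assume h: "X \<in> perp_left K S"
    have "hom0 K (Sh K X) Y" if Y: "Y \<in> S" for Y
    proof -
      obtain W where W: "W \<in> S" "isomorphic K (Sh K W) Y" using assms Y unfolding shift_closed_def by blast
      then have "hom0 K (Sh K X) (Sh K W)" using hom0_sh h S X unfolding perp_left_def by blast
      then show ?thesis using hom0_retract_right[OF isomorphic_retract[OF isomorphic_sym[OF W(2)]]] by blast
    qed
    then show "Sh K X \<in> perp_left K S" unfolding perp_left_def using X sh_ob by blast
  qed
  show "Y \<in> perp_left K S" if t: "Tri K f g h" "f \<in> Hom K X Y" "g \<in> Hom K Y Z"
    "X \<in> perp_left K S" "Z \<in> perp_left K S" for f g h X Y Z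
    using hom0_ext_left[OF t(1-3)] t hom_ob unfolding perp_left_def by blast
qed

text \<open>An equivalence preserves coproducts. Full faithfulness speaks of shifted objects only,
  so the target \<open>T\<close> is first replaced by an isomorphic \<open>Sh K W\<close>.\<close>

lemma coproduct_shift:
  assumes "is_coproduct K I F P \<iota>" "\<And>i. i \<in> I \<Longrightarrow> F i \<in> Ob K"
  shows "is_coproduct K I (\<lambda>i. Sh K (F i)) (Sh K P) (\<lambda>i. ShM K (\<iota> i))"
proof (rule is_coproductI)
  note P = coproduct_ob[OF assms(1)] and \<iota> = coproduct_hom[OF assms(1)]
  show "Sh K P \<in> Ob K" using P sh_ob by blast
  show "ShM K (\<iota> i) \<in> Hom K (Sh K (F i)) (Sh K P)" if "i \<in> I" for i using shm_hom \<iota> that by blast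
  show "\<exists>u \<in> Hom K (Sh K P) T. \<forall>i \<in> I. u \<cdot> ShM K (\<iota> i) = f i"
    if T: "T \<in> Ob K" and f: "\<And>i. i \<in> I \<Longrightarrow> f i \<in> Hom K (Sh K (F i)) T" for T f
  proof -
    obtain W where W: "W \<in> Ob K" "isomorphic K (Sh K W) T" using desuspend[OF T] .
    obtain p q where p: "p \<in> Hom K (Sh K W) T" "q \<in> Hom K T (Sh K W)" "p \<cdot> q = Idm K T"
      using W(2) by (rule isomorphicE)
    have "\<exists>a. a \<in> Hom K (F i) W \<and> ShM K a = q \<cdot> f i" if "i \<in> I" for i
      using shm_surj[OF cmp_hom[OF f[OF that] p(2)] assms(2)[OF that] W(1)] by blast
    then obtain a where a: "\<And>i. i \<in> I \<Longrightarrow> a i \<in> Hom K (F i) W" "\<And>i. i \<in> I \<Longrightarrow> ShM K (a i) = q \<cdot> f i"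
      by metis
    obtain u where u: "u \<in> Hom K P W" "\<And>i. i \<in> I \<Longrightarrow> u \<cdot> \<iota> i = a i"
      using coproduct_map[OF assms(1) W(1) a(1)] by blast
    have "(p \<cdot> ShM K u) \<cdot> ShM K (\<iota> i) = f i" if i: "i \<in> I" for i
    proof -
      have "(p \<cdot> ShM K u) \<cdot> ShM K (\<iota> i) = p \<cdot> ShM K (u \<cdot> \<iota> i)"
        using cmp_assoc[OF shm_hom[OF \<iota>[OF i]] shm_hom[OF u(1)] p(1)] shm_cmp[OF \<iota>[OF i] u(1)] by simp
      also have "\<dots> = (p \<cdot> q) \<cdot> f i" using u(2)[OF i] a(2)[OF i] cmp_assoc[OF f[OF i] p(2,1)] by simp
      finally show ?thesis using p(3) idm_left[OF f[OF i]] by simp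
    qed
    then show ?thesis using cmp_hom[OF shm_hom[OF u(1)] p(1)] by blast
  qed
  show "u = v" if uv: "u \<in> Hom K (Sh K P) T" "v \<in> Hom K (Sh K P) T"
    and eq: "\<And>i. i \<in> I \<Longrightarrow> u \<cdot> ShM K (\<iota> i) = v \<cdot> ShM K (\<iota> i)" for T u v
  proof -
    have T: "T \<in> Ob K" using uv hom_ob by blast
    obtain W where W: "W \<in> Ob K" "isomorphic K (Sh K W) T" using desuspend[OF T] .
    obtain p q where p: "p \<in> Hom K (Sh K W) T" "q \<in> Hom K T (Sh K W)" "p \<cdot> q = Idm K T"
      using W(2) by (rule isomorphicE)
    obtain a where a: "a \<in> Hom K P W" "ShM K a = q \<cdot> u" using shm_surj[OF cmp_hom[OF uv(1) p(2)] P W(1)] .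
    obtain b where b: "b \<in> Hom K P W" "ShM K b = q \<cdot> v" using shm_surj[OF cmp_hom[OF uv(2) p(2)] P W(1)] .
    have "a \<cdot> \<iota> i = b \<cdot> \<iota> i" if i: "i \<in> I" for i
    proof (rule shm_inj)
      show "a \<cdot> \<iota> i \<in> Hom K (F i) W" "b \<cdot> \<iota> i \<in> Hom K (F i) W" using cmp_hom \<iota>[OF i] a b by blast+
      show "ShM K (a \<cdot> \<iota> i) = ShM K (b \<cdot> \<iota> i)"
        using shm_cmp[OF \<iota>[OF i] a(1)] shm_cmp[OF \<iota>[OF i] b(1)] a(2) b(2) eq[OF i]
          cmp_assoc[OF shm_hom[OF \<iota>[OF i]] uv(1) p(2)] cmp_assoc[OF shm_hom[OF \<iota>[OF i]] uv(2) p(2)]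
        by simp
    qed
    then have "a = b" using coproduct_eqI[OF assms(1) a(1) b(1)] by blast
    then have "q \<cdot> u = q \<cdot> v" using a b by simp
    then have "p \<cdot> (q \<cdot> u) = p \<cdot> (q \<cdot> v)" by simp
    then show ?thesis using cmp_reassoc[OF p(3,2,1)] uv by (simp add: cat)
  qed
qed

text \<open>The shift has no chosen inverse functor: summands and coproduct are desuspended up to
  isomorphism, and the injections are recovered by full faithfulness. This serves to show that
  shifts of compact objects are compact.\<close>

lemma coproduct_desuspend:
  assumes "is_coproduct K I F P \<iota>" "\<And>i. i \<in> I \<Longrightarrow> F i \<in> Ob K"
  obtains G Q j p q where "\<And>i. i \<in> I \<Longrightarrow> G i \<in> Ob K" "is_coproduct K I G Q j"
    "\<And>i. i \<in> I \<Longrightarrow> isomorphic K (Sh K (G i)) (F i)"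
    "p \<in> Hom K (Sh K Q) P" "q \<in> Hom K P (Sh K Q)" "q \<cdot> p = Idm K (Sh K Q)" "p \<cdot> q = Idm K P"
    "\<And>i. i \<in> I \<Longrightarrow> \<exists>a \<in> Hom K (Sh K (G i)) (F i). p \<cdot> ShM K (j i) = \<iota> i \<cdot> a"
proof -
  note P = coproduct_ob[OF assms(1)] and \<iota> = coproduct_hom[OF assms(1)]
  obtain Q where Q: "Q \<in> Ob K" "isomorphic K (Sh K Q) P" using desuspend[OF P] .
  obtain p q where p: "p \<in> Hom K (Sh K Q) P" "q \<in> Hom K P (Sh K Q)"
    "q \<cdot> p = Idm K (Sh K Q)" "p \<cdot> q = Idm K P" using Q(2) by (rule isomorphicE)
  have "\<exists>G. G \<in> Ob K \<and> isomorphic K (Sh K G) (F i)" if "i \<in> I" for i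
    using desuspend[OF assms(2)[OF that]] by metis
  then obtain G where G: "\<And>i. i \<in> I \<Longrightarrow> G i \<in> Ob K" "\<And>i. i \<in> I \<Longrightarrow> isomorphic K (Sh K (G i)) (F i)"
    by metis
  have "\<exists>a b. a \<in> Hom K (Sh K (G i)) (F i) \<and> b \<in> Hom K (F i) (Sh K (G i)) \<and>
    b \<cdot> a = Idm K (Sh K (G i)) \<and> a \<cdot> b = Idm K (F i)" if "i \<in> I" for i
    using G(2)[OF that] isomorphicE by metis
  then obtain a b where a: "\<And>i. i \<in> I \<Longrightarrow> a i \<in> Hom K (Sh K (G i)) (F i)"
    and b: "\<And>i. i \<in> I \<Longrightarrow> b i \<in> Hom K (F i) (Sh K (G i))"
    and ba: "\<And>i. i \<in> I \<Longrightarrow> b i \<cdot> a i = Idm K (Sh K (G i))"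
    and ab: "\<And>i. i \<in> I \<Longrightarrow> a i \<cdot> b i = Idm K (F i)" by metis
  have "\<exists>j. j \<in> Hom K (G i) Q \<and> ShM K j = q \<cdot> (\<iota> i \<cdot> a i)" if "i \<in> I" for i
    using shm_surj[OF cmp_hom[OF cmp_hom[OF a[OF that] \<iota>[OF that]] p(2)] G(1)[OF that] Q(1)] by metis
  then obtain j where j: "\<And>i. i \<in> I \<Longrightarrow> j i \<in> Hom K (G i) Q"
    "\<And>i. i \<in> I \<Longrightarrow> ShM K (j i) = q \<cdot> (\<iota> i \<cdot> a i)" by metis
  have pj: "p \<cdot> ShM K (j i) = \<iota> i \<cdot> a i" if "i \<in> I" for i
    using cmp_reassoc[OF p(4,2,1)] j(2)[OF that] cmp_hom[OF a[OF that] \<iota>[OF that]] by (simp add: cat)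
  have "is_coproduct K I G Q j"
  proof (rule is_coproductI)
    show "Q \<in> Ob K" "\<And>i. i \<in> I \<Longrightarrow> j i \<in> Hom K (G i) Q" using Q j by auto
    show "\<exists>u \<in> Hom K Q T. \<forall>i \<in> I. u \<cdot> j i = f i"
      if T: "T \<in> Ob K" and f: "\<And>i. i \<in> I \<Longrightarrow> f i \<in> Hom K (G i) T" for T f
    proof -
      obtain u where u: "u \<in> Hom K P (Sh K T)" "\<And>i. i \<in> I \<Longrightarrow> u \<cdot> \<iota> i = ShM K (f i) \<cdot> b i"
        using coproduct_map[OF assms(1) sh_ob[OF T], of "\<lambda>i. ShM K (f i) \<cdot> b i"] cmp_hom[OF b shm_hom[OF f]]
        by blast
      obtain v where v: "v \<in> Hom K Q T" "ShM K v = u \<cdot> p"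
        using shm_surj[OF cmp_hom[OF p(1) u(1)] Q(1) T] .
      have "v \<cdot> j i = f i" if i: "i \<in> I" for i
      proof (rule shm_inj[OF cmp_hom[OF j(1)[OF i] v(1)] f[OF i]])
        have "ShM K (v \<cdot> j i) = u \<cdot> (p \<cdot> ShM K (j i))"
          using v j i cmp_assoc[OF shm_hom[OF j(1)[OF i]] p(1) u(1)] by (simp add: shm_cmp[OF j(1)[OF i] v(1)])
        also have "\<dots> = (u \<cdot> \<iota> i) \<cdot> a i" using pj[OF i] cmp_assoc[OF a[OF i] \<iota>[OF i] u(1)] by simp
        also have "\<dots> = ShM K (f i) \<cdot> (b i \<cdot> a i)"
          using u(2)[OF i] cmp_assoc[OF a[OF i] b[OF i] shm_hom[OF f[OF i]]] by simp
        also have "\<dots> = ShM K (f i)" using ba[OF i] idm_right[OF shm_hom[OF f[OF i]]] by simp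
        finally show "ShM K (v \<cdot> j i) = ShM K (f i)" .
      qed
      with v show ?thesis by blast
    qed
    show "u = v" if uv: "u \<in> Hom K Q T" "v \<in> Hom K Q T"
      and eq: "\<And>i. i \<in> I \<Longrightarrow> u \<cdot> j i = v \<cdot> j i" for T u v
    proof -
      have "ShM K w \<cdot> q \<cdot> \<iota> i = ShM K (w \<cdot> j i) \<cdot> b i" if i: "i \<in> I" and w: "w \<in> Hom K Q T" for w i
      proof -
        have "ShM K (w \<cdot> j i) \<cdot> b i = (ShM K w \<cdot> (q \<cdot> (\<iota> i \<cdot> a i))) \<cdot> b i"
          using shm_cmp[OF j(1)[OF i] w] j(2)[OF i] by simp
        also have "\<dots> = ShM K w \<cdot> (q \<cdot> (\<iota> i \<cdot> (a i \<cdot> b i)))"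
          using a[OF i] b[OF i] \<iota>[OF i] p shm_hom[OF w] by (simp add: cat)
        finally show ?thesis using ab[OF i] \<iota>[OF i] idm_right by simp
      qed
      then have "ShM K u \<cdot> q \<cdot> \<iota> i = ShM K v \<cdot> q \<cdot> \<iota> i" if "i \<in> I" for i using that uv eq by simp
      then have "(ShM K u \<cdot> q) \<cdot> \<iota> i = (ShM K v \<cdot> q) \<cdot> \<iota> i" if "i \<in> I" for i
        using that cmp_assoc[OF \<iota>[OF that] p(2) shm_hom[OF uv(1)]] cmp_assoc[OF \<iota>[OF that] p(2) shm_hom[OF uv(2)]]
        by simp
      then have "ShM K u \<cdot> q = ShM K v \<cdot> q"
        using coproduct_eqI[OF assms(1) cmp_hom[OF p(2) shm_hom[OF uv(1)]] cmp_hom[OF p(2) shm_hom[OF uv(2)]]]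
        by blast
      then have "(ShM K u \<cdot> q) \<cdot> p = (ShM K v \<cdot> q) \<cdot> p" by simp
      then have "ShM K u = ShM K v"
        using cmp_assoc[OF p(1,2) shm_hom[OF uv(1)]] cmp_assoc[OF p(1,2) shm_hom[OF uv(2)]] p(3)
          idm_right[OF shm_hom[OF uv(1)]] idm_right[OF shm_hom[OF uv(2)]] by simp
      then show ?thesis using shm_inj uv by blast
    qed
  qed
  then show ?thesis using that[OF G(1) _ G(2) p] pj a by blast
qed

end

section \<open>Localizing subcategories and compact objects\<close>

context triangulated_category begin

lemma localizingI:
  fixes \<kappa> :: "'u rel"
  assumes "thick K T"
    and "\<And>(I :: 'u set) F P \<iota>. small \<kappa> I \<Longrightarrow> (\<And>i. i \<in> I \<Longrightarrow> F i \<in> T) \<Longrightarrow> (\<And>i. i \<in> I \<Longrightarrow> F i \<in> Ob K) \<Longrightarrow>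
      is_coproduct K I F P \<iota> \<Longrightarrow> P \<in> T"
  shows "localizing \<kappa> K T"
  unfolding localizing_def using assms thick_ob[OF assms(1)] by blast

lemma localizing_thick: "localizing \<kappa> K T \<Longrightarrow> thick K T"
  unfolding localizing_def by blast

lemma localizing_coproduct:
  fixes \<kappa> :: "'u rel" and I :: "'u set"
  shows "localizing \<kappa> K T \<Longrightarrow> small \<kappa> I \<Longrightarrow> (\<And>i. i \<in> I \<Longrightarrow> F i \<in> T) \<Longrightarrow> is_coproduct K I F P \<iota> \<Longrightarrow> P \<in> T"
  unfolding localizing_def by blast

lemma localizing_Ob: "localizing \<kappa> K (Ob K)"
  by (rule localizingI[OF thick_Ob]) (rule coproduct_ob)

lemma localizing_Inter:
  assumes "\<And>T. T \<in> M \<Longrightarrow> localizing \<kappa> K T" "M \<noteq> {}" shows "localizing \<kappa> K (\<Inter>M)"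
proof (rule localizingI)
  show "thick K (\<Inter>M)" using thick_Inter assms localizing_thick by blast
  show "P \<in> \<Inter>M" if "small \<kappa> I" "\<And>i. i \<in> I \<Longrightarrow> F i \<in> \<Inter>M" "is_coproduct K I F P \<iota>"
    for I :: "'a set" and F P \<iota>
    using localizing_coproduct[OF assms(1) that(1) _ that(3)] that(2) by blast
qed

lemma localizing_Loc:
  assumes "S \<subseteq> Ob K" shows "localizing \<kappa> K (Loc \<kappa> K S)"
  unfolding Loc_def by (rule localizing_Inter) (use assms localizing_Ob in blast)+

lemma Loc_subset: "S \<subseteq> Loc \<kappa> K S"
  unfolding Loc_def by blast

lemma Loc_least: "localizing \<kappa> K T \<Longrightarrow> S \<subseteq> T \<Longrightarrow> Loc \<kappa> K S \<subseteq> T"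
  unfolding Loc_def by blast

text \<open>Maps out of a coproduct are determined by their components, so left orthogonals are
  closed under coproducts.\<close>

lemma localizing_perp_left:
  assumes "shift_closed K S" shows "localizing \<kappa> K (perp_left K S)"
proof (rule localizingI[OF thick_perp_left[OF assms]])
  fix I :: "'a set" and F P \<iota>
  assume h: "\<And>i. i \<in> I \<Longrightarrow> F i \<in> perp_left K S" "is_coproduct K I F P \<iota>"
  have "f = Zer K P Y" if Y: "Y \<in> S" and f: "f \<in> Hom K P Y" for Y f
  proof (rule coproduct_eqI[OF h(2) f])
    show "Zer K P Y \<in> Hom K P Y" using zer_hom hom_ob[OF f] by blast
    fix i assume i: "i \<in> I"
    have \<iota>: "\<iota> i \<in> Hom K (F i) P" using coproduct_hom[OF h(2) i] .
    have "f \<cdot> \<iota> i = Zer K (F i) Y"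
      using h(1)[OF i] Y hom0D cmp_hom[OF \<iota> f] unfolding perp_left_def by blast
    then show "f \<cdot> \<iota> i = Zer K P Y \<cdot> \<iota> i" using cmp_zer_left[OF \<iota> hom_ob(2)[OF f]] by simp
  qed
  then show "P \<in> perp_left K S"
    unfolding perp_left_def hom0_def using coproduct_ob[OF h(2)] by blast
qed

lemma localizing_preimage:
  fixes \<kappa> :: "'u rel"
  assumes "is_exact_endofunctor K F \<Phi>" "localizing \<kappa> K T"
    and "\<And>(I :: 'u set) G P \<iota>. small \<kappa> I \<Longrightarrow> (\<And>i. i \<in> I \<Longrightarrow> G i \<in> Ob K) \<Longrightarrow> is_coproduct K I G P \<iota> \<Longrightarrow>
      is_coproduct K I (\<lambda>i. F (G i)) (F P) (\<lambda>i. \<Phi> (\<iota> i))"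
  shows "localizing \<kappa> K {X \<in> Ob K. F X \<in> T}"
proof (rule localizingI[OF thick_preimage[OF assms(1) localizing_thick[OF assms(2)]]])
  fix I :: "'u set" and G P \<iota>
  assume h: "small \<kappa> I" "\<And>i. i \<in> I \<Longrightarrow> G i \<in> {X \<in> Ob K. F X \<in> T}" "is_coproduct K I G P \<iota>"
  have "F P \<in> T"
    using localizing_coproduct[OF assms(2) h(1) _ assms(3)[OF h(1) _ h(3)]] h(2) by blast
  then show "P \<in> {X \<in> Ob K. F X \<in> T}" using coproduct_ob[OF h(3)] by blast
qed

text \<open>A map into a coproduct is finitely supported if it factors through a finite
  subcoproduct; this is expressed by the maps out of the coproduct, which avoids sums.\<close>

definition supported_on :: "('i \<Rightarrow> 'o) \<Rightarrow> 'o \<Rightarrow> ('i \<Rightarrow> 'm) \<Rightarrow> 'o \<Rightarrow> 'm \<Rightarrow> 'i set \<Rightarrow> bool" where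
  "supported_on F P \<iota> C x S \<longleftrightarrow> (\<forall>T. \<forall>u \<in> Hom K P T.
     (\<forall>k \<in> S. u \<cdot> \<iota> k = Zer K (F k) T) \<longrightarrow> u \<cdot> x = Zer K C T)"

definition fin_supp :: "'i set \<Rightarrow> ('i \<Rightarrow> 'o) \<Rightarrow> 'o \<Rightarrow> ('i \<Rightarrow> 'm) \<Rightarrow> 'o \<Rightarrow> 'm \<Rightarrow> bool" where
  "fin_supp I F P \<iota> C x \<longleftrightarrow> (\<exists>S \<subseteq> I. finite S \<and> supported_on F P \<iota> C x S)"

lemma supported_onD:
  assumes "supported_on F P \<iota> C x S" "u \<in> Hom K P T" "\<And>k. k \<in> S \<Longrightarrow> u \<cdot> \<iota> k = Zer K (F k) T"
  shows "u \<cdot> x = Zer K C T"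
  using assms unfolding supported_on_def by blast

lemma fin_suppE:
  assumes "fin_supp I F P \<iota> C x"
  obtains S where "S \<subseteq> I" "finite S" "supported_on F P \<iota> C x S"
  using assms unfolding fin_supp_def by blast

lemma fin_suppI:
  assumes "S \<subseteq> I" "finite S"
    "\<And>T u. u \<in> Hom K P T \<Longrightarrow> (\<And>k. k \<in> S \<Longrightarrow> u \<cdot> \<iota> k = Zer K (F k) T) \<Longrightarrow> u \<cdot> x = Zer K C T"
  shows "fin_supp I F P \<iota> C x"
  using assms unfolding fin_supp_def supported_on_def by (intro exI[of _ S]) blast

text \<open>Off-diagonal terms vanish, so the projection reads off one entry of the sum. Injectivity
  of \<open>HomSum_map\<close> follows.\<close>

lemma HomSum_map_proj:
  assumes "is_coproduct K I F P \<iota>" "\<And>i. i \<in> I \<Longrightarrow> F i \<in> Ob K" "C \<in> Ob K"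
    and p: "p \<in> Hom K P (F k)" "k \<in> I"
      "\<And>j. j \<in> I \<Longrightarrow> p \<cdot> \<iota> j = (if k = j then Idm K (F k) else Zer K (F j) (F k))"
    and S: "finite S" "S \<subseteq> I" "\<And>j. j \<in> S \<Longrightarrow> a j \<in> Hom K C (F j)"
  shows "p \<cdot> finprod (HomG K C P) (\<lambda>j. \<iota> j \<cdot> a j) S = (if k \<in> S then a k else Zer K C (F k))"
proof -
  have P: "P \<in> Ob K" and Fk: "F k \<in> Ob K" using coproduct_ob assms by blast+
  interpret B: comm_group "HomG K C (F k)" using hom_group assms(3) Fk by blast
  have \<iota>: "\<iota> j \<in> Hom K (F j) P" if "j \<in> I" for j using coproduct_hom[OF assms(1) that] .
  have "p \<cdot> finprod (HomG K C P) (\<lambda>j. \<iota> j \<cdot> a j) S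
      = finprod (HomG K C (F k)) (\<lambda>j. p \<cdot> (\<iota> j \<cdot> a j)) S"
    by (rule finsum_additive[OF assms(3) P assms(3) Fk])
      (use cmp_hom[OF _ p(1)] cmp_add_right[OF _ _ p(1)] S \<iota> cmp_hom in blast)+
  also have "\<dots> = finprod (HomG K C (F k)) (\<lambda>j. if k = j then a j else Zer K C (F k)) S"
  proof (rule B.finprod_cong')
    show "(\<lambda>j. if k = j then a j else Zer K C (F k)) \<in> S \<rightarrow> carrier (HomG K C (F k))"
      using S zer_hom[OF assms(3) Fk] by auto
    fix j assume j: "j \<in> S"
    then have jI: "j \<in> I" using S by blast
    have "p \<cdot> (\<iota> j \<cdot> a j) = (p \<cdot> \<iota> j) \<cdot> a j" using cmp_assoc[OF S(3)[OF j] \<iota>[OF jI] p(1)] by simp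
    then show "p \<cdot> (\<iota> j \<cdot> a j) = (if k = j then a j else Zer K C (F k))"
      using p(3)[OF jI] idm_left[OF S(3)[OF j]] cmp_zer_left[OF S(3)[OF j] Fk] by simp
  qed simp
  also have "\<dots> = (if k \<in> S then a k else Zer K C (F k))"
  proof (cases "k \<in> S")
    case True
    have "finprod (HomG K C (F k)) (\<lambda>j. if k = j then a j else Zer K C (F k)) S
      = finprod (HomG K C (F k)) (\<lambda>j. if k = j then a k else Zer K C (F k)) S"
      by (rule B.finprod_cong') (use S True zer_hom[OF assms(3) Fk] in auto)
    then show ?thesis
      using B.finprod_singleton[OF True S(1), of "\<lambda>_. a k", unfolded HomG_simps] S(3)[OF True] True by simp
  next
    case False
    have "finprod (HomG K C (F k)) (\<lambda>j. if k = j then a j else Zer K C (F k)) S = Zer K C (F k)"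
      by (rule B.finprod_one_eqI[unfolded HomG_simps]) (use False in auto)
    then show ?thesis using False by simp
  qed
  finally show ?thesis .
qed

text \<open>Finite support suffices for compactness. The projections give injectivity. For
  surjectivity, \<open>e\<close> is the sum of the idempotents
  \<open>\<iota> k \<cdot> \<pi> k\<close> over the finite support \<open>S\<close>; then
  \<open>1 - e\<close> annihilates the injections from \<open>S\<close>, hence also
  \<open>x\<close>, and \<open>x = e x\<close> is the desired finite sum.\<close>

lemma compactI:
  fixes \<kappa> :: "'u rel"
  assumes "C \<in> Ob K" and "\<And>(I :: 'u set) F P \<iota> x. small \<kappa> I \<Longrightarrow> (\<And>i. i \<in> I \<Longrightarrow> F i \<in> Ob K) \<Longrightarrow>
    is_coproduct K I F P \<iota> \<Longrightarrow> x \<in> Hom K C P \<Longrightarrow> fin_supp I F P \<iota> C x"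
  shows "C \<in> compacts \<kappa> K"
  unfolding compacts_def
proof (intro CollectI conjI allI impI)
  show "C \<in> Ob K" by fact
  fix I :: "'u set" and F P \<iota>
  assume I: "small \<kappa> I" "\<forall>i \<in> I. F i \<in> Ob K" and c: "is_coproduct K I F P \<iota>"
  have F: "F i \<in> Ob K" if "i \<in> I" for i using I that by blast
  have P: "P \<in> Ob K" using coproduct_ob[OF c] .
  note \<iota> = coproduct_hom[OF c]
  obtain \<pi> where \<pi>': "\<forall>i \<in> I. \<pi> i \<in> Hom K P (F i)"
    "\<forall>i \<in> I. \<forall>j \<in> I. \<pi> i \<cdot> \<iota> j = (if i = j then Idm K (F i) else Zer K (F j) (F i))"
    using coproduct_proj[OF c F] by blast
  note \<pi> = \<pi>'(1)[rule_format] \<pi>'(2)[rule_format]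
  interpret G: comm_group "HomG K C P" using hom_group assms(1) P by blast
  interpret E: comm_group "HomG K P P" using hom_group P by blast
  have gC: "g i \<in> Hom K C (F i)" if "g \<in> HomSum K C I F" "i \<in> I" for g i
    using that unfolding HomSum_def by auto
  have proj: "\<pi> k \<cdot> HomSum_map K C I F P \<iota> g = g k" if g: "g \<in> HomSum K C I F" and k: "k \<in> I" for g k
    unfolding HomSum_map_def
    by (subst HomSum_map_proj[OF c F assms(1) \<pi>(1)[OF k] k \<pi>(2)[OF k]])
      (use g k gC[OF g] in \<open>auto simp: HomSum_def\<close>)
  show "bij_betw (HomSum_map K C I F P \<iota>) (HomSum K C I F) (Hom K C P)"
    unfolding bij_betw_def
  proof (intro conjI inj_onI equalityI subsetI)
    fix g g' assume g: "g \<in> HomSum K C I F" "g' \<in> HomSum K C I F"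
      and eq: "HomSum_map K C I F P \<iota> g = HomSum_map K C I F P \<iota> g'"
    have "g k = g' k" if "k \<in> I" for k using proj[OF g(1) that] proj[OF g(2) that] eq by simp
    moreover have "g \<in> extensional I" "g' \<in> extensional I"
      using g unfolding HomSum_def PiE_def by auto
    ultimately show "g = g'" using extensionalityI by blast
  next
    fix y assume "y \<in> HomSum_map K C I F P \<iota> ` HomSum K C I F"
    then obtain g where g: "g \<in> HomSum K C I F" "y = HomSum_map K C I F P \<iota> g" by blast
    have "(\<lambda>i. \<iota> i \<cdot> g i) \<in> {i \<in> I. g i \<noteq> Zer K C (F i)} \<rightarrow> carrier (HomG K C P)"
      using cmp_hom[OF gC[OF g(1)] \<iota>] by auto
    then show "y \<in> Hom K C P" using G.finprod_closed g(2) unfolding HomSum_map_def by fastforce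
  next
    fix x assume x: "x \<in> Hom K C P"
    obtain S where S: "S \<subseteq> I" "finite S"
      "supported_on F P \<iota> C x S"
      using assms(2)[OF I(1) F c x] by (rule fin_suppE)
    define e where "e = finprod (HomG K P P) (\<lambda>k. \<iota> k \<cdot> \<pi> k) S"
    have ip: "\<iota> k \<cdot> \<pi> k \<in> Hom K P P" if "k \<in> S" for k using cmp_hom[OF \<pi>(1) \<iota>] S(1) that by blast
    have e: "e \<in> Hom K P P" unfolding e_def
      using E.finprod_closed[of "\<lambda>k. \<iota> k \<cdot> \<pi> k" S] ip by auto
    have ecmp: "e \<cdot> y = finprod (HomG K A P) (\<lambda>k. \<iota> k \<cdot> (\<pi> k \<cdot> y)) S" if y: "y \<in> Hom K A P" for A y
    proof -
      have A: "A \<in> Ob K" using hom_ob[OF y] by blast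
      interpret H: comm_group "HomG K A P" using hom_group A P by blast
      have 1: "(\<iota> k \<cdot> \<pi> k) \<cdot> y = \<iota> k \<cdot> (\<pi> k \<cdot> y)" if "k \<in> S" for k
        using cmp_assoc[OF y \<pi>(1) \<iota>] S(1) that by blast
      have "e \<cdot> y = finprod (HomG K A P) (\<lambda>k. (\<iota> k \<cdot> \<pi> k) \<cdot> y) S"
        unfolding e_def
        by (rule finsum_additive[OF P P A P, where \<phi> = "\<lambda>z. z \<cdot> y"])
          (use cmp_hom[OF y] cmp_add_left[OF y] S ip in blast)+
      also have "\<dots> = finprod (HomG K A P) (\<lambda>k. \<iota> k \<cdot> (\<pi> k \<cdot> y)) S"
        by (rule H.finprod_cong') (use 1 cmp_hom[OF cmp_hom[OF y \<pi>(1)] \<iota>] S(1) in auto)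
      finally show ?thesis .
    qed
    have ei: "e \<cdot> \<iota> j = \<iota> j" if j: "j \<in> S" for j
    proof -
      have jI: "j \<in> I" using S(1) j by blast
      interpret H: comm_group "HomG K (F j) P" using hom_group F[OF jI] P by blast
      have "e \<cdot> \<iota> j = finprod (HomG K (F j) P) (\<lambda>k. if j = k then \<iota> k else Zer K (F j) P) S"
        unfolding ecmp[OF \<iota>[OF jI]]
      proof (rule H.finprod_cong')
        show "(\<lambda>k. if j = k then \<iota> k else Zer K (F j) P) \<in> S \<rightarrow> carrier (HomG K (F j) P)"
          using \<iota>[OF jI] zer_hom[OF F[OF jI] P] by auto
        fix k assume "k \<in> S"
        then have k: "k \<in> I" using S(1) by blast
        show "\<iota> k \<cdot> (\<pi> k \<cdot> \<iota> j) = (if j = k then \<iota> k else Zer K (F j) P)"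
          using \<pi>(2)[OF k jI] idm_right[OF \<iota>[OF k]] cmp_zer_right[OF \<iota>[OF k] F[OF jI]] by auto
      qed simp
      also have "\<dots> = finprod (HomG K (F j) P) (\<lambda>k. if j = k then \<iota> j else Zer K (F j) P) S"
        by (rule H.finprod_cong') (use \<iota>[OF jI] zer_hom[OF F[OF jI] P] in auto)
      also have "\<dots> = \<iota> j"
        using H.finprod_singleton[OF j S(2), of "\<lambda>_. \<iota> j", unfolded HomG_simps] \<iota>[OF jI] by simp
      finally show ?thesis .
    qed
    define d where "d = Add K (Idm K P) (Neg K e)"
    have d: "d \<in> Hom K P P" unfolding d_def using e P by (simp add: cat)
    have "d \<cdot> x = Zer K C P"
    proof (rule supported_onD[OF S(3) d])
      fix k assume "k \<in> S"
      then show "d \<cdot> \<iota> k = Zer K (F k) P"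
        unfolding d_def using ei[of k] \<iota>[of k] S(1) e P by (auto simp: cat)
    qed
    moreover have "d \<cdot> x = Add K x (Neg K (e \<cdot> x))" unfolding d_def using x e P by (simp add: cat)
    ultimately have xe: "x = e \<cdot> x" using sub_eq_zer_iff[OF x cmp_hom[OF x e]] by simp
    \<comment> \<open>Zero outside \<open>S\<close>, yet restricted to \<open>I\<close>, since
      \<open>HomSum\<close> consists of extensional functions.\<close>
    define g where "g = (\<lambda>k \<in> I. if k \<in> S then \<pi> k \<cdot> x else Zer K C (F k))"
    have gk: "g k = (if k \<in> S then \<pi> k \<cdot> x else Zer K C (F k))" if "k \<in> I" for k
      using that by (simp add: g_def)
    have gh: "g k \<in> Hom K C (F k)" if "k \<in> I" for k
      using that gk[OF that] cmp_hom[OF x \<pi>(1)[OF that]] zer_hom[OF assms(1) F[OF that]] by simp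
    have sub: "{i \<in> I. g i \<noteq> Zer K C (F i)} \<subseteq> S"
    proof
      fix i assume "i \<in> {i \<in> I. g i \<noteq> Zer K C (F i)}"
      then show "i \<in> S" using gk[of i] by (cases "i \<in> S") auto
    qed
    have g: "g \<in> HomSum K C I F"
      unfolding HomSum_def using gh sub S(2) finite_subset by (auto simp: g_def PiE_def)
    have "HomSum_map K C I F P \<iota> g = finprod (HomG K C P) (\<lambda>k. \<iota> k \<cdot> (\<pi> k \<cdot> x)) S"
      unfolding HomSum_map_def
    proof (rule G.finprod_mono_neutral_cong_left[OF S(2) sub])
      show "\<iota> i \<cdot> (\<pi> i \<cdot> x) = \<one>\<^bsub>HomG K C P\<^esub>" if i: "i \<in> S - {i \<in> I. g i \<noteq> Zer K C (F i)}" for i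
      proof -
        have iI: "i \<in> I" "i \<in> S" "g i = Zer K C (F i)" using i S(1) by auto
        then have "\<pi> i \<cdot> x = Zer K C (F i)" using gk[OF iI(1)] by simp
        then show ?thesis using cmp_zer_right[OF \<iota>[OF iI(1)] assms(1)] by simp
      qed
      show "\<iota> i \<cdot> g i = \<iota> i \<cdot> (\<pi> i \<cdot> x)" if "i \<in> {i \<in> I. g i \<noteq> Zer K C (F i)}" for i
        using that sub gk[of i] by auto
      show "(\<lambda>k. \<iota> k \<cdot> (\<pi> k \<cdot> x)) \<in> S \<rightarrow> carrier (HomG K C P)"
        using cmp_hom[OF cmp_hom[OF x \<pi>(1)] \<iota>] S(1) by auto
    qed
    also have "\<dots> = x" using ecmp[OF x] xe by simp
    finally show "x \<in> HomSum_map K C I F P \<iota> ` HomSum K C I F" using g by (metis image_eqI)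
  qed
qed

end

text \<open>A set of cardinality below \<open>\<kappa>\<close> injects into the field of
  \<open>\<kappa>\<close>, which lies in \<open>'u\<close>; its image serves as an index set of the
  required type.\<close>

lemma small_reindex:
  fixes \<kappa> :: "'u rel"
  assumes "Card_order \<kappa>" "small \<kappa> A"
  obtains I :: "'u set" and e where "small \<kappa> I" "bij_betw e I A"
proof -
  have A: "|A| <o \<kappa>" using assms(2) unfolding small_def .
  have "|A| \<le>o |Field \<kappa>|"
    using ordLeq_ordIso_trans[OF ordLess_imp_ordLeq[OF A] ordIso_symmetric[OF card_of_Field_ordIso[OF assms(1)]]] .
  then obtain f where f: "inj_on f A" "f ` A \<subseteq> Field \<kappa>" using card_of_ordLeq[of A "Field \<kappa>"] by blast
  have b: "bij_betw f A (f ` A)" using f(1) by (simp add: bij_betw_def)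
  have "small \<kappa> (f ` A)" unfolding small_def using ordLeq_ordLess_trans[OF card_of_image A] .
  then show ?thesis using that bij_betw_inv_into[OF b] by blast
qed

section \<open>Maps from compact objects into coproducts\<close>

context rigidly_compactly_generated begin

lemma compact_ob: "C \<in> compacts \<kappa> K \<Longrightarrow> C \<in> Ob K"
  unfolding compacts_def by blast

lemma coproduct_ex:
  assumes "small \<kappa> A" "\<And>i. i \<in> A \<Longrightarrow> F i \<in> Ob K"
  obtains P \<iota> where "is_coproduct K A F P \<iota>"
proof -
  obtain I :: "'u set" and e where e: "small \<kappa> I" "bij_betw e I A"
    using small_reindex[OF univ_card assms(1)] .
  obtain P \<iota> where c: "is_coproduct K I (\<lambda>i. F (e i)) P \<iota>"
    using coproducts[OF e(1), of "\<lambda>i. F (e i)"] assms(2) bij_betwE[OF e(2)] by blast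
  define d where "d = inv_into I e"
  have d: "bij_betw d A I" "\<And>a. a \<in> A \<Longrightarrow> e (d a) = a"
    using bij_betw_inv_into[OF e(2)] bij_betw_inv_into_right[OF e(2)] unfolding d_def by auto
  have "is_coproduct K A (\<lambda>a. F (e (d a))) P (\<lambda>a. \<iota> (d a))"
    using coproduct_reindex[OF d(1), of "\<lambda>i. F (e i)" P \<iota>] c by simp
  then have "is_coproduct K A F P (\<lambda>a. \<iota> (d a))"
    using d(2) unfolding is_coproduct_def by simp
  then show ?thesis using that by blast
qed

lemma localizing_coproduct':
  assumes "localizing \<kappa> K T" "small \<kappa> A" "\<And>i. i \<in> A \<Longrightarrow> F i \<in> T" "is_coproduct K A F P \<iota>"
  shows "P \<in> T"
proof -
  obtain I :: "'u set" and e where e: "small \<kappa> I" "bij_betw e I A"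
    using small_reindex[OF univ_card assms(2)] .
  show ?thesis
    using localizing_coproduct[OF assms(1) e(1)] coproduct_reindex[OF e(2)] assms(3,4) bij_betwE[OF e(2)]
    by metis
qed

text \<open>Surjectivity of \<open>HomSum_map\<close> as an induction rule: a map from a compact
  object into a coproduct is a finite sum of maps through single injections. The index set may have
  any type.\<close>

lemma compact_induct [consumes 5, case_names zer add inj]:
  assumes C: "C \<in> compacts \<kappa> K" and A: "small \<kappa> A" "is_coproduct K A F P \<iota>" and x: "x \<in> Hom K C P"
    and F: "\<forall>i \<in> A. F i \<in> Ob K"
    and "Q (Zer K C P)"
    and add: "\<And>x y. x \<in> Hom K C P \<Longrightarrow> y \<in> Hom K C P \<Longrightarrow> Q x \<Longrightarrow> Q y \<Longrightarrow> Q (Add K x y)"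
    and inj: "\<And>i a. i \<in> A \<Longrightarrow> a \<in> Hom K C (F i) \<Longrightarrow> Q (\<iota> i \<cdot> a)"
  shows "Q x"
proof -
  obtain I :: "'u set" and e where e: "small \<kappa> I" "bij_betw e I A"
    using small_reindex[OF univ_card A(1)] .
  let ?F = "\<lambda>i. F (e i)" and ?\<iota> = "\<lambda>i. \<iota> (e i)"
  have c: "is_coproduct K I ?F P ?\<iota>" using coproduct_reindex[OF e(2)] A(2) by blast
  have eA: "e i \<in> A" if "i \<in> I" for i using bij_betwE[OF e(2)] that by blast
  have b: "bij_betw (HomSum_map K C I ?F P ?\<iota>) (HomSum K C I ?F) (Hom K C P)"
  proof -
    have "\<forall>F P \<iota>. (\<forall>i \<in> I. F i \<in> Ob K) \<longrightarrow> is_coproduct K I F P \<iota> \<longrightarrow>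
        bij_betw (HomSum_map K C I F P \<iota>) (HomSum K C I F) (Hom K C P)"
      using C e(1) unfolding compacts_def by blast
    then show ?thesis using c F eA by simp
  qed
  obtain g where g: "g \<in> HomSum K C I ?F" "x = HomSum_map K C I ?F P ?\<iota> g"
    using b x unfolding bij_betw_def by blast
  interpret G: comm_group "HomG K C P" using hom_group compact_ob[OF C] coproduct_ob[OF A(2)] by blast
  have gh: "g i \<in> Hom K C (?F i)" if "i \<in> I" for i using g(1) that unfolding HomSum_def by auto
  have h: "?\<iota> i \<cdot> g i \<in> Hom K C P" if "i \<in> I" for i using cmp_hom[OF gh coproduct_hom[OF c]] that by blast
  have "finite S \<Longrightarrow> S \<subseteq> I \<Longrightarrow> finprod (HomG K C P) (\<lambda>i. ?\<iota> i \<cdot> g i) S \<in> Hom K C P \<and>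
      Q (finprod (HomG K C P) (\<lambda>i. ?\<iota> i \<cdot> g i) S)" for S
  proof (induction S rule: finite_induct)
    case empty then show ?case using assms(6) zer_hom compact_ob[OF C] coproduct_ob[OF A(2)] by simp
  next
    case (insert k S)
    have "(\<lambda>i. ?\<iota> i \<cdot> g i) \<in> S \<rightarrow> carrier (HomG K C P)" "?\<iota> k \<cdot> g k \<in> carrier (HomG K C P)"
      using h insert.prems by auto
    then have "finprod (HomG K C P) (\<lambda>i. ?\<iota> i \<cdot> g i) (insert k S)
      = Add K (?\<iota> k \<cdot> g k) (finprod (HomG K C P) (\<lambda>i. ?\<iota> i \<cdot> g i) S)"
      using G.finprod_insert[OF insert.hyps] by simp
    moreover have "Q (?\<iota> k \<cdot> g k)" using inj eA gh insert.prems by blast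
    ultimately show ?case using insert add h add_hom by simp
  qed
  moreover have "finite {i \<in> I. g i \<noteq> Zer K C (?F i)}" using g(1) unfolding HomSum_def by blast
  ultimately show ?thesis using g(2) unfolding HomSum_map_def by blast
qed

text \<open>Converse of \<open>compactI\<close>. Together they replace finite sums by a test with
  maps out of \<open>P\<close>, which is easier to carry through triangles.\<close>

lemma compact_fin_supp:
  assumes C: "C \<in> compacts \<kappa> K" and A: "small \<kappa> A" "is_coproduct K A F P \<iota>" and x: "x \<in> Hom K C P"
    and F: "\<And>i. i \<in> A \<Longrightarrow> F i \<in> Ob K"
  shows "fin_supp A F P \<iota> C x"
proof -
  have "\<forall>i \<in> A. F i \<in> Ob K" using F by blast
  with C A x show ?thesis
  proof (induction rule: compact_induct)
    case zer
    show ?case by (rule fin_suppI[of "{}"]) (use cmp_zer_right compact_ob[OF C] in blast)+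
  next
    case (add x y)
    obtain S where S: "S \<subseteq> A" "finite S"
      "supported_on F P \<iota> C x S"
      using add(3) by (rule fin_suppE)
    obtain S' where S': "S' \<subseteq> A" "finite S'"
      "supported_on F P \<iota> C y S'"
      using add(4) by (rule fin_suppE)
    show ?case
    proof (rule fin_suppI[of "S \<union> S'"])
      show "S \<union> S' \<subseteq> A" "finite (S \<union> S')" using S S' by auto
      fix T u assume u: "u \<in> Hom K P T" "\<And>k. k \<in> S \<union> S' \<Longrightarrow> u \<cdot> \<iota> k = Zer K (F k) T"
      have "u \<cdot> x = Zer K C T" "u \<cdot> y = Zer K C T"
        using supported_onD[OF S(3) u(1)] supported_onD[OF S'(3) u(1)] u(2) by blast+
      then show "u \<cdot> Add K x y = Zer K C T"
        using cmp_add_right[OF add(1,2) u(1)] add_zer_left[OF zer_hom[OF compact_ob[OF C] hom_ob(2)[OF u(1)]]]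
        by simp
    qed
  next
    case (inj i a)
    show ?case
    proof (rule fin_suppI[of "{i}"])
      fix T u assume u: "u \<in> Hom K P T" "\<And>k. k \<in> {i} \<Longrightarrow> u \<cdot> \<iota> k = Zer K (F k) T"
      have "u \<cdot> (\<iota> i \<cdot> a) = (u \<cdot> \<iota> i) \<cdot> a" using cmp_assoc[OF inj(2) coproduct_hom[OF A(2) inj(1)] u(1)] by simp
      then show "u \<cdot> (\<iota> i \<cdot> a) = Zer K C T" using u cmp_zer_left[OF inj(2) hom_ob(2)[OF u(1)]] by simp
    qed (use inj in auto)
  qed
qed

text \<open>Finite support makes the projections jointly injective on maps from \<open>C\<close>.
  Splitting off the summands of the support one after the other leaves \<open>x\<close> unchanged,
  as its projections vanish, and ends with an endomorphism that annihilates the support.\<close>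

lemma compact_proj_zero:
  assumes C: "C \<in> compacts \<kappa> K" and A: "small \<kappa> A" "is_coproduct K A F P \<iota>" and x: "x \<in> Hom K C P"
    and F: "\<And>i. i \<in> A \<Longrightarrow> F i \<in> Ob K"
    and p: "\<And>i. i \<in> A \<Longrightarrow> p i \<in> Hom K P (F i)"
      "\<And>i j. i \<in> A \<Longrightarrow> j \<in> A \<Longrightarrow> p i \<cdot> \<iota> j = (if i = j then Idm K (F i) else Zer K (F j) (F i))"
    and z: "\<And>i. i \<in> A \<Longrightarrow> p i \<cdot> x = Zer K C (F i)"
  shows "x = Zer K C P"
proof -
  have P: "P \<in> Ob K" using coproduct_ob[OF A(2)] .
  note \<iota> = coproduct_hom[OF A(2)]
  obtain S where S: "S \<subseteq> A" "finite S"
    "supported_on F P \<iota> C x S"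
    using compact_fin_supp[OF C A x F] by (rule fin_suppE)
  have "\<exists>d \<in> Hom K P P. (\<forall>j \<in> S. d \<cdot> \<iota> j = Zer K (F j) P) \<and> d \<cdot> x = x" using S(2,1)
  proof (induction S rule: finite_induct)
    case empty
    then show ?case using idm_hom[OF P] idm_left[OF x] by blast
  next
    case (insert k S)
    then obtain d where d: "d \<in> Hom K P P" "\<And>j. j \<in> S \<Longrightarrow> d \<cdot> \<iota> j = Zer K (F j) P" "d \<cdot> x = x" by auto
    have k: "k \<in> A" using insert by blast
    \<comment> \<open>This is \<open>d\<close> composed with
      \<open>1 - \<iota> k \<cdot> p k\<close>.\<close>
    define d' where "d' = Add K d (Neg K (d \<cdot> (\<iota> k \<cdot> p k)))"
    have 0: "\<iota> k \<in> Hom K (F k) P" "p k \<in> Hom K P (F k)" using \<iota>[OF k] p(1)[OF k] by auto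
    have d': "d' \<in> Hom K P P" unfolding d'_def using d(1) 0 by (simp add: cat)
    have cmp: "d' \<cdot> y = Add K (d \<cdot> y) (Neg K (d \<cdot> (\<iota> k \<cdot> (p k \<cdot> y))))" if "y \<in> Hom K B P" for y B
      unfolding d'_def using d(1) 0 that by (simp add: cat)
    have "d' \<cdot> x = x"
      using cmp[OF x] z[OF k] d(1,3) 0 x F[OF k] compact_ob[OF C] neg_zer[OF hom_ob[OF x]] by (simp add: cat)
    moreover have "d' \<cdot> \<iota> j = Zer K (F j) P" if j: "j \<in> insert k S" for j
    proof (cases "j = k")
      case True
      then show ?thesis using cmp[OF 0(1)] p(2)[OF k k] d(1) 0 F[OF k] by (simp add: cat)
    next
      case False
      then have j: "j \<in> A" "j \<in> S" using j insert by auto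
      show ?thesis using cmp[OF \<iota>[OF j(1)]] p(2)[OF k j(1)] d(1) d(2)[OF j(2)] False 0 F[OF j(1)] F[OF k] P
          neg_zer[OF F[OF j(1)] P] by (simp add: cat)
    qed
    ultimately show ?case using d' by blast
  qed
  then show ?thesis using supported_onD[OF S(3)] by metis
qed

text \<open>Each closure property is a transport of finite support: along a retraction, through
  shifted coproducts, and along the maps of a triangle.\<close>

lemma thick_compacts: "thick K (compacts \<kappa> K)"
proof (rule thickI)
  show "compacts \<kappa> K \<subseteq> Ob K" using compact_ob by blast
  show "compacts \<kappa> K \<noteq> {}" using unit_compact by blast
next
  fix X S assume r: "retract K X S" and S: "S \<in> compacts \<kappa> K"
  obtain i p where ip: "i \<in> Hom K X S" "p \<in> Hom K S X" "p \<cdot> i = Idm K X"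
    using r unfolding retract_def by blast
  show "X \<in> compacts \<kappa> K"
  proof (rule compactI)
    show "X \<in> Ob K" using hom_ob ip by blast
    fix I :: "'u set" and F P \<iota> x
    assume h: "small \<kappa> I" "\<And>i. i \<in> I \<Longrightarrow> F i \<in> Ob K" "is_coproduct K I F P \<iota>" and x: "x \<in> Hom K X P"
    obtain J where J: "J \<subseteq> I" "finite J"
      "supported_on F P \<iota> S (x \<cdot> p) J"
      using compact_fin_supp[OF S h(1,3) cmp_hom[OF ip(2) x] h(2)] by (rule fin_suppE)
    show "fin_supp I F P \<iota> X x"
    proof (rule fin_suppI[OF J(1,2)])
      fix T u assume u: "u \<in> Hom K P T" "\<And>k. k \<in> J \<Longrightarrow> u \<cdot> \<iota> k = Zer K (F k) T"
      have "u \<cdot> (x \<cdot> p) = Zer K S T" using supported_onD[OF J(3) u(1)] u(2) by blast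
      then have "(u \<cdot> (x \<cdot> p)) \<cdot> i = Zer K X T" using cmp_zer_left[OF ip(1) hom_ob(2)[OF u(1)]] by simp
      then show "u \<cdot> x = Zer K X T" using u(1) x ip by (simp add: cat)
    qed
  qed
next
  fix X assume X: "X \<in> Ob K"
  show "Sh K X \<in> compacts \<kappa> K \<longleftrightarrow> X \<in> compacts \<kappa> K"
  proof
    assume S: "Sh K X \<in> compacts \<kappa> K"
    show "X \<in> compacts \<kappa> K"
    proof (rule compactI[OF X])
      fix I :: "'u set" and F P \<iota> x
      assume h: "small \<kappa> I" "\<And>i. i \<in> I \<Longrightarrow> F i \<in> Ob K" "is_coproduct K I F P \<iota>" and x: "x \<in> Hom K X P"
      have c: "is_coproduct K I (\<lambda>i. Sh K (F i)) (Sh K P) (\<lambda>i. ShM K (\<iota> i))"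
        using coproduct_shift[OF h(3,2)] .
      obtain J where J: "J \<subseteq> I" "finite J"
        "supported_on (\<lambda>k. Sh K (F k)) (Sh K P) (\<lambda>k. ShM K (\<iota> k)) (Sh K X) (ShM K x) J"
        using compact_fin_supp[OF S h(1) c shm_hom[OF x] sh_ob[OF h(2)]] by (rule fin_suppE)
      show "fin_supp I F P \<iota> X x"
      proof (rule fin_suppI[OF J(1,2)])
        fix T u assume u: "u \<in> Hom K P T" "\<And>k. k \<in> J \<Longrightarrow> u \<cdot> \<iota> k = Zer K (F k) T"
        have T: "T \<in> Ob K" using hom_ob u by blast
        have "ShM K u \<cdot> ShM K (\<iota> k) = Zer K (Sh K (F k)) (Sh K T)" if "k \<in> J" for k
        proof -
          have k: "k \<in> I" using that J(1) by blast
          have "ShM K u \<cdot> ShM K (\<iota> k) = ShM K (Zer K (F k) T)"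
            using shm_cmp[OF coproduct_hom[OF h(3) k] u(1)] u(2)[OF that] by simp
          then show ?thesis using h(2)[OF k] T by (simp add: cat_shm)
        qed
        then have "ShM K u \<cdot> ShM K x = Zer K (Sh K X) (Sh K T)" using supported_onD[OF J(3) shm_hom[OF u(1)]] by blast
        then have "ShM K (u \<cdot> x) = ShM K (Zer K X T)" using shm_cmp[OF x u(1)] X T by (simp add: cat_shm)
        then show "u \<cdot> x = Zer K X T" using shm_inj cmp_hom[OF x u(1)] zer_hom[OF X T] by blast
      qed
    qed
  next
    assume C: "X \<in> compacts \<kappa> K"
    show "Sh K X \<in> compacts \<kappa> K"
    proof (rule compactI[OF sh_ob[OF X]])
      fix I :: "'u set" and F P \<iota> x
      assume h: "small \<kappa> I" "\<And>i. i \<in> I \<Longrightarrow> F i \<in> Ob K" "is_coproduct K I F P \<iota>" and x: "x \<in> Hom K (Sh K X) P"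
      \<comment> \<open>The target \<open>P\<close>, and below also the test object
        \<open>T\<close>, are desuspended in order to use the finite support of a map from
        \<open>X\<close>.\<close>
      obtain G Q j p q where G: "\<And>i. i \<in> I \<Longrightarrow> G i \<in> Ob K" "is_coproduct K I G Q j"
        "p \<in> Hom K (Sh K Q) P" "q \<in> Hom K P (Sh K Q)" "q \<cdot> p = Idm K (Sh K Q)" "p \<cdot> q = Idm K P"
        "\<And>i. i \<in> I \<Longrightarrow> \<exists>a \<in> Hom K (Sh K (G i)) (F i). p \<cdot> ShM K (j i) = \<iota> i \<cdot> a"
        using coproduct_desuspend[OF h(3,2)] by metis
      have Q: "Q \<in> Ob K" using coproduct_ob[OF G(2)] .
      obtain y where y: "y \<in> Hom K X Q" "ShM K y = q \<cdot> x" using shm_surj[OF cmp_hom[OF x G(4)] X Q] .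
      obtain J where J: "J \<subseteq> I" "finite J"
        "supported_on G Q j X y J"
        using compact_fin_supp[OF C h(1) G(2) y(1) G(1)] by (rule fin_suppE)
      show "fin_supp I F P \<iota> (Sh K X) x"
      proof (rule fin_suppI[OF J(1,2)])
        fix T u assume u: "u \<in> Hom K P T" "\<And>k. k \<in> J \<Longrightarrow> u \<cdot> \<iota> k = Zer K (F k) T"
        have T: "T \<in> Ob K" using hom_ob u by blast
        obtain W where W: "W \<in> Ob K" "isomorphic K (Sh K W) T" using desuspend[OF T] .
        obtain r s where r: "r \<in> Hom K (Sh K W) T" "s \<in> Hom K T (Sh K W)" "r \<cdot> s = Idm K T"
          using W(2) by (rule isomorphicE)
        obtain v where v: "v \<in> Hom K Q W" "ShM K v = s \<cdot> (u \<cdot> p)"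
          using shm_surj[OF cmp_hom[OF cmp_hom[OF G(3) u(1)] r(2)] Q W(1)] .
        have "v \<cdot> j k = Zer K (G k) W" if k: "k \<in> J" for k
        proof -
          have kI: "k \<in> I" using k J(1) by blast
          have jk: "j k \<in> Hom K (G k) Q" and \<iota>k: "\<iota> k \<in> Hom K (F k) P"
            using coproduct_hom[OF G(2) kI] coproduct_hom[OF h(3) kI] by auto
          obtain a where a: "a \<in> Hom K (Sh K (G k)) (F k)" "p \<cdot> ShM K (j k) = \<iota> k \<cdot> a"
            using G(7)[OF kI] by blast
          have "ShM K (v \<cdot> j k) = s \<cdot> (u \<cdot> (\<iota> k \<cdot> a))"
            using v jk G(3) u(1) r a(2) by (simp add: cat)
          also have "\<dots> = s \<cdot> ((u \<cdot> \<iota> k) \<cdot> a)" using cmp_assoc[OF a(1) \<iota>k u(1)] by simp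
          also have "\<dots> = ShM K (Zer K (G k) W)" using u(2)[OF k] a(1) r T W G(1)[OF kI] by (simp add: cat)
          finally show ?thesis using shm_inj cmp_hom[OF jk v(1)] zer_hom[OF G(1)[OF kI] W(1)] by blast
        qed
        then have vy: "v \<cdot> y = Zer K X W" using supported_onD[OF J(3) v(1)] by blast
        have "s \<cdot> (u \<cdot> x) = ShM K v \<cdot> ShM K y"
          using v(2) y(2) G(3,4,6) u(1) x r cmp_reassoc[OF G(6,4,3)] by (simp add: cat)
        also have "\<dots> = Zer K (Sh K X) (Sh K W)"
          using shm_cmp[OF y(1) v(1)] vy X W by (simp add: cat_shm)
        finally have "r \<cdot> (s \<cdot> (u \<cdot> x)) = Zer K (Sh K X) T" using r(1) X sh_ob by (simp add: cat)
        then show "u \<cdot> x = Zer K (Sh K X) T"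
          using cmp_reassoc[OF r(3,2,1)] u(1) x by (simp add: cat)
      qed
    qed
  qed
next
  fix f g h X Y Z
  assume t: "Tri K f g h" "f \<in> Hom K X Y" "g \<in> Hom K Y Z" and C: "X \<in> compacts \<kappa> K" "Z \<in> compacts \<kappa> K"
  show "Y \<in> compacts \<kappa> K"
  proof (rule compactI)
    show "Y \<in> Ob K" using hom_ob t by blast
    fix I :: "'u set" and F P \<iota> y
    assume h: "small \<kappa> I" "\<And>i. i \<in> I \<Longrightarrow> F i \<in> Ob K" "is_coproduct K I F P \<iota>" and y: "y \<in> Hom K Y P"
    have P: "P \<in> Ob K" using coproduct_ob[OF h(3)] .
    note \<iota> = coproduct_hom[OF h(3)]
    obtain J where J: "J \<subseteq> I" "finite J"
      "supported_on F P \<iota> X (y \<cdot> f) J"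
      using compact_fin_supp[OF C(1) h(1,3) cmp_hom[OF t(2) y] h(2)] by (rule fin_suppE)
    \<comment> \<open>\<open>d\<close> erases the finitely many summands that support
      \<open>y \<cdot> f\<close>, so \<open>d \<cdot> y\<close> factors through \<open>Z\<close>,
      whose compactness yields the rest of the support.\<close>
    obtain d where d: "d \<in> Hom K P P" "\<And>i. i \<in> I \<Longrightarrow> d \<cdot> \<iota> i = (if i \<in> J then Zer K (F i) P else \<iota> i)"
      using coproduct_map[OF h(3) P, of "\<lambda>i. if i \<in> J then Zer K (F i) P else \<iota> i"] \<iota> zer_hom[OF h(2) P]
      by (smt (verit))
    have "d \<cdot> \<iota> k = Zer K (F k) P" if "k \<in> J" for k using d(2)[of k] J(1) that by auto
    then have "d \<cdot> (y \<cdot> f) = Zer K X P" using supported_onD[OF J(3) d(1)] by blast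
    then have "(d \<cdot> y) \<cdot> f = Zer K X P" using cmp_assoc[OF t(2) y d(1)] by simp
    then obtain z where z: "z \<in> Hom K Z P" "z \<cdot> g = d \<cdot> y"
      using tri_factor_cone[OF t cmp_hom[OF y d(1)]] by blast
    obtain J' where J': "J' \<subseteq> I" "finite J'"
      "supported_on F P \<iota> Z z J'"
      using compact_fin_supp[OF C(2) h(1,3) z(1) h(2)] by (rule fin_suppE)
    show "fin_supp I F P \<iota> Y y"
    proof (rule fin_suppI[of "J \<union> J'"])
      show "J \<union> J' \<subseteq> I" "finite (J \<union> J')" using J J' by auto
      fix T u assume u: "u \<in> Hom K P T" "\<And>k. k \<in> J \<union> J' \<Longrightarrow> u \<cdot> \<iota> k = Zer K (F k) T"
      \<comment> \<open>A test map that vanishes on \<open>J\<close> does not notice the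
        erasure.\<close>
      have "u \<cdot> d = u"
      proof (rule coproduct_eqI[OF h(3) cmp_hom[OF d(1) u(1)] u(1)])
        fix i assume i: "i \<in> I"
        have "(u \<cdot> d) \<cdot> \<iota> i = u \<cdot> (d \<cdot> \<iota> i)" using cmp_assoc[OF \<iota>[OF i] d(1) u(1)] .
        then show "(u \<cdot> d) \<cdot> \<iota> i = u \<cdot> \<iota> i"
          using d(2)[OF i] u(2)[of i] cmp_zer_right[OF u(1) h(2)[OF i]] by (cases "i \<in> J") auto
      qed
      then have "u \<cdot> y = u \<cdot> (z \<cdot> g)" using z(2) cmp_assoc[OF y d(1) u(1)] by simp
      also have "\<dots> = (u \<cdot> z) \<cdot> g" using cmp_assoc[OF t(3) z(1) u(1)] by simp
      also have "\<dots> = Zer K Y T" using supported_onD[OF J'(3) u(1)] u(2) cmp_zer_left[OF t(3) hom_ob(2)[OF u(1)]] by simp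
      finally show "u \<cdot> y = Zer K Y T" .
    qed
  qed
qed

text \<open>Here compactness of the objects of \<open>S\<close> enters: a map from one of them into
  the coproduct is a finite sum of maps through summands, and each of these is zero.\<close>

lemma localizing_perp_right:
  assumes "thick K S" "S \<subseteq> compacts \<kappa> K" shows "localizing \<kappa> K (perp_right K S)"
proof (rule localizingI[OF thick_perp_right[OF thick_shift_closed[OF assms(1)]]])
  fix I :: "'u set" and F P \<iota>
  assume h: "small \<kappa> I" "\<And>i. i \<in> I \<Longrightarrow> F i \<in> perp_right K S" "\<And>i. i \<in> I \<Longrightarrow> F i \<in> Ob K"
    "is_coproduct K I F P \<iota>"
  have "x = Zer K C P" if C: "C \<in> S" and x: "x \<in> Hom K C P" for C x
  proof -
    have C': "C \<in> compacts \<kappa> K" using C assms(2) by blast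
    have F: "\<forall>i \<in> I. F i \<in> Ob K" using h(3) by blast
    show ?thesis using C' h(1,4) x F
    proof (induction rule: compact_induct)
      case zer then show ?case by simp
    next
      case (add x y)
      then show ?case using add_zer_left[OF zer_hom[OF compact_ob[OF C'] coproduct_ob[OF h(4)]]] by simp
    next
      case (inj i a)
      then have "a = Zer K C (F i)" using h(2)[OF inj(1)] C hom0D unfolding perp_right_def by blast
      then show ?case using cmp_zer_right[OF coproduct_hom[OF h(4) inj(1)] compact_ob[OF C']] by simp
    qed
  qed
  then show "P \<in> perp_right K S" unfolding perp_right_def hom0_def using coproduct_ob[OF h(4)] by blast
qed

text \<open>\<open>perp_left K (perp_right K S)\<close> is localizing and contains \<open>S\<close>,
  hence it contains \<open>Loc \<kappa> K S\<close>.\<close>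

lemma Loc_perp_left:
  assumes "thick K S" "S \<subseteq> compacts \<kappa> K" "X \<in> Loc \<kappa> K S" "Y \<in> perp_right K S"
  shows "hom0 K X Y"
proof -
  have sc: "shift_closed K (perp_right K S)"
    using thick_shift_closed thick_perp_right[OF thick_shift_closed[OF assms(1)]] by blast
  have "S \<subseteq> perp_left K (perp_right K S)"
    unfolding perp_left_def perp_right_def using thick_ob[OF assms(1)] by blast
  then have "Loc \<kappa> K S \<subseteq> perp_left K (perp_right K S)" using Loc_least localizing_perp_left[OF sc] by blast
  then show ?thesis using assms(3,4) unfolding perp_left_def by blast
qed

lemma Loc_perp_zero:
  assumes "thick K S" "S \<subseteq> compacts \<kappa> K" "X \<in> Loc \<kappa> K S" "X \<in> perp_right K S"
  shows "is_zero K X"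
  using Loc_perp_left[OF assms] hom0_self_zero assms(4) unfolding perp_right_def by blast

end

section \<open>Compact objects in localizing subcategories\<close>

context triangulated_category begin

text \<open>For thick \<open>T\<close>, these are the maps that become invertible in the Verdier
  quotient by \<open>T\<close>. One triangle is asked for; by \<open>cone_inD\<close> any other
  triangle on \<open>c\<close> serves as well.\<close>

definition cone_in :: "'o set \<Rightarrow> 'm \<Rightarrow> bool" where
  "cone_in T c \<longleftrightarrow> (\<exists>g h. Tri K c g h \<and> Cod K g \<in> T)"

lemma cone_inD:
  assumes "thick K T" "cone_in T c" "Tri K c g h" "c \<in> Hom K X Y" "g \<in> Hom K Y Z"
  shows "Z \<in> T"
proof -
  obtain g' h' where t: "Tri K c g' h'" "Cod K g' \<in> T" using assms(2) unfolding cone_in_def by blast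
  then show ?thesis
    using thick_retract[OF assms(1) t(2) tri_cone_retract[OF assms(3) t(1) assms(4,5) tri_homs(1)[OF t(1) assms(4)]]]
    by blast
qed

lemma cone_inI:
  assumes "Tri K c g h" "g \<in> Hom K Y Z" "Z \<in> T" shows "cone_in T c"
  unfolding cone_in_def using assms hom_cod[OF assms(2)] by blast

text \<open>Octahedral axiom: the cone of a composite is an extension of the two cones.\<close>

lemma cone_in_cmp:
  assumes "thick K T" "cone_in T f" "cone_in T g" "f \<in> Hom K X Y" "g \<in> Hom K Y Z"
  shows "cone_in T (g \<cdot> f)"
proof -
  obtain f1 f2 g1 g2 where t: "Tri K f f1 f2" "Cod K f1 \<in> T" "Tri K g g1 g2" "Cod K g1 \<in> T"
    using assms(2,3) unfolding cone_in_def by blast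
  obtain W h1 h2 where h: "Tri K (g \<cdot> f) h1 h2" "h1 \<in> Hom K Z W"
    using tri_cone_ex[OF cmp_hom[OF assms(4,5)]] by metis
  obtain u v where uv: "Tri K u v (ShM K f1 \<cdot> g2)" "u \<in> Hom K (Cod K f1) (Cod K h1)"
    "v \<in> Hom K (Cod K h1) (Cod K g1)"
    using tri_octahedral[OF assms(4,5) t(1,3) h(1)] by blast
  have "Cod K h1 \<in> T" using thick_ext[OF assms(1) uv t(2,4)] .
  then show ?thesis unfolding cone_in_def using h(1) by blast
qed

lemma cone_in_iso:
  assumes "thick K T" "f \<in> Hom K X Y" "g \<in> Hom K Y X" "g \<cdot> f = Idm K X" "f \<cdot> g = Idm K Y"
  shows "cone_in T f"
proof -
  obtain Z0 where Z: "is_zero K Z0" "Z0 \<in> Ob K" by (rule zero_ob_ex)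
  have ob: "X \<in> Ob K" "Y \<in> Ob K" using assms hom_ob by blast+
  have iso1: "is_iso K (Idm K A)" if "A \<in> Ob K" for A
    using is_iso_iff[OF idm_hom[OF that]] idm_hom[OF that] idm_left[OF idm_hom[OF that]] by blast
  have "Tri K f (Zer K Y Z0) (Zer K Z0 (Sh K X))"
  proof (rule tri_iso[OF tri_idm[OF ob(1) Z(1)], where u = "Idm K X" and v = f and w = "Idm K Z0"])
    show "is_triangle K f (Zer K Y Z0) (Zer K Z0 (Sh K X))"
      by (rule is_triangleI[OF assms(2)]) (use ob Z zer_hom sh_ob in blast)+
    show "is_iso K f" using is_iso_iff[OF assms(2)] assms by blast
    show "is_iso K (Idm K X)" "is_iso K (Idm K Z0)" using iso1 ob Z by auto
  qed (use assms ob Z in \<open>simp_all add: cat\<close>)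
  then show ?thesis using cone_inI zer_hom[OF ob(2) Z(2)] thick_zero[OF assms(1) Z(1)] by blast
qed

text \<open>Three rotations shift a triangle and change the sign of every map; the sign is kept, so
  that the rotated triangle can be used as it is.\<close>

lemma cone_in_shift:
  assumes "thick K T" "c \<in> Hom K X Y"
  shows "cone_in T (Neg K (ShM K c)) \<longleftrightarrow> cone_in T c"
proof -
  obtain Z g h where t: "Tri K c g h" "g \<in> Hom K Y Z" "h \<in> Hom K Z (Sh K X)" "Z \<in> Ob K"
    using tri_cone_ex[OF assms(2)] .
  have 1: "Tri K (Neg K (ShM K c)) (Neg K (ShM K g)) (Neg K (ShM K h))"
    using tri_rot[OF tri_rot[OF tri_rot[OF t(1)]]] .
  have 2: "Neg K (ShM K c) \<in> Hom K (Sh K X) (Sh K Y)" "Neg K (ShM K g) \<in> Hom K (Sh K Y) (Sh K Z)"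
    using neg_hom shm_hom assms(2) t(2) by blast+
  show ?thesis
    using cone_inD[OF assms(1) _ 1 2] cone_inI[OF 1 2(2)] cone_inD[OF assms(1) _ t(1) assms(2) t(2)]
      cone_inI[OF t(1,2)] thick_sh[OF assms(1) t(4)] by blast
qed

end

section \<open>Maps that vanish modulo a thick subcategory of compact objects\<close>

context rigidly_compactly_generated begin

text \<open>The map \<open>f\<close> becomes zero in the Verdier quotient by \<open>S\<close>, as
  witnessed by a denominator with compact source. \<open>Cod K f\<close> saves a parameter for the
  target.\<close>

definition killable :: "'o set \<Rightarrow> 'o \<Rightarrow> 'm \<Rightarrow> bool" where
  "killable S C f \<longleftrightarrow> (\<exists>C' \<in> compacts \<kappa> K. \<exists>c \<in> Hom K C' C. cone_in S c \<and> f \<cdot> c = Zer K C' (Cod K f))"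

lemma killableI:
  assumes "C' \<in> compacts \<kappa> K" "c \<in> Hom K C' C" "cone_in S c" "f \<in> Hom K C Y" "f \<cdot> c = Zer K C' Y"
  shows "killable S C f"
  unfolding killable_def using assms hom_cod[OF assms(4)] by blast

lemma killableE:
  assumes "killable S C f" "f \<in> Hom K C Y"
  obtains C' c where "C' \<in> compacts \<kappa> K" "c \<in> Hom K C' C" "cone_in S c" "f \<cdot> c = Zer K C' Y"
  using assms(1) hom_cod[OF assms(2)] unfolding killable_def by blast

lemma killable_pullback:
  assumes "thick K S" "c \<in> Hom K C' C" "cone_in S c" "f \<in> Hom K C Y" "killable S C' (f \<cdot> c)"
  shows "killable S C f"
proof -
  obtain C'' d where d: "C'' \<in> compacts \<kappa> K" "d \<in> Hom K C'' C'" "cone_in S d" "(f \<cdot> c) \<cdot> d = Zer K C'' Y"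
    using killableE[OF assms(5) cmp_hom[OF assms(2,4)]] .
  show ?thesis
    using killableI[OF d(1) cmp_hom[OF d(2) assms(2)] cone_in_cmp[OF assms(1) d(3) assms(3) d(2) assms(2)] assms(4)]
      d(4) cmp_assoc[OF d(2) assms(2,4)] by simp
qed

text \<open>The fiber map of \<open>f\<close> kills \<open>f\<close>. Its cone is \<open>Y\<close>,
  and its source is compact because the compact objects are thick.\<close>

lemma killable_thick:
  assumes "thick K S" "S \<subseteq> compacts \<kappa> K" "Y \<in> S" "D \<in> compacts \<kappa> K" "f \<in> Hom K D Y"
  shows "killable S D f"
proof -
  have Y: "Y \<in> compacts \<kappa> K" using assms(2,3) by blast
  obtain F c h where t: "Tri K c f h" "c \<in> Hom K F D" using tri_fiber_ex[OF assms(5)] by metis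
  have F: "F \<in> compacts \<kappa> K" using thick_fiber[OF thick_compacts t assms(5,4) Y] .
  show ?thesis
    using killableI[OF F t(2) cone_inI[OF t(1) assms(5,3)] assms(5) tri_cmp_zer[OF t assms(5)]] .
qed

text \<open>Every map from a compact object to an object of \<open>Loc S\<close> is killed by a map with cone
  in \<open>S\<close>: the objects with this property form a localizing subcategory.\<close>

lemma localizing_killable:
  assumes "thick K S" "S \<subseteq> compacts \<kappa> K"
  shows "localizing \<kappa> K {Y \<in> Ob K. \<forall>C \<in> compacts \<kappa> K. \<forall>f \<in> Hom K C Y. killable S C f}"
    (is "localizing \<kappa> K ?T")
proof -
  have kill_pre: "killable S C f"
    if f: "f \<in> Hom K C Y" and i: "i \<in> Hom K Y W" "p \<in> Hom K W Y" "p \<cdot> i = Idm K Y"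
      and k: "killable S C (i \<cdot> f)" for C Y W f i p
  proof -
    obtain C' c where c: "C' \<in> compacts \<kappa> K" "c \<in> Hom K C' C" "cone_in S c" "(i \<cdot> f) \<cdot> c = Zer K C' W"
      using killableE[OF k cmp_hom[OF f i(1)]] .
    have "f \<cdot> c = p \<cdot> (i \<cdot> (f \<cdot> c))"
      using cmp_assoc[OF cmp_hom[OF c(2) f] i(1,2)] i(3) idm_left[OF cmp_hom[OF c(2) f]] by simp
    also have "\<dots> = p \<cdot> ((i \<cdot> f) \<cdot> c)" using cmp_assoc[OF c(2) f i(1)] by simp
    also have "\<dots> = Zer K C' Y" using c(4) cmp_zer_right[OF i(2) compact_ob[OF c(1)]] by simp
    finally have "f \<cdot> c = Zer K C' Y" .
    then show ?thesis using killableI c f by blast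
  qed
  \<comment> \<open>Denominators shift with the sign of \<open>cone_in_shift\<close>; conversely,
    they are desuspended after composition with an isomorphism.\<close>
  have kill_sh: "killable S (Sh K C) (ShM K f) \<longleftrightarrow> killable S C f"
    if f: "f \<in> Hom K C Y" for C Y f
  proof
    have ob: "C \<in> Ob K" "Y \<in> Ob K" using hom_ob f by blast+
    {
      assume "killable S C f"
      then obtain C' c where c: "C' \<in> compacts \<kappa> K" "c \<in> Hom K C' C" "cone_in S c" "f \<cdot> c = Zer K C' Y"
        using killableE f by metis
      have "ShM K f \<cdot> Neg K (ShM K c) = Neg K (ShM K (f \<cdot> c))"
        using shm_cmp[OF c(2) f] cmp_neg_right[OF shm_hom[OF c(2)] shm_hom[OF f]] by simp
      also have "\<dots> = Zer K (Sh K C') (Sh K Y)"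
        using c ob compact_ob neg_zer[OF sh_ob sh_ob] by (simp add: cat)
      finally show "killable S (Sh K C) (ShM K f)"
        using killableI[OF _ neg_hom[OF shm_hom[OF c(2)]] _ shm_hom[OF f]]
          cone_in_shift[OF assms(1) c(2)] c(1,3) thick_sh[OF thick_compacts compact_ob] by blast
    }
    {
      assume "killable S (Sh K C) (ShM K f)"
      then obtain D d where d: "D \<in> compacts \<kappa> K" "d \<in> Hom K D (Sh K C)" "cone_in S d"
        "ShM K f \<cdot> d = Zer K D (Sh K Y)"
        using killableE shm_hom[OF f] by metis
      obtain C' where C': "C' \<in> Ob K" "isomorphic K (Sh K C') D" using desuspend[OF compact_ob[OF d(1)]] .
      obtain p q where p: "p \<in> Hom K (Sh K C') D" "q \<in> Hom K D (Sh K C')"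
        "q \<cdot> p = Idm K (Sh K C')" "p \<cdot> q = Idm K D" using C'(2) by (rule isomorphicE)
      have C'c: "C' \<in> compacts \<kappa> K"
        using d(1) C' thick_iso[OF thick_compacts C'(2)] thick_sh[OF thick_compacts C'(1)] by blast
      obtain c where c: "c \<in> Hom K C' C" "ShM K c = Neg K (d \<cdot> p)"
        using shm_surj[OF neg_hom[OF cmp_hom[OF p(1) d(2)]] C'(1) ob(1)] .
      have "cone_in S (d \<cdot> p)"
        using cone_in_cmp[OF assms(1) cone_in_iso[OF assms(1) p] d(3) p(1) d(2)] .
      moreover have "Neg K (ShM K c) = d \<cdot> p" using c(2) neg_neg[OF cmp_hom[OF p(1) d(2)]] by simp
      ultimately have cc: "cone_in S c" using cone_in_shift[OF assms(1) c(1)] by simp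
      have "ShM K (f \<cdot> c) = Neg K ((ShM K f \<cdot> d) \<cdot> p)" using f c p d(1,2) by (simp add: cat)
      also have "\<dots> = ShM K (Zer K C' Y)"
        using d(4) p(1) ob C' neg_zer[OF sh_ob[OF C'(1)] sh_ob[OF ob(2)]] by (simp add: cat)
      finally have "f \<cdot> c = Zer K C' Y" using shm_inj cmp_hom[OF c(1) f] zer_hom[OF C'(1) ob(2)] by blast
      then show "killable S C f" using killableI C'c c(1) cc f by blast
    }
  qed
  have thick: "thick K ?T"
  proof (rule thickI)
    show "?T \<subseteq> Ob K" by blast
    have "S \<subseteq> ?T" using killable_thick[OF assms] compact_ob assms(2) by blast
    then show "?T \<noteq> {}" using thick_zero[OF assms(1)] zero_object by blast
  next
    fix X W assume r: "retract K X W" and W: "W \<in> ?T"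
    obtain i p where ip: "i \<in> Hom K X W" "p \<in> Hom K W X" "p \<cdot> i = Idm K X"
      using r unfolding retract_def by blast
    have "killable S C f" if "C \<in> compacts \<kappa> K" "f \<in> Hom K C X" for C f
      using kill_pre[OF that(2) ip] W that(1) cmp_hom[OF that(2) ip(1)] by blast
    then show "X \<in> ?T" using hom_ob ip by blast
  next
    fix X assume X: "X \<in> Ob K"
    show "Sh K X \<in> ?T \<longleftrightarrow> X \<in> ?T"
    proof
      assume h: "Sh K X \<in> ?T"
      have "killable S C f" if "C \<in> compacts \<kappa> K" "f \<in> Hom K C X" for C f
      proof -
        have "Sh K C \<in> compacts \<kappa> K" using that(1) thick_sh[OF thick_compacts compact_ob] by blast
        then have "killable S (Sh K C) (ShM K f)" using h shm_hom[OF that(2)] by blast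
        then show ?thesis using kill_sh[OF that(2)] by blast
      qed
      then show "X \<in> ?T" using X by blast
    next
      assume h: "X \<in> ?T"
      have "killable S C f" if C: "C \<in> compacts \<kappa> K" and f: "f \<in> Hom K C (Sh K X)" for C f
      proof -
        obtain D where D: "D \<in> Ob K" "isomorphic K (Sh K D) C" using desuspend[OF compact_ob[OF C]] .
        obtain p q where p: "p \<in> Hom K (Sh K D) C" "q \<in> Hom K C (Sh K D)"
          "q \<cdot> p = Idm K (Sh K D)" "p \<cdot> q = Idm K C" using D(2) by (rule isomorphicE)
        have Dc: "D \<in> compacts \<kappa> K"
          using C thick_iso[OF thick_compacts D(2)] thick_sh[OF thick_compacts D(1)] by blast
        obtain g where g: "g \<in> Hom K D X" "ShM K g = f \<cdot> p" using shm_surj[OF cmp_hom[OF p(1) f] D(1) X] .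
        have "killable S D g" using h Dc g(1) by blast
        then have "killable S (Sh K D) (f \<cdot> p)" using kill_sh[OF g(1)] g(2) by simp
        then show ?thesis using killable_pullback[OF assms(1) p(1) cone_in_iso[OF assms(1) p] f] by blast
      qed
      then show "Sh K X \<in> ?T" using sh_ob[OF X] by blast
    qed
  next
    fix f g h X Y Z
    assume t: "Tri K f g h" "f \<in> Hom K X Y" "g \<in> Hom K Y Z" and X: "X \<in> ?T" and Z: "Z \<in> ?T"
    have "killable S C y" if C: "C \<in> compacts \<kappa> K" and y: "y \<in> Hom K C Y" for C y
    proof -
      \<comment> \<open>First the image in \<open>Z\<close> is killed, then the resulting lift to
        \<open>X\<close>; the two denominators compose.\<close>
      have "killable S C (g \<cdot> y)" using Z C cmp_hom[OF y t(3)] by blast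
      then obtain C' c where c: "C' \<in> compacts \<kappa> K" "c \<in> Hom K C' C" "cone_in S c" "(g \<cdot> y) \<cdot> c = Zer K C' Z"
        using killableE cmp_hom[OF y t(3)] by metis
      have "g \<cdot> (y \<cdot> c) = Zer K C' Z" using c(4) cmp_assoc[OF c(2) y t(3)] by simp
      then obtain x where x: "x \<in> Hom K C' X" "f \<cdot> x = y \<cdot> c" using tri_lift[OF t cmp_hom[OF c(2) y]] by blast
      have "killable S C' x" using X c(1) x(1) by blast
      then obtain C'' d where d: "C'' \<in> compacts \<kappa> K" "d \<in> Hom K C'' C'" "cone_in S d" "x \<cdot> d = Zer K C'' X"
        using killableE x(1) by metis
      have "(y \<cdot> c) \<cdot> d = f \<cdot> (x \<cdot> d)" using x cmp_assoc[OF d(2) x(1) t(2)] by simp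
      then have "(y \<cdot> c) \<cdot> d = Zer K C'' Y" using d(4) cmp_zer_right[OF t(2) compact_ob[OF d(1)]] by simp
      then have "killable S C' (y \<cdot> c)" using killableI[OF d(1-3) cmp_hom[OF c(2) y]] by blast
      then show ?thesis using killable_pullback[OF assms(1) c(2,3) y] by blast
    qed
    then show "Y \<in> ?T" using hom_ob t by blast
  qed
  show ?thesis
  proof (rule localizingI[OF thick])
    fix I :: "'u set" and F P \<iota>
    assume I: "small \<kappa> I" "\<And>i. i \<in> I \<Longrightarrow> F i \<in> ?T" "\<And>i. i \<in> I \<Longrightarrow> F i \<in> Ob K" "is_coproduct K I F P \<iota>"
    note P = coproduct_ob[OF I(4)] and \<iota> = coproduct_hom[OF I(4)]
    have F: "\<forall>i \<in> I. F i \<in> Ob K" using I(3) by blast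
    have "killable S C x" if C: "C \<in> compacts \<kappa> K" and x: "x \<in> Hom K C P" for C x
      using C I(1,4) x F
    proof (induction rule: compact_induct)
      case zer
      have i: "Idm K C \<in> Hom K C C" "Idm K C \<cdot> Idm K C = Idm K C"
        using idm_hom idm_left compact_ob[OF C] by blast+
      show ?case
        using killableI[OF C i(1) cone_in_iso[OF assms(1) i(1,1,2,2)] zer_hom[OF compact_ob[OF C] P]]
          idm_right zer_hom[OF compact_ob[OF C] P] by blast
    next
      case (add x y)
      have "killable S C x \<Longrightarrow> killable S C y \<Longrightarrow> killable S C (Add K x y)" 
      proof -
        assume "killable S C x"
        then obtain C1 c where c: "C1 \<in> compacts \<kappa> K" "c \<in> Hom K C1 C" "cone_in S c" "x \<cdot> c = Zer K C1 P"
          using killableE add(1) by metis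
        assume "killable S C y"
        then obtain C2 d where d: "C2 \<in> compacts \<kappa> K" "d \<in> Hom K C2 C" "cone_in S d" "y \<cdot> d = Zer K C2 P"
          using killableE add(2) by metis
        obtain W g h where t: "Tri K d g h" "g \<in> Hom K C W" "W \<in> Ob K" using tri_cone_ex[OF d(2)] by metis
        have W: "W \<in> S" using cone_inD[OF assms(1) d(3) t(1) d(2) t(2)] .
        then have Wc: "W \<in> compacts \<kappa> K" using assms(2) by blast
        \<comment> \<open>the homotopy pullback of \<open>c\<close> and \<open>d\<close> is the fiber of \<open>g \<cdot> c\<close>\<close>
        obtain E e k where e: "Tri K e (g \<cdot> c) k" "e \<in> Hom K E C1"
          using tri_fiber_ex[OF cmp_hom[OF c(2) t(2)]] by metis
        have E: "E \<in> compacts \<kappa> K" using thick_fiber[OF thick_compacts e cmp_hom[OF c(2) t(2)] c(1) Wc] .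
        have ec: "cone_in S e" using cone_inI[OF e(1) cmp_hom[OF c(2) t(2)] W] .
        have "g \<cdot> (c \<cdot> e) = Zer K E W"
          using tri_cmp_zer[OF e cmp_hom[OF c(2) t(2)]] cmp_assoc[OF e(2) c(2) t(2)] by simp
        then obtain l where l: "l \<in> Hom K E C2" "d \<cdot> l = c \<cdot> e"
          using tri_lift[OF t(1) d(2) t(2) cmp_hom[OF e(2) c(2)]] by blast
        have "y \<cdot> (c \<cdot> e) = (y \<cdot> d) \<cdot> l" using l cmp_assoc[OF l(1) d(2) add(2)] by simp
        also have "\<dots> = Zer K E P" using d(4) cmp_zer_left[OF l(1) P] by simp
        finally have y0: "y \<cdot> (c \<cdot> e) = Zer K E P" .
        have "x \<cdot> (c \<cdot> e) = (x \<cdot> c) \<cdot> e" using cmp_assoc[OF e(2) c(2) add(1)] by simp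
        also have "\<dots> = Zer K E P" using c(4) cmp_zer_left[OF e(2) P] by simp
        finally have x0: "x \<cdot> (c \<cdot> e) = Zer K E P" .
        have "Add K x y \<cdot> (c \<cdot> e) = Zer K E P"
          using cmp_add_left[OF cmp_hom[OF e(2) c(2)] add(1,2)] x0 y0
            add_zer_left[OF zer_hom[OF compact_ob[OF E] P]] by simp
        then show "killable S C (Add K x y)"
          using killableI[OF E cmp_hom[OF e(2) c(2)] cone_in_cmp[OF assms(1) ec c(3) e(2) c(2)] add_hom[OF add(1,2)]]
          by blast
      qed
      then show ?case using add by blast
    next
      case (inj i a)
      have "killable S C a" using I(2)[OF inj(1)] C inj(2) by blast
      then obtain C' c where c: "C' \<in> compacts \<kappa> K" "c \<in> Hom K C' C" "cone_in S c" "a \<cdot> c = Zer K C' (F i)"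
        using killableE inj(2) by metis
      have "(\<iota> i \<cdot> a) \<cdot> c = \<iota> i \<cdot> (a \<cdot> c)" using cmp_assoc[OF c(2) inj(2) \<iota>[OF inj(1)]] .
      then have "(\<iota> i \<cdot> a) \<cdot> c = Zer K C' P" using c(4) cmp_zer_right[OF \<iota>[OF inj(1)] compact_ob[OF c(1)]] by simp
      then show ?case using killableI[OF c(1-3) cmp_hom[OF inj(2) \<iota>[OF inj(1)]]] by blast
    qed
    then show "P \<in> ?T" using P by blast
  qed
qed

text \<open>If \<open>c\<close> kills the identity of \<open>C\<close>, then \<open>c\<close> itself
  is zero, so the identity extends over the cone of \<open>c\<close>: \<open>C\<close> is a retract
  of an object of \<open>S\<close>.\<close>

theorem compact_in_Loc:
  assumes "thick K S" "S \<subseteq> compacts \<kappa> K" "C \<in> compacts \<kappa> K" "C \<in> Loc \<kappa> K S"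
  shows "C \<in> S"
proof -
  let ?T = "{Y \<in> Ob K. \<forall>C \<in> compacts \<kappa> K. \<forall>f \<in> Hom K C Y. killable S C f}"
  have "S \<subseteq> ?T" using killable_thick[OF assms(1,2)] compact_ob assms(2) by blast
  then have "C \<in> ?T" using Loc_least[OF localizing_killable[OF assms(1,2)]] assms(4) by blast
  note i = idm_hom[OF compact_ob[OF assms(3)]]
  have "killable S C (Idm K C)" using \<open>C \<in> ?T\<close> assms(3) i by blast
  then obtain C' c where c: "C' \<in> compacts \<kappa> K" "c \<in> Hom K C' C" "cone_in S c" "Idm K C \<cdot> c = Zer K C' C"
    using killableE i by metis
  obtain W g h where t: "Tri K c g h" "g \<in> Hom K C W" using tri_cone_ex[OF c(2)] by metis
  obtain p where "p \<in> Hom K W C" "p \<cdot> g = Idm K C" using tri_factor_cone[OF t(1) c(2) t(2) i c(4)] .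
  then have "retract K C W" unfolding retract_def using t(2) by blast
  then show ?thesis using thick_retract[OF assms(1) cone_inD[OF assms(1) c(3) t(1) c(2) t(2)]] by blast
qed

section \<open>Cardinalities of morphism sets out of compact objects\<close>

lemma small_image: "small \<kappa> A \<Longrightarrow> small \<kappa> (f ` A)"
  unfolding small_def using ordLeq_ordLess_trans[OF card_of_image] .

lemma small_subset: "small \<kappa> B \<Longrightarrow> A \<subseteq> B \<Longrightarrow> small \<kappa> A"
  unfolding small_def using ordLeq_ordLess_trans[OF card_of_mono1] by blast

lemma small_inj: "small \<kappa> B \<Longrightarrow> inj_on f A \<Longrightarrow> f ` A \<subseteq> B \<Longrightarrow> small \<kappa> A"
  unfolding small_def using ordLeq_ordLess_trans card_of_ordLeq[of A B] by blast

lemma small_nat: "small \<kappa> (UNIV :: nat set)"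
  unfolding small_def using ordIso_ordLess_trans[OF card_of_nat univ_uncountable] .

text \<open>Regularity of \<open>\<kappa>\<close> enters here, as the stability of an infinite
  regular cardinal.\<close>

lemma small_Sigma:
  assumes "small \<kappa> A" "\<And>a. a \<in> A \<Longrightarrow> small \<kappa> (B a)" shows "small \<kappa> (Sigma A B)"
proof -
  have "natLeq \<le>o \<kappa>" using univ_uncountable ordLess_imp_ordLeq by blast
  then have "cinfinite \<kappa>" using cinfinite_mono natLeq_cinfinite by blast
  then have "stable \<kappa>" using regularCard_stable univ_regular univ_card unfolding cinfinite_def by blast
  then show ?thesis using assms stable_elim unfolding small_def by blast
qed

lemma small_UN:
  assumes "small \<kappa> A" "\<And>a. a \<in> A \<Longrightarrow> small \<kappa> (B a)" shows "small \<kappa> (\<Union>a \<in> A. B a)"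
proof -
  have "(\<Union>a \<in> A. B a) = snd ` Sigma A B" by force
  then show ?thesis using small_image[OF small_Sigma[OF assms]] by simp
qed

lemma small_Un: "small \<kappa> A \<Longrightarrow> small \<kappa> B \<Longrightarrow> small \<kappa> (A \<union> B)"
proof -
  assume h: "small \<kappa> A" "small \<kappa> B"
  have "small \<kappa> (\<Union>n \<in> (UNIV :: nat set). if n = 0 then A else B)"
    by (rule small_UN[OF small_nat]) (use h in auto)
  moreover have "A \<union> B \<subseteq> (\<Union>n \<in> (UNIV :: nat set). if n = 0 then A else B)" by auto
  ultimately show ?thesis using small_subset by blast
qed

text \<open>\<open>ess_small\<close> bounds only maps between compact objects; generation extends
  the bound to all targets. This keeps the coproducts of \<open>weak_cover\<close> small.\<close>

lemma localizing_small_hom: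
  "localizing \<kappa> K {X \<in> Ob K. \<forall>C \<in> compacts \<kappa> K. small \<kappa> (Hom K C X)}" (is "localizing \<kappa> K ?T")
proof (rule localizingI)
  show "thick K ?T"
  proof (rule thickI)
    show "?T \<subseteq> Ob K" by blast
    have "compacts \<kappa> K \<subseteq> ?T" using ess_small compact_ob by blast
    then show "?T \<noteq> {}" using unit_compact by blast
  next
    fix X S assume r: "retract K X S" and S: "S \<in> ?T"
    obtain i p where ip: "i \<in> Hom K X S" "p \<in> Hom K S X" "p \<cdot> i = Idm K X"
      using r unfolding retract_def by blast
    have "small \<kappa> (Hom K C X)" if C: "C \<in> compacts \<kappa> K" for C
    proof -
      have "Hom K C X \<subseteq> (\<lambda>f. p \<cdot> f) ` Hom K C S"
      proof
        fix f assume f: "f \<in> Hom K C X"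
        have "f = p \<cdot> (i \<cdot> f)" using cmp_assoc[OF f ip(1,2)] ip(3) idm_left[OF f] by simp
        then show "f \<in> (\<lambda>f. p \<cdot> f) ` Hom K C S" using cmp_hom[OF f ip(1)] by blast
      qed
      then show ?thesis using small_subset small_image S C by blast
    qed
    then show "X \<in> ?T" using hom_ob ip by blast
  next
    fix X assume X: "X \<in> Ob K"
    show "Sh K X \<in> ?T \<longleftrightarrow> X \<in> ?T"
    proof
      assume h: "Sh K X \<in> ?T"
      have "small \<kappa> (Hom K C X)" if C: "C \<in> compacts \<kappa> K" for C
      proof -
        have "small \<kappa> (Hom K (Sh K C) (Sh K X))"
          using h C thick_sh[OF thick_compacts compact_ob] by blast
        then show ?thesis using small_inj[of _ "ShM K"] shift_ff[OF compact_ob[OF C] X]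
          unfolding bij_betw_def by blast
      qed
      then show "X \<in> ?T" using X by blast
    next
      assume h: "X \<in> ?T"
      have "small \<kappa> (Hom K C (Sh K X))" if C: "C \<in> compacts \<kappa> K" for C
      proof -
        obtain D where D: "D \<in> Ob K" "isomorphic K (Sh K D) C" using desuspend[OF compact_ob[OF C]] .
        obtain p q where p: "p \<in> Hom K (Sh K D) C" "q \<in> Hom K C (Sh K D)" "p \<cdot> q = Idm K C"
          using D(2) by (rule isomorphicE)
        have Dc: "D \<in> compacts \<kappa> K"
          using C thick_iso[OF thick_compacts D(2)] thick_sh[OF thick_compacts D(1)] by blast
        have "Hom K C (Sh K X) \<subseteq> (\<lambda>g. ShM K g \<cdot> q) ` Hom K D X"
        proof
          fix f assume f: "f \<in> Hom K C (Sh K X)"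
          obtain g where g: "g \<in> Hom K D X" "ShM K g = f \<cdot> p" using shm_surj[OF cmp_hom[OF p(1) f] D(1) X] .
          have "f = ShM K g \<cdot> q" using g(2) cmp_assoc[OF p(2,1) f] p(3) idm_right[OF f] by simp
          then show "f \<in> (\<lambda>g. ShM K g \<cdot> q) ` Hom K D X" using g(1) by blast
        qed
        then show ?thesis using small_subset small_image h Dc by blast
      qed
      then show "Sh K X \<in> ?T" using sh_ob[OF X] by blast
    qed
  next
    fix f g h X Y Z
    assume t: "Tri K f g h" "f \<in> Hom K X Y" "g \<in> Hom K Y Z" and X: "X \<in> ?T" and Z: "Z \<in> ?T"
    have "small \<kappa> (Hom K C Y)" if C: "C \<in> compacts \<kappa> K" for C
    proof -
      \<comment> \<open>\<open>s\<close> picks a lift of each map to \<open>Z\<close>. Two lifts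
        differ by a map coming from \<open>X\<close>, so the pairs of maps to \<open>Z\<close> and
        to \<open>X\<close> exhaust the maps to \<open>Y\<close>.\<close>
      define s where "s z = (SOME y. y \<in> Hom K C Y \<and> g \<cdot> y = z)" for z
      have "Hom K C Y \<subseteq> (\<lambda>(z, x). Add K (f \<cdot> x) (s z)) ` (Hom K C Z \<times> Hom K C X)"
      proof
        fix y assume y: "y \<in> Hom K C Y"
        define w where "w = s (g \<cdot> y)"
        have "\<exists>w. w \<in> Hom K C Y \<and> g \<cdot> w = g \<cdot> y" using y by blast
        then have w: "w \<in> Hom K C Y" "g \<cdot> w = g \<cdot> y"
          unfolding w_def s_def by (metis (mono_tags, lifting) someI_ex)+
        have "g \<cdot> Add K y (Neg K w) = Zer K C Z"
          using y w t(3) hom_ob[OF y] by (simp add: cat)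
        then obtain x where x: "x \<in> Hom K C X" "f \<cdot> x = Add K y (Neg K w)"
          using tri_lift[OF t add_hom[OF y neg_hom[OF w(1)]]] by blast
        have "y = Add K (f \<cdot> x) (s (g \<cdot> y))" using sub_add[OF y w(1)] x(2) w_def by simp
        then show "y \<in> (\<lambda>(z, x). Add K (f \<cdot> x) (s z)) ` (Hom K C Z \<times> Hom K C X)"
          using x(1) cmp_hom[OF y t(3)] by (intro image_eqI[of _ _ "(g \<cdot> y, x)"]) auto
      qed
      moreover have "small \<kappa> (Hom K C Z \<times> Hom K C X)" by (rule small_Sigma) (use X Z C in blast)+
      ultimately show ?thesis using small_subset small_image by blast
    qed
    then show "Y \<in> ?T" using hom_ob t by blast
  qed
next
  fix I :: "'u set" and F P \<iota>
  assume I: "small \<kappa> I" "\<And>i. i \<in> I \<Longrightarrow> F i \<in> ?T" "\<And>i. i \<in> I \<Longrightarrow> F i \<in> Ob K" "is_coproduct K I F P \<iota>"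
  have F: "\<forall>i \<in> I. F i \<in> Ob K" using I(3) by blast
  have "small \<kappa> (Hom K C P)" if C: "C \<in> compacts \<kappa> K" for C
  proof -
    \<comment> \<open>The maps through one summand, to be closed under addition in countably many
      rounds; countable unions of small sets are small.\<close>
    define E0 where "E0 = {Zer K C P} \<union> (\<Union>i \<in> I. (\<lambda>a. \<iota> i \<cdot> a) ` Hom K C (F i))"
    define E where "E = rec_nat E0 (\<lambda>_ A. A \<union> (\<lambda>(x, y). Add K x y) ` (A \<times> A))"
    have E: "E 0 = E0" "\<And>n. E (Suc n) = E n \<union> (\<lambda>(x, y). Add K x y) ` (E n \<times> E n)"
      unfolding E_def by simp_all
    have "small \<kappa> {Zer K C P}" by (rule small_subset[OF small_image[OF small_nat, of "\<lambda>_. Zer K C P"]]) blast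
    moreover have "small \<kappa> (\<Union>i \<in> I. (\<lambda>a. \<iota> i \<cdot> a) ` Hom K C (F i))"
      by (rule small_UN[OF I(1) small_image]) (use I(2) C in blast)
    ultimately have E0: "small \<kappa> E0" unfolding E0_def by (rule small_Un)
    have "small \<kappa> (E n)" for n
    proof (induction n)
      case 0 then show ?case using E0 E(1) by simp
    next
      case (Suc n)
      then show ?case unfolding E(2) by (intro small_Un small_image small_Sigma)
    qed
    then have s: "small \<kappa> (\<Union>n. E n)" using small_UN[OF small_nat] by blast
    have mono: "E n \<subseteq> E (n + k)" for n k by (induction k) (auto simp: E)
    have "x \<in> (\<Union>n. E n)" if x: "x \<in> Hom K C P" for x
      using C I(1,4) x F
    proof (induction rule: compact_induct)
      case zer then show ?case using E(1) E0_def by blast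
    next
      case (add x y)
      then obtain n m where "x \<in> E n" "y \<in> E m" by blast
      then have "x \<in> E (n + m)" "y \<in> E (n + m)" using mono[of n m] mono[of m n] by (auto simp: add.commute)
      then have "Add K x y \<in> E (Suc (n + m))" using E(2) by force
      then show ?case by blast
    next
      case (inj i a)
      then have "\<iota> i \<cdot> a \<in> E 0" unfolding E(1) E0_def by blast
      then show ?case by blast
    qed
    then show ?thesis using small_subset[OF s] by blast
  qed
  then show "P \<in> ?T" using coproduct_ob[OF I(4)] by blast
qed

lemma small_hom:
  assumes "C \<in> compacts \<kappa> K" "X \<in> Ob K" shows "small \<kappa> (Hom K C X)"
proof -
  have "compacts \<kappa> K \<subseteq> {X \<in> Ob K. \<forall>C \<in> compacts \<kappa> K. small \<kappa> (Hom K C X)}"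
    using ess_small compact_ob by blast
  then show ?thesis using Loc_least[OF localizing_small_hom] generated assms by blast
qed

end

section \<open>Existence of Rickard triangles\<close>

context rigidly_compactly_generated begin

text \<open>The coproduct over all maps of \<open>A\<close> from a small set of representatives of
  \<open>S\<close>; closure under precomposition lets every object of \<open>S\<close> be replaced
  by its representative. \<open>A\<close> will consist either of all maps into \<open>Y\<close> or
  of those annihilated by a given map.\<close>

lemma weak_cover:
  assumes S: "thick K S" "S \<subseteq> compacts \<kappa> K" and Y: "Y \<in> Ob K"
    and A: "\<And>s. A s \<subseteq> Hom K s Y"
    and A_pre: "\<And>r s f p. p \<in> Hom K r s \<Longrightarrow> f \<in> A s \<Longrightarrow> f \<cdot> p \<in> A r"
  obtains P a where "P \<in> Loc \<kappa> K S" "a \<in> Hom K P Y"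
    "\<And>s f. s \<in> S \<Longrightarrow> f \<in> A s \<Longrightarrow> \<exists>f' \<in> Hom K s P. a \<cdot> f' = f"
    "\<And>T b. b \<in> Hom K Y T \<Longrightarrow> (\<And>s f. f \<in> A s \<Longrightarrow> b \<cdot> f = Zer K s T) \<Longrightarrow> b \<cdot> a = Zer K P T"
proof -
  obtain R where R: "R \<subseteq> compacts \<kappa> K" "small \<kappa> R" "\<forall>C \<in> compacts \<kappa> K. \<exists>D \<in> R. isomorphic K C D"
    using ess_small by blast
  define J where "J = (SIGMA r : R \<inter> S. A r)"
  have "small \<kappa> (A r)" if "r \<in> R" for r using small_subset[OF small_hom A] R(1) that Y by blast
  then have J: "small \<kappa> J" unfolding J_def
    by (intro small_Sigma) (use small_subset[OF R(2)] in blast)+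
  have JS: "fst i \<in> S" "snd i \<in> A (fst i)" "fst i \<in> Ob K" if "i \<in> J" for i
    using that thick_ob[OF S(1)] unfolding J_def by auto
  obtain P \<iota> where c: "is_coproduct K J fst P \<iota>" using coproduct_ex[OF J, of fst] JS(3) by blast
  have JA: "snd i \<in> Hom K (fst i) Y" if "i \<in> J" for i using JS(2)[OF that] A by blast
  obtain a where a: "a \<in> Hom K P Y" "\<And>i. i \<in> J \<Longrightarrow> a \<cdot> \<iota> i = snd i"
    using coproduct_map[OF c Y JA] by blast
  have P: "P \<in> Loc \<kappa> K S"
    using localizing_coproduct'[OF localizing_Loc J _ c] JS(1) Loc_subset thick_ob[OF S(1)] by blast
  have "\<exists>f' \<in> Hom K s P. a \<cdot> f' = f" if s: "s \<in> S" and f: "f \<in> A s" for s f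
  proof -
    obtain r where r: "r \<in> R" "isomorphic K s r" using R(3) s S(2) by blast
    obtain p q where p: "p \<in> Hom K s r" "q \<in> Hom K r s" "q \<cdot> p = Idm K s" using r(2) by (rule isomorphicE)
    have rS: "r \<in> S" using thick_iso[OF S(1) r(2)] s by blast
    have fq: "f \<cdot> q \<in> A r" using A_pre[OF p(2) f] .
    then have j: "(r, f \<cdot> q) \<in> J" unfolding J_def using r rS by blast
    have fh: "f \<in> Hom K s Y" using f A by blast
    have \<iota>: "\<iota> (r, f \<cdot> q) \<in> Hom K r P" using coproduct_hom[OF c j] by simp
    have "a \<cdot> (\<iota> (r, f \<cdot> q) \<cdot> p) = (f \<cdot> q) \<cdot> p" using a(2)[OF j] cmp_assoc[OF p(1) \<iota> a(1)] by simp
    also have "\<dots> = f" using cmp_assoc[OF p(1,2) fh] p(3) idm_right[OF fh] by simp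
    finally show ?thesis using cmp_hom[OF p(1) \<iota>] by blast
  qed
  moreover have "b \<cdot> a = Zer K P T"
    if b: "b \<in> Hom K Y T" and z: "\<And>s f. f \<in> A s \<Longrightarrow> b \<cdot> f = Zer K s T" for T b
  proof (rule coproduct_eqI[OF c cmp_hom[OF a(1) b] zer_hom])
    show T: "P \<in> Ob K" "T \<in> Ob K" using hom_ob a b by blast+
    fix i assume i: "i \<in> J"
    have "(b \<cdot> a) \<cdot> \<iota> i = Zer K (fst i) T"
      using cmp_assoc[OF coproduct_hom[OF c i] a(1) b] a(2)[OF i] z[OF JS(2)[OF i]] by simp
    then show "(b \<cdot> a) \<cdot> \<iota> i = Zer K P T \<cdot> \<iota> i" using cmp_zer_left[OF coproduct_hom[OF c i] T(2)] by simp
  qed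
  ultimately show ?thesis using that[OF P a(1)] by blast
qed

text \<open>As when killing homotopy classes by attaching cells: \<open>G'\<close> is the cone of a
  weak cover of the maps into \<open>G\<close> that die in \<open>X\<close>, so these maps die in
  \<open>G'\<close>, while \<open>g\<close> still extends over it.\<close>

lemma rickard_step:
  assumes S: "thick K S" "S \<subseteq> compacts \<kappa> K" and G: "G \<in> Loc \<kappa> K S" and g: "g \<in> Hom K G X"
  obtains G' g' j where "G' \<in> Loc \<kappa> K S" "g' \<in> Hom K G' X" "j \<in> Hom K G G'" "g' \<cdot> j = g"
    "\<forall>s \<in> S. \<forall>f \<in> Hom K s G. g \<cdot> f = Zer K s X \<longrightarrow> j \<cdot> f = Zer K s G'"
proof -
  have loc: "localizing \<kappa> K (Loc \<kappa> K S)" using localizing_Loc thick_ob[OF S(1)] by blast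
  have ob: "G \<in> Ob K" "X \<in> Ob K" using hom_ob g by blast+
  define A where "A s = {f \<in> Hom K s G. g \<cdot> f = Zer K s X}" for s
  have A_pre: "f \<cdot> p \<in> A r" if p: "p \<in> Hom K r s" and f: "f \<in> A s" for r s f p
  proof -
    have f': "f \<in> Hom K s G" "g \<cdot> f = Zer K s X" using f unfolding A_def by auto
    then have "g \<cdot> (f \<cdot> p) = Zer K r X"
      using cmp_assoc[OF p f'(1) g] cmp_zer_left[OF p ob(2)] by simp
    then show ?thesis unfolding A_def using cmp_hom[OF p f'(1)] by blast
  qed
  obtain P a where P: "P \<in> Loc \<kappa> K S" "a \<in> Hom K P G"
    and a1: "\<forall>s f. s \<in> S \<longrightarrow> f \<in> A s \<longrightarrow> (\<exists>f' \<in> Hom K s P. a \<cdot> f' = f)"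
    and a2: "g \<cdot> a = Zer K P X"
    by (rule weak_cover[OF S ob(1), of A]) (use A_pre g in \<open>auto simp: A_def\<close>)
  obtain G' j h where t: "Tri K a j h" "j \<in> Hom K G G'" using tri_cone_ex[OF P(2)] by metis
  have G': "G' \<in> Loc \<kappa> K S" using thick_cone[OF localizing_thick[OF loc] t(1) P(2) t(2) P(1) G] .
  obtain g' where g': "g' \<in> Hom K G' X" "g' \<cdot> j = g" using tri_factor_cone[OF t(1) P(2) t(2) g a2] .
  have "j \<cdot> f = Zer K s G'" if s: "s \<in> S" and f: "f \<in> Hom K s G" "g \<cdot> f = Zer K s X" for s f
  proof -
    obtain f' where f': "f' \<in> Hom K s P" "a \<cdot> f' = f" using a1 s f unfolding A_def by blast
    have "j \<cdot> f = (j \<cdot> a) \<cdot> f'" using f' cmp_assoc[OF f'(1) P(2) t(2)] by simp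
    then show ?thesis using tri_cmp_zer[OF t(1) P(2) t(2)] cmp_zer_left[OF f'(1) hom_ob(2)[OF t(2)]] by simp
  qed
  then show ?thesis using that[OF G' g'(1) t(2) g'(2)] by blast
qed

lemma rickard_tower:
  assumes S: "thick K S" "S \<subseteq> compacts \<kappa> K" and X: "X \<in> Ob K"
  obtains G g j where "\<forall>n::nat. G n \<in> Loc \<kappa> K S" "\<forall>n. g n \<in> Hom K (G n) X"
    "\<forall>n. j n \<in> Hom K (G n) (G (Suc n))" "\<forall>n. g (Suc n) \<cdot> j n = g n"
    "\<forall>n. \<forall>s \<in> S. \<forall>f \<in> Hom K s (G n). g n \<cdot> f = Zer K s X \<longrightarrow> j n \<cdot> f = Zer K s (G (Suc n))"
    "\<forall>s \<in> S. \<forall>f \<in> Hom K s X. \<exists>f' \<in> Hom K s (G 0). g 0 \<cdot> f' = f"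
proof -
  \<comment> \<open>Surjectivity onto the maps into \<open>X\<close> is recorded at stage 0 only;
    later stages inherit it through the transition maps.\<close>
  define P where "P n Gg \<longleftrightarrow> fst Gg \<in> Loc \<kappa> K S \<and> snd Gg \<in> Hom K (fst Gg) X \<and>
    (n = 0 \<longrightarrow> (\<forall>s \<in> S. \<forall>f \<in> Hom K s X. \<exists>f' \<in> Hom K s (fst Gg). snd Gg \<cdot> f' = f))" for n :: nat and Gg
  define Q where "Q Gg Gg' j \<longleftrightarrow> j \<in> Hom K (fst Gg) (fst Gg') \<and> snd Gg' \<cdot> j = snd Gg \<and>
    (\<forall>s \<in> S. \<forall>f \<in> Hom K s (fst Gg). snd Gg \<cdot> f = Zer K s X \<longrightarrow> j \<cdot> f = Zer K s (fst Gg'))" for Gg Gg' j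
  obtain G0 g0 where g0: "G0 \<in> Loc \<kappa> K S" "g0 \<in> Hom K G0 X"
    "\<forall>s f. s \<in> S \<longrightarrow> f \<in> Hom K s X \<longrightarrow> (\<exists>f' \<in> Hom K s G0. g0 \<cdot> f' = f)"
    by (rule weak_cover[OF S X, of "\<lambda>s. Hom K s X"]) (use cmp_hom in auto)
  have "\<exists>F. \<forall>n. P n (F n) \<and> (\<exists>j. Q (F n) (F (Suc n)) j)"
  proof (rule dependent_nat_choice)
    have "P 0 (G0, g0)" unfolding P_def using g0 by simp
    then show "\<exists>x. P 0 x" by blast
  next
    fix x n assume "P n x"
    then have x: "fst x \<in> Loc \<kappa> K S" "snd x \<in> Hom K (fst x) X" unfolding P_def by auto
    obtain G' g' j where "G' \<in> Loc \<kappa> K S" "g' \<in> Hom K G' X" "j \<in> Hom K (fst x) G'" "g' \<cdot> j = snd x"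
      "\<forall>s \<in> S. \<forall>f \<in> Hom K s (fst x). snd x \<cdot> f = Zer K s X \<longrightarrow> j \<cdot> f = Zer K s G'"
      using rickard_step[OF S x] .
    then have "P (Suc n) (G', g')" "Q x (G', g') j" unfolding P_def Q_def by simp_all
    then show "\<exists>y. P (Suc n) y \<and> (\<exists>j. Q x y j)" by blast
  qed
  then obtain F where F: "\<And>n. P n (F n)" "\<And>n. \<exists>j. Q (F n) (F (Suc n)) j" by blast
  then obtain j where j: "\<And>n. Q (F n) (F (Suc n)) (j n)" by metis
  show ?thesis
    by (rule that[of "\<lambda>n. fst (F n)" "\<lambda>n. snd (F n)" j])
      (use F(1) F(1)[of 0] j in \<open>simp_all add: P_def Q_def\<close>)
qed

text \<open>Injectivity on maps from \<open>S\<close> survives the shift, because objects of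
  \<open>S\<close> can be desuspended within \<open>S\<close>. It will make connecting maps
  vanish.\<close>

lemma shift_cancel:
  assumes S: "thick K S" and v: "v \<in> Hom K A B"
    and inj: "\<And>s z. s \<in> S \<Longrightarrow> z \<in> Hom K s A \<Longrightarrow> v \<cdot> z = Zer K s B \<Longrightarrow> z = Zer K s A"
    and s: "s \<in> S" and z: "z \<in> Hom K s (Sh K A)" "ShM K v \<cdot> z = Zer K s (Sh K B)"
  shows "z = Zer K s (Sh K A)"
proof -
  have ob: "A \<in> Ob K" "B \<in> Ob K" "s \<in> Ob K" using v z hom_ob by blast+
  obtain r where r: "r \<in> Ob K" "isomorphic K (Sh K r) s" using desuspend[OF ob(3)] .
  obtain p q where p: "p \<in> Hom K (Sh K r) s" "q \<in> Hom K s (Sh K r)" "p \<cdot> q = Idm K s"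
    using r(2) by (rule isomorphicE)
  have rS: "r \<in> S" using thick_iso[OF S r(2)] thick_sh[OF S r(1)] s by blast
  obtain w where w: "w \<in> Hom K r A" "ShM K w = z \<cdot> p" using shm_surj[OF cmp_hom[OF p(1) z(1)] r(1) ob(1)] .
  have "ShM K (v \<cdot> w) = (ShM K v \<cdot> z) \<cdot> p"
    using w(2) shm_cmp[OF w(1) v] cmp_assoc[OF p(1) z(1) shm_hom[OF v]] by simp
  also have "\<dots> = ShM K (Zer K r B)" using z(2) cmp_zer_left[OF p(1) sh_ob[OF ob(2)]] r ob by (simp add: cat_shm)
  finally have "v \<cdot> w = Zer K r B" using shm_inj cmp_hom[OF w(1) v] zer_hom[OF r(1) ob(2)] by blast
  then have "w = Zer K r A" using inj[OF rS w(1)] by blast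
  then have "z \<cdot> p = Zer K (Sh K r) (Sh K A)" using w(2) r ob by (simp add: cat_shm)
  then have "(z \<cdot> p) \<cdot> q = Zer K s (Sh K A)" using cmp_zer_left[OF p(2) sh_ob[OF ob(1)]] by simp
  then show ?thesis using cmp_assoc[OF p(2,1) z(1)] p(3) idm_right[OF z(1)] by simp
qed

text \<open>The telescope of the tower, the cone of the identity minus the transition map on its
  coproduct, has the same maps from objects of \<open>S\<close> as \<open>X\<close>.\<close>

lemma rickard_ex:
  assumes S: "thick K S" "S \<subseteq> compacts \<kappa> K" and X: "X \<in> Ob K"
  obtains G L where "rickard_triangle \<kappa> K S X G L"
proof -
  have loc: "localizing \<kappa> K (Loc \<kappa> K S)" using localizing_Loc thick_ob[OF S(1)] by blast
  obtain G g j where tower: "\<forall>n::nat. G n \<in> Loc \<kappa> K S" "\<forall>n. g n \<in> Hom K (G n) X"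
    "\<forall>n. j n \<in> Hom K (G n) (G (Suc n))" "\<forall>n. g (Suc n) \<cdot> j n = g n"
    "\<forall>n. \<forall>s \<in> S. \<forall>f \<in> Hom K s (G n). g n \<cdot> f = Zer K s X \<longrightarrow> j n \<cdot> f = Zer K s (G (Suc n))"
    "\<forall>s \<in> S. \<forall>f \<in> Hom K s X. \<exists>f' \<in> Hom K s (G 0). g 0 \<cdot> f' = f"
    using rickard_tower[OF S X] .
  note g = tower(2)[rule_format] and j = tower(3)[rule_format] and gj = tower(4)[rule_format]
    and kill = tower(5)[rule_format] and onto = tower(6)[rule_format]
  have Gob: "G n \<in> Ob K" for n using hom_ob[OF g] by blast
  obtain P \<iota> where c: "is_coproduct K (UNIV :: nat set) G P \<iota>" using coproduct_ex[OF small_nat Gob] .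
  have P: "P \<in> Ob K" using coproduct_ob[OF c] .
  have \<iota>: "\<iota> n \<in> Hom K (G n) P" for n using coproduct_hom[OF c] by blast
  have PL: "P \<in> Loc \<kappa> K S" using localizing_coproduct'[OF loc small_nat _ c] tower(1) by blast
  have \<iota>j: "\<iota> (Suc n) \<cdot> j n \<in> Hom K (G n) P" for n using cmp_hom[OF j \<iota>] .
  obtain t where t: "t \<in> Hom K P P" "\<And>n. t \<cdot> \<iota> n = \<iota> (Suc n) \<cdot> j n"
    by (rule coproduct_map[OF c P \<iota>j]) blast
  define d where "d = Add K (Idm K P) (Neg K t)"
  have d: "d \<in> Hom K P P" unfolding d_def using t(1) P by (simp add: cat)
  have dx: "d \<cdot> x = Add K x (Neg K (t \<cdot> x))" if "x \<in> Hom K A P" for A x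
    unfolding d_def using that t(1) P by (simp add: cat)
  have xd: "x \<cdot> d = Add K x (Neg K (x \<cdot> t))" if "x \<in> Hom K P A" for A x
    unfolding d_def using that t(1) P by (simp add: cat)
  obtain H q h where tr: "Tri K d q h" "q \<in> Hom K P H" "h \<in> Hom K H (Sh K P)" "H \<in> Ob K"
    using tri_cone_ex[OF d] .
  have HL: "H \<in> Loc \<kappa> K S" using thick_cone[OF localizing_thick[OF loc] tr(1) d tr(2) PL PL] .
  \<comment> \<open>In the telescope, stage \<open>n\<close> agrees with its image at stage
    \<open>n + 1\<close>.\<close>
  have q\<iota>: "q \<cdot> \<iota> n = q \<cdot> (\<iota> (Suc n) \<cdot> j n)" for n
  proof -
    have "Add K q (Neg K (q \<cdot> t)) = Zer K P H" using tri_cmp_zer[OF tr(1) d tr(2)] xd[OF tr(2)] by simp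
    then have "q = q \<cdot> t" using sub_eq_zer_iff[OF tr(2) cmp_hom[OF t(1) tr(2)]] by simp
    then have "q \<cdot> \<iota> n = (q \<cdot> t) \<cdot> \<iota> n" by simp
    then show ?thesis using cmp_assoc[OF \<iota> t(1) tr(2)] t(2) by simp
  qed
  obtain e where e: "e \<in> Hom K P X" "\<And>n. e \<cdot> \<iota> n = g n"
    by (rule coproduct_map[OF c X g]) blast
  have "e \<cdot> t = e"
  proof (rule coproduct_eqI[OF c cmp_hom[OF t(1) e(1)] e(1)])
    fix n
    have "(e \<cdot> t) \<cdot> \<iota> n = e \<cdot> (\<iota> (Suc n) \<cdot> j n)" using cmp_assoc[OF \<iota> t(1) e(1)] t(2) by simp
    also have "\<dots> = g n" using cmp_assoc[OF j \<iota> e(1)] e(2) gj by simp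
    finally show "(e \<cdot> t) \<cdot> \<iota> n = e \<cdot> \<iota> n" using e(2) by simp
  qed
  then have "e \<cdot> d = Zer K P X" using xd[OF e(1)] add_neg_right[OF e(1)] by simp
  then obtain k where k: "k \<in> Hom K H X" "k \<cdot> q = e" using tri_factor_cone[OF tr(1) d tr(2) e(1)] by blast
  obtain \<pi> where \<pi>': "\<forall>i \<in> UNIV. \<pi> i \<in> Hom K P (G i)"
    "\<forall>i \<in> UNIV. \<forall>m \<in> UNIV. \<pi> i \<cdot> \<iota> m = (if i = m then Idm K (G i) else Zer K (G m) (G i))"
    using coproduct_proj[OF c Gob] by blast
  have \<pi>: "\<And>i. \<pi> i \<in> Hom K P (G i)"
    "\<And>i m. \<pi> i \<cdot> \<iota> m = (if i = m then Idm K (G i) else Zer K (G m) (G i))"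
    using \<pi>' by auto
  have \<pi>t0: "\<pi> 0 \<cdot> t = Zer K P (G 0)"
  proof (rule coproduct_eqI[OF c cmp_hom[OF t(1) \<pi>(1)] zer_hom[OF P Gob]])
    fix n
    have "(\<pi> 0 \<cdot> t) \<cdot> \<iota> n = (\<pi> 0 \<cdot> \<iota> (Suc n)) \<cdot> j n"
      using cmp_assoc[OF \<iota> t(1) \<pi>(1)] t(2) cmp_assoc[OF j \<iota> \<pi>(1)] by simp
    then show "(\<pi> 0 \<cdot> t) \<cdot> \<iota> n = Zer K P (G 0) \<cdot> \<iota> n"
      using \<pi>(2) cmp_zer_left[OF j Gob] cmp_zer_left[OF \<iota> Gob] by simp
  qed
  have \<pi>tS: "\<pi> (Suc m) \<cdot> t = j m \<cdot> \<pi> m" for m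
  proof (rule coproduct_eqI[OF c cmp_hom[OF t(1) \<pi>(1)] cmp_hom[OF \<pi>(1) j]])
    fix n
    have "(\<pi> (Suc m) \<cdot> t) \<cdot> \<iota> n = (\<pi> (Suc m) \<cdot> \<iota> (Suc n)) \<cdot> j n"
      using cmp_assoc[OF \<iota> t(1) \<pi>(1)] t(2) cmp_assoc[OF j \<iota> \<pi>(1)] by simp
    moreover have "(j m \<cdot> \<pi> m) \<cdot> \<iota> n = j m \<cdot> (\<pi> m \<cdot> \<iota> n)" using cmp_assoc[OF \<iota> \<pi>(1) j] .
    ultimately show "(\<pi> (Suc m) \<cdot> t) \<cdot> \<iota> n = (j m \<cdot> \<pi> m) \<cdot> \<iota> n"
      using \<pi>(2) cmp_zer_left[OF j Gob] cmp_zer_right[OF j Gob] idm_left[OF j] idm_right[OF j]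
      by (cases "m = n") simp_all
  qed
  \<comment> \<open>From \<open>d x = 0\<close> comes \<open>x = t x\<close>. As \<open>t\<close>
    moves every summand one step up, \<open>\<pi> 0\<close> annihilates \<open>t\<close>, and all
    projections of \<open>x\<close> vanish by induction; compactness of \<open>s\<close> then gives
    \<open>x = 0\<close>.\<close>
  have d_inj: "x = Zer K s P" if s: "s \<in> S" and x: "x \<in> Hom K s P" and z: "d \<cdot> x = Zer K s P" for s x
  proof (rule compact_proj_zero[OF _ small_nat c x Gob \<pi>(1) \<pi>(2)])
    show "s \<in> compacts \<kappa> K" using s S by blast
    have tx: "t \<cdot> x = x" using dx[OF x] z sub_eq_zer_iff[OF x cmp_hom[OF x t(1)]] by simp
    fix n show "\<pi> n \<cdot> x = Zer K s (G n)"
    proof (induction n)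
      case 0
      have "\<pi> 0 \<cdot> x = (\<pi> 0 \<cdot> t) \<cdot> x" using tx cmp_assoc[OF x t(1) \<pi>(1)] by simp
      then show ?case using \<pi>t0 cmp_zer_left[OF x Gob] by simp
    next
      case (Suc n)
      have "\<pi> (Suc n) \<cdot> x = (\<pi> (Suc n) \<cdot> t) \<cdot> x" using tx cmp_assoc[OF x t(1) \<pi>(1)] by simp
      also have "\<dots> = j n \<cdot> (\<pi> n \<cdot> x)" using \<pi>tS cmp_assoc[OF x \<pi>(1) j] by simp
      finally show ?case using Suc cmp_zer_right[OF j hom_ob(1)[OF x]] by simp
    qed
  qed
  \<comment> \<open>Every map from \<open>S\<close> to the telescope comes from a finite stage: it
    lifts along \<open>q\<close> because the shift of \<open>d\<close> is injective on maps from
    \<open>S\<close>, the lift is a finite sum, and its terms can be moved to a common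
    stage.\<close>
  have stage: "\<exists>n. \<exists>a \<in> Hom K s (G n). y = (q \<cdot> \<iota> n) \<cdot> a" if s: "s \<in> S" and y: "y \<in> Hom K s H" for s y
  proof -
    have sc: "s \<in> compacts \<kappa> K" using s S by blast
    have hy: "h \<cdot> y \<in> Hom K s (Sh K P)" using cmp_hom[OF y tr(3)] .
    have "ShM K d \<cdot> (h \<cdot> y) = (ShM K d \<cdot> h) \<cdot> y" using cmp_assoc[OF y tr(3) shm_hom[OF d]] by simp
    also have "\<dots> = Zer K s (Sh K P)"
      using tri_cmp_zer3[OF tr(1) d tr(3)] cmp_zer_left[OF y sh_ob[OF P]] by simp
    finally have "h \<cdot> y = Zer K s (Sh K P)" using shift_cancel[OF S(1) d d_inj s hy] by blast
    then obtain x where x: "x \<in> Hom K s P" "q \<cdot> x = y" using tri_lift2[OF tr(1-3) y] by blast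
    have up: "\<exists>b \<in> Hom K s (G (n + m)). (q \<cdot> \<iota> n) \<cdot> a = (q \<cdot> \<iota> (n + m)) \<cdot> b" if a: "a \<in> Hom K s (G n)" for n m a
    proof (induction m)
      case 0 then show ?case using a by auto
    next
      case (Suc m)
      then obtain b where b: "b \<in> Hom K s (G (n + m))" "(q \<cdot> \<iota> n) \<cdot> a = (q \<cdot> \<iota> (n + m)) \<cdot> b" by blast
      have "(q \<cdot> \<iota> (n + m)) \<cdot> b = (q \<cdot> (\<iota> (Suc (n + m)) \<cdot> j (n + m))) \<cdot> b" using q\<iota>[of "n + m"] by simp
      also have "\<dots> = (q \<cdot> \<iota> (Suc (n + m))) \<cdot> (j (n + m) \<cdot> b)"
        using tr(2) \<iota>[of "Suc (n + m)"] j[of "n + m"] b(1) by (simp add: cat)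
      finally show ?case using b cmp_hom[OF b(1) j] by auto
    qed
    have "\<forall>i \<in> (UNIV :: nat set). G i \<in> Ob K" using Gob by blast
    with sc small_nat c x(1) have "\<exists>n. \<exists>a \<in> Hom K s (G n). q \<cdot> x = (q \<cdot> \<iota> n) \<cdot> a"
    proof (induction rule: compact_induct)
      case zer
      have "q \<cdot> Zer K s P = (q \<cdot> \<iota> 0) \<cdot> Zer K s (G 0)"
        using cmp_zer_right[OF tr(2) compact_ob[OF sc]] cmp_zer_right[OF cmp_hom[OF \<iota> tr(2)] compact_ob[OF sc]] by simp
      then show ?case using zer_hom[OF compact_ob[OF sc] Gob] by blast
    next
      case (add x y)
      then obtain n a m b where a: "a \<in> Hom K s (G n)" "q \<cdot> x = (q \<cdot> \<iota> n) \<cdot> a"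
        and b: "b \<in> Hom K s (G m)" "q \<cdot> y = (q \<cdot> \<iota> m) \<cdot> b" by blast
      obtain a' where a': "a' \<in> Hom K s (G (n + m))" "q \<cdot> x = (q \<cdot> \<iota> (n + m)) \<cdot> a'"
        using up[OF a(1), of m] a(2) by auto
      obtain b' where b': "b' \<in> Hom K s (G (n + m))" "q \<cdot> y = (q \<cdot> \<iota> (n + m)) \<cdot> b'"
        using up[OF b(1), of n] b(2) by (auto simp: add.commute)
      have "q \<cdot> Add K x y = (q \<cdot> \<iota> (n + m)) \<cdot> Add K a' b'"
        using cmp_add_right[OF add(1,2) tr(2)] cmp_add_right[OF a'(1) b'(1) cmp_hom[OF \<iota> tr(2)]] a' b' by simp
      then show ?case using add_hom[OF a'(1) b'(1)] by blast
    next
      case (inj i a)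
      then show ?case using cmp_assoc[OF inj(2) \<iota> tr(2)] by metis
    qed
    then show ?thesis using x(2) by simp
  qed
  have k\<iota>: "k \<cdot> ((q \<cdot> \<iota> n) \<cdot> a) = g n \<cdot> a" if a: "a \<in> Hom K s (G n)" for s n a
    using cmp_assoc[OF a cmp_hom[OF \<iota> tr(2)] k(1)] cmp_assoc[OF \<iota> tr(2) k(1)] k(2) e(2) by simp
  \<comment> \<open>A map represented at stage \<open>n\<close> that dies in \<open>X\<close> dies
    at stage \<open>n + 1\<close>, by construction of the tower.\<close>
  have k_inj: "y = Zer K s H" if s: "s \<in> S" and y: "y \<in> Hom K s H" and z: "k \<cdot> y = Zer K s X" for s y
  proof -
    obtain n a where a: "a \<in> Hom K s (G n)" "y = (q \<cdot> \<iota> n) \<cdot> a" using stage[OF s y] by blast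
    have "g n \<cdot> a = Zer K s X" using k\<iota>[OF a(1)] a(2) z by simp
    then have ja: "j n \<cdot> a = Zer K s (G (Suc n))" using kill[OF s a(1)] by blast
    have "y = (q \<cdot> (\<iota> (Suc n) \<cdot> j n)) \<cdot> a" using a(2) q\<iota> by simp
    also have "\<dots> = (q \<cdot> \<iota> (Suc n)) \<cdot> (j n \<cdot> a)" using tr(2) \<iota>[of "Suc n"] j[of n] a(1) by (simp add: cat)
    also have "\<dots> = Zer K s H" using ja cmp_zer_right[OF cmp_hom[OF \<iota> tr(2)] hom_ob(1)[OF y]] by simp
    finally show ?thesis .
  qed
  have k_onto: "\<exists>y \<in> Hom K s H. k \<cdot> y = f" if s: "s \<in> S" and f: "f \<in> Hom K s X" for s f
  proof -
    obtain f' where f': "f' \<in> Hom K s (G 0)" "g 0 \<cdot> f' = f" using onto[OF s f] by blast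
    then show ?thesis using k\<iota>[OF f'(1)] cmp_hom[OF f'(1) cmp_hom[OF \<iota> tr(2)]] by blast
  qed
  \<comment> \<open>Since \<open>k\<close> is bijective on maps from \<open>S\<close>, its cone
    receives none but zero: such a map lifts to \<open>X\<close> by injectivity, and the lift
    factors through \<open>k\<close> by surjectivity.\<close>
  obtain L b m where l: "Tri K k b m" "b \<in> Hom K X L" "m \<in> Hom K L (Sh K H)" "L \<in> Ob K"
    using tri_cone_ex[OF k(1)] .
  have "y = Zer K s L" if s: "s \<in> S" and y: "y \<in> Hom K s L" for s y
  proof -
    have my: "m \<cdot> y \<in> Hom K s (Sh K H)" using cmp_hom[OF y l(3)] .
    have "ShM K k \<cdot> (m \<cdot> y) = (ShM K k \<cdot> m) \<cdot> y" using cmp_assoc[OF y l(3) shm_hom[OF k(1)]] by simp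
    also have "\<dots> = Zer K s (Sh K X)"
      using tri_cmp_zer3[OF l(1) k(1) l(3)] cmp_zer_left[OF y sh_ob[OF X]] by simp
    finally have "m \<cdot> y = Zer K s (Sh K H)" using shift_cancel[OF S(1) k(1) k_inj s my] by blast
    then obtain x where x: "x \<in> Hom K s X" "b \<cdot> x = y" using tri_lift2[OF l(1-3) y] by blast
    obtain w where w: "w \<in> Hom K s H" "k \<cdot> w = x" using k_onto[OF s x(1)] by blast
    have "y = (b \<cdot> k) \<cdot> w" using x(2) w cmp_assoc[OF w(1) k(1) l(2)] by simp
    then show ?thesis using tri_cmp_zer[OF l(1) k(1) l(2)] cmp_zer_left[OF w(1) l(4)] by simp
  qed
  then have "L \<in> perp_right K S" unfolding perp_right_def hom0_def using l(4) by blast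
  then have "\<forall>B \<in> Loc \<kappa> K S. Hom K B L = {Zer K B L}"
    using Loc_perp_left[OF S] hom0_eq[OF _ l(4)] thick_ob[OF localizing_thick[OF loc]] by blast
  then have "rickard_triangle \<kappa> K S X H L"
    unfolding rickard_triangle_def using k(1) l HL by blast
  then show ?thesis using that by blast
qed

text \<open>\<open>Gamma\<close> and \<open>Lcl\<close> are chosen independently of each other, so
  each is given a partner of its own to complete the triangle.\<close>

lemma Gamma_rickard:
  assumes "thick K S" "S \<subseteq> compacts \<kappa> K" "X \<in> Ob K"
  obtains L where "rickard_triangle \<kappa> K S X (Gamma \<kappa> K S X) L"
proof -
  obtain G L where "rickard_triangle \<kappa> K S X G L" using rickard_ex[OF assms] .
  then have "\<exists>G L. rickard_triangle \<kappa> K S X G L" by blast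
  from someI_ex[OF this] show ?thesis using that unfolding Gamma_def by blast
qed

lemma Lcl_rickard:
  assumes "thick K S" "S \<subseteq> compacts \<kappa> K" "X \<in> Ob K"
  obtains G where "rickard_triangle \<kappa> K S X G (Lcl \<kappa> K S X)"
proof -
  obtain G L where "rickard_triangle \<kappa> K S X G L" using rickard_ex[OF assms] .
  then have "\<exists>L G. rickard_triangle \<kappa> K S X G L" by blast
  from someI_ex[OF this] show ?thesis using that unfolding Lcl_def by blast
qed

lemma rickard_triangleE:
  assumes "rickard_triangle \<kappa> K S X G L" "S \<subseteq> Ob K"
  obtains f g h where "Tri K f g h" "f \<in> Hom K G X" "g \<in> Hom K X L" "h \<in> Hom K L (Sh K G)"
    "G \<in> Loc \<kappa> K S" "L \<in> perp_right K S" "G \<in> Ob K" "L \<in> Ob K"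
proof -
  obtain f g h where t: "Tri K f g h" "f \<in> Hom K G X" "g \<in> Hom K X L" "h \<in> Hom K L (Sh K G)"
    "G \<in> Loc \<kappa> K S" "\<forall>B \<in> Loc \<kappa> K S. Hom K B L = {Zer K B L}"
    using assms(1) unfolding rickard_triangle_def by blast
  have "L \<in> perp_right K S" unfolding perp_right_def hom0_def
    using t(6) Loc_subset[of S \<kappa>] hom_ob(2)[OF t(3)] by blast
  then show ?thesis using that t hom_ob(1)[OF t(2)] hom_ob(2)[OF t(3)] by blast
qed

end

section \<open>Duality and tensor ideals\<close>

context monoidal_triangulated_category begin

lemma cat_ten [cat]:
  "X \<in> Ob K \<Longrightarrow> Y \<in> Ob K \<Longrightarrow> X \<boxtimes> Y \<in> Ob K" "Unt K \<in> Ob K"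
  "f \<in> Mor K \<Longrightarrow> g \<in> Mor K \<Longrightarrow> f \<star> g \<in> Mor K"
  "f \<in> Mor K \<Longrightarrow> g \<in> Mor K \<Longrightarrow> Dom K (f \<star> g) = Dom K f \<boxtimes> Dom K g"
  "f \<in> Mor K \<Longrightarrow> g \<in> Mor K \<Longrightarrow> Cod K (f \<star> g) = Cod K f \<boxtimes> Cod K g"
  "X \<in> Ob K \<Longrightarrow> Y \<in> Ob K \<Longrightarrow> Idm K X \<star> Idm K Y = Idm K (X \<boxtimes> Y)"
  using ten_ob unt_ob ten_idm ten_hom[OF mor_hom mor_hom] by (auto simp: Hom_def)

lemma ten_cmp_split:
  assumes "f \<in> Mor K" "g \<in> Mor K" "f' \<in> Mor K" "g' \<in> Mor K" "Cod K f = Dom K g" "Cod K f' = Dom K g'"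
  shows "(g \<cdot> f) \<star> (g' \<cdot> f') = (g \<star> g') \<cdot> (f \<star> f')"
  using ten_cmp[of f "Dom K f" "Dom K g" g "Cod K g" f' "Dom K f'" "Dom K g'" g' "Cod K g'"] assms
  by (simp add: Hom_def)

lemma ten_additive_right: "X \<in> Ob K \<Longrightarrow> is_additive_endofunctor K (\<lambda>Y. X \<boxtimes> Y) (\<lambda>f. Idm K X \<star> f)"
  using ten_exact_right unfolding is_exact_endofunctor_def by blast

lemma ten_additive_left: "Y \<in> Ob K \<Longrightarrow> is_additive_endofunctor K (\<lambda>X. X \<boxtimes> Y) (\<lambda>f. f \<star> Idm K Y)"
  using ten_exact_left unfolding is_exact_endofunctor_def by blast

lemma ten_zero:
  assumes "is_zero K X" "Y \<in> Ob K" shows "is_zero K (X \<boxtimes> Y)" "is_zero K (Y \<boxtimes> X)"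
  using add_endo_zero[OF ten_additive_left[OF assms(2)] assms(1)]
    add_endo_zero[OF ten_additive_right[OF assms(2)] assms(1)] by simp_all

lemma ten_isomorphic_left: "isomorphic K X X' \<Longrightarrow> Y \<in> Ob K \<Longrightarrow> isomorphic K (X \<boxtimes> Y) (X' \<boxtimes> Y)"
  using add_endo_isomorphic[OF ten_additive_left] by blast

lemma ten_isomorphic_right: "isomorphic K X X' \<Longrightarrow> Y \<in> Ob K \<Longrightarrow> isomorphic K (Y \<boxtimes> X) (Y \<boxtimes> X')"
  using add_endo_isomorphic[OF ten_additive_right] by blast

lemma ten_assoc_isomorphic:
  "X \<in> Ob K \<Longrightarrow> Y \<in> Ob K \<Longrightarrow> Z \<in> Ob K \<Longrightarrow> isomorphic K (X \<boxtimes> Y \<boxtimes> Z) (X \<boxtimes> (Y \<boxtimes> Z))"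
  unfolding isomorphic_def using asc_hom by blast

lemma unt_isomorphic: "X \<in> Ob K \<Longrightarrow> isomorphic K (Unt K \<boxtimes> X) X"
  unfolding isomorphic_def using lun_hom by blast

lemma is_zero_isomorphic: "isomorphic K X Y \<Longrightarrow> is_zero K X \<longleftrightarrow> is_zero K Y"
  using retract_zero isomorphic_retract isomorphic_sym by blast

lemma left_dualE:
  assumes "is_left_dual K D X"
  obtains ev coev where "ev \<in> Hom K (D \<boxtimes> X) (Unt K)" "coev \<in> Hom K (Unt K) (X \<boxtimes> D)"
    "RUn K X \<cdot> (Idm K X \<star> ev) \<cdot> Asc K X D X \<cdot> (coev \<star> Idm K X) = LUn K X"
    "LUn K D \<cdot> (ev \<star> Idm K D) \<cdot> Inv K (Asc K D X D) \<cdot> (Idm K D \<star> coev) = RUn K D"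
  using assms unfolding is_left_dual_def by blast

text \<open>Each zigzag identity, composed with the inverse of a unitor, is a retraction. The first
  makes thick ideals semiprime; the second puts the dual of an object into every thick ideal that
  contains the object.\<close>

lemma left_dual_retract:
  assumes dual: "is_left_dual K D X" and ob: "D \<in> Ob K" "X \<in> Ob K"
  shows "retract K X (X \<boxtimes> D \<boxtimes> X)" "retract K D (D \<boxtimes> X \<boxtimes> D)"
proof -
  obtain ev coev where ev: "ev \<in> Hom K (D \<boxtimes> X) (Unt K)" and coev: "coev \<in> Hom K (Unt K) (X \<boxtimes> D)"
    and z1: "RUn K X \<cdot> (Idm K X \<star> ev) \<cdot> Asc K X D X \<cdot> (coev \<star> Idm K X) = LUn K X"
    and z2: "LUn K D \<cdot> (ev \<star> Idm K D) \<cdot> Inv K (Asc K D X D) \<cdot> (Idm K D \<star> coev) = RUn K D"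
    using left_dualE[OF dual] .
  have l: "LUn K X \<in> Hom K (Unt K \<boxtimes> X) X" "is_iso K (LUn K X)" using lun_hom ob by auto
  have r: "RUn K X \<in> Hom K (X \<boxtimes> Unt K) X" using run_hom ob by auto
  have a: "Asc K X D X \<in> Hom K (X \<boxtimes> D \<boxtimes> X) (X \<boxtimes> (D \<boxtimes> X))" using asc_hom ob by auto
  note li = Inv_props[OF l]
  have "(RUn K X \<cdot> (Idm K X \<star> ev) \<cdot> Asc K X D X) \<cdot> ((coev \<star> Idm K X) \<cdot> Inv K (LUn K X))
    = (RUn K X \<cdot> (Idm K X \<star> ev) \<cdot> Asc K X D X \<cdot> (coev \<star> Idm K X)) \<cdot> Inv K (LUn K X)"
    using ev coev r a li(1) ob by (simp add: cat)
  also have "\<dots> = Idm K X" using z1 li(3) by simp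
  finally have 1: "(RUn K X \<cdot> (Idm K X \<star> ev) \<cdot> Asc K X D X) \<cdot> ((coev \<star> Idm K X) \<cdot> Inv K (LUn K X)) = Idm K X" .
  have "RUn K X \<cdot> (Idm K X \<star> ev) \<cdot> Asc K X D X \<in> Hom K (X \<boxtimes> D \<boxtimes> X) X"
    "(coev \<star> Idm K X) \<cdot> Inv K (LUn K X) \<in> Hom K X (X \<boxtimes> D \<boxtimes> X)"
    using ev coev r a li(1) ob by (simp_all add: cat)
  with 1 show "retract K X (X \<boxtimes> D \<boxtimes> X)" unfolding retract_def by blast
  have l': "LUn K D \<in> Hom K (Unt K \<boxtimes> D) D" using lun_hom ob by auto
  have r': "RUn K D \<in> Hom K (D \<boxtimes> Unt K) D" "is_iso K (RUn K D)" using run_hom ob by auto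
  have "Asc K D X D \<in> Hom K (D \<boxtimes> X \<boxtimes> D) (D \<boxtimes> (X \<boxtimes> D))" "is_iso K (Asc K D X D)" using asc_hom ob by auto
  note ai = Inv_props[OF this] and ri = Inv_props[OF r']
  have "(LUn K D \<cdot> (ev \<star> Idm K D)) \<cdot> (Inv K (Asc K D X D) \<cdot> (Idm K D \<star> coev) \<cdot> Inv K (RUn K D))
    = (LUn K D \<cdot> (ev \<star> Idm K D) \<cdot> Inv K (Asc K D X D) \<cdot> (Idm K D \<star> coev)) \<cdot> Inv K (RUn K D)"
    using ev coev l' ai(1) ri(1) ob by (simp add: cat)
  also have "\<dots> = Idm K D" using z2 ri(3) by simp
  finally have 2: "(LUn K D \<cdot> (ev \<star> Idm K D)) \<cdot> (Inv K (Asc K D X D) \<cdot> (Idm K D \<star> coev) \<cdot> Inv K (RUn K D)) = Idm K D" .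
  have "LUn K D \<cdot> (ev \<star> Idm K D) \<in> Hom K (D \<boxtimes> X \<boxtimes> D) D"
    "Inv K (Asc K D X D) \<cdot> (Idm K D \<star> coev) \<cdot> Inv K (RUn K D) \<in> Hom K D (D \<boxtimes> X \<boxtimes> D)"
    using ev coev l' ai(1) ri(1) ob by (simp_all add: cat)
  with 2 show "retract K D (D \<boxtimes> X \<boxtimes> D)" unfolding retract_def by blast
qed

text \<open>Half of the adjunction between tensoring with \<open>X\<close> and with \<open>D\<close> on the right: its
  triangle identity is only needed up to an isomorphism, which avoids the coherence
  theorem for the unitors.\<close>

lemma left_dual_hom0:
  assumes dual: "is_left_dual K D X" and ob: "D \<in> Ob K" "X \<in> Ob K" "A \<in> Ob K" "B \<in> Ob K"
    and hom: "hom0 K (A \<boxtimes> X) B"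
  shows "hom0 K A (B \<boxtimes> D)"
proof -
  obtain ev coev where ev: "ev \<in> Hom K (D \<boxtimes> X) (Unt K)" and coev: "coev \<in> Hom K (Unt K) (X \<boxtimes> D)"
    and z2: "LUn K D \<cdot> (ev \<star> Idm K D) \<cdot> Inv K (Asc K D X D) \<cdot> (Idm K D \<star> coev) = RUn K D"
    using left_dualE[OF dual] .
  note U = unt_ob and T = ten_ob
  define a1 where "a1 = Asc K B D X"
  define a2 where "a2 = Asc K (B \<boxtimes> D) X D"
  define a3 where "a3 = Asc K B D (X \<boxtimes> D)"
  define a4 where "a4 = Asc K B (D \<boxtimes> X) D"
  define a5 where "a5 = Asc K D X D"
  define a6 where "a6 = Asc K B (Unt K) D"
  define a7 where "a7 = Asc K B D (Unt K)"
  define a8 where "a8 = Asc K A X D"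
  define b2 where "b2 = Inv K a2"
  define b5 where "b5 = Inv K a5"
  define b8 where "b8 = Inv K a8"
  have a: "a1 \<in> Hom K (B \<boxtimes> D \<boxtimes> X) (B \<boxtimes> (D \<boxtimes> X))" "a2 \<in> Hom K (B \<boxtimes> D \<boxtimes> X \<boxtimes> D) (B \<boxtimes> D \<boxtimes> (X \<boxtimes> D))"
    "a3 \<in> Hom K (B \<boxtimes> D \<boxtimes> (X \<boxtimes> D)) (B \<boxtimes> (D \<boxtimes> (X \<boxtimes> D)))"
    "a4 \<in> Hom K (B \<boxtimes> (D \<boxtimes> X) \<boxtimes> D) (B \<boxtimes> (D \<boxtimes> X \<boxtimes> D))"
    "a5 \<in> Hom K (D \<boxtimes> X \<boxtimes> D) (D \<boxtimes> (X \<boxtimes> D))" "a6 \<in> Hom K (B \<boxtimes> Unt K \<boxtimes> D) (B \<boxtimes> (Unt K \<boxtimes> D))"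
    "a7 \<in> Hom K (B \<boxtimes> D \<boxtimes> Unt K) (B \<boxtimes> (D \<boxtimes> Unt K))" "a8 \<in> Hom K (A \<boxtimes> X \<boxtimes> D) (A \<boxtimes> (X \<boxtimes> D))"
    unfolding a1_def a2_def a3_def a4_def a5_def a6_def a7_def a8_def
    using asc_hom ob U T by auto
  have iso: "is_iso K a2" "is_iso K a5" "is_iso K a7" "is_iso K a8"
    unfolding a2_def a5_def a7_def a8_def using asc_hom ob U T by auto
  note b2 = Inv_props[OF a(2) iso(1), folded b2_def] and b5 = Inv_props[OF a(5) iso(2), folded b5_def]
    and b8 = Inv_props[OF a(8) iso(4), folded b8_def]
  have R: "RUn K B \<in> Hom K (B \<boxtimes> Unt K) B" "RUn K D \<in> Hom K (D \<boxtimes> Unt K) D" "LUn K D \<in> Hom K (Unt K \<boxtimes> D) D"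
    "RUn K A \<in> Hom K (A \<boxtimes> Unt K) A" "is_iso K (RUn K A)" "is_iso K (RUn K D)"
    using run_hom lun_hom ob by auto
  \<comment> \<open>The counit of the adjunction at \<open>B\<close>.\<close>
  define \<epsilon> where "\<epsilon> = RUn K B \<cdot> (Idm K B \<star> ev) \<cdot> a1"
  have \<epsilon>: "\<epsilon> \<in> Hom K (B \<boxtimes> D \<boxtimes> X) B" unfolding \<epsilon>_def using R(1) ev a(1) ob by (simp add: cat)
  have ID: "Idm K D \<cdot> Idm K D = Idm K D" "Idm K B \<cdot> Idm K B = Idm K B"
    using ob idm_left idm_hom by auto
  have \<epsilon>D: "\<epsilon> \<star> Idm K D = (RUn K B \<star> Idm K D) \<cdot> ((Idm K B \<star> ev \<star> Idm K D) \<cdot> (a1 \<star> Idm K D))"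
    unfolding \<epsilon>_def
    using ten_cmp_split[of "(Idm K B \<star> ev) \<cdot> a1" "RUn K B" "Idm K D" "Idm K D"]
      ten_cmp_split[of a1 "Idm K B \<star> ev" "Idm K D" "Idm K D"] R(1) ev a(1) ob ID by (simp add: cat)
  have E1: "RUn K B \<star> Idm K D = (Idm K B \<star> LUn K D) \<cdot> a6"
    unfolding a6_def using unit_triangle[OF ob(4,1)] by simp
  have E2: "a6 \<cdot> (Idm K B \<star> ev \<star> Idm K D) = (Idm K B \<star> (ev \<star> Idm K D)) \<cdot> a4"
    unfolding a6_def a4_def using asc_nat[OF idm_hom[OF ob(4)] ev idm_hom[OF ob(1)]] .
  have pent: "a3 \<cdot> a2 = (Idm K B \<star> a5) \<cdot> a4 \<cdot> (a1 \<star> Idm K D)"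
    unfolding a1_def a2_def a3_def a4_def a5_def using pentagon[OF ob(4,1,2,1)] .
  have Bb5: "(Idm K B \<star> b5) \<cdot> (Idm K B \<star> a5) = Idm K (B \<boxtimes> (D \<boxtimes> X \<boxtimes> D))"
    using ten_cmp_split[of "Idm K B" "Idm K B" a5 b5] a(5) b5 ob ID by (simp add: cat)
  \<comment> \<open>The pentagon, solved for two of its factors by inverting
    \<open>a5\<close>.\<close>
  have E3: "a4 \<cdot> (a1 \<star> Idm K D) = (Idm K B \<star> b5) \<cdot> (a3 \<cdot> a2)"
  proof -
    have h: "Idm K B \<star> a5 \<in> Hom K (B \<boxtimes> (D \<boxtimes> X \<boxtimes> D)) (B \<boxtimes> (D \<boxtimes> (X \<boxtimes> D)))"
      "Idm K B \<star> b5 \<in> Hom K (B \<boxtimes> (D \<boxtimes> (X \<boxtimes> D))) (B \<boxtimes> (D \<boxtimes> X \<boxtimes> D))"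
      using a(5) b5(1) ob by (simp_all add: cat)
    show ?thesis unfolding pent using cmp_reassoc[OF Bb5 h] a(1,4) ob by (simp add: cat)
  qed
  have E5: "a3 \<cdot> (Idm K (B \<boxtimes> D) \<star> coev) = (Idm K B \<star> (Idm K D \<star> coev)) \<cdot> a7"
    unfolding a3_def a7_def using asc_nat[OF idm_hom[OF ob(4)] idm_hom[OF ob(1)] coev] ten_idm[OF ob(4,1)] by simp
  have E6: "(Idm K B \<star> LUn K D) \<cdot> ((Idm K B \<star> (ev \<star> Idm K D)) \<cdot> ((Idm K B \<star> b5) \<cdot> (Idm K B \<star> (Idm K D \<star> coev))))
    = Idm K B \<star> RUn K D"
    using z2 R(3) ev coev b5(1) ob ID
      ten_cmp_split[of "Idm K B" "Idm K B" "Idm K D \<star> coev" b5]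
      ten_cmp_split[of "Idm K B" "Idm K B" "b5 \<cdot> (Idm K D \<star> coev)" "ev \<star> Idm K D"]
      ten_cmp_split[of "Idm K B" "Idm K B" "(ev \<star> Idm K D) \<cdot> b5 \<cdot> (Idm K D \<star> coev)" "LUn K D"]
    unfolding a5_def[symmetric] b5_def[symmetric] by (simp add: cat)
  have h: "RUn K B \<star> Idm K D \<in> Hom K (B \<boxtimes> Unt K \<boxtimes> D) (B \<boxtimes> D)"
    "Idm K B \<star> ev \<star> Idm K D \<in> Hom K (B \<boxtimes> (D \<boxtimes> X) \<boxtimes> D) (B \<boxtimes> Unt K \<boxtimes> D)"
    "a1 \<star> Idm K D \<in> Hom K (B \<boxtimes> D \<boxtimes> X \<boxtimes> D) (B \<boxtimes> (D \<boxtimes> X) \<boxtimes> D)"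
    "Idm K B \<star> LUn K D \<in> Hom K (B \<boxtimes> (Unt K \<boxtimes> D)) (B \<boxtimes> D)"
    "Idm K B \<star> (ev \<star> Idm K D) \<in> Hom K (B \<boxtimes> (D \<boxtimes> X \<boxtimes> D)) (B \<boxtimes> (Unt K \<boxtimes> D))"
    "Idm K B \<star> b5 \<in> Hom K (B \<boxtimes> (D \<boxtimes> (X \<boxtimes> D))) (B \<boxtimes> (D \<boxtimes> X \<boxtimes> D))"
    "Idm K B \<star> (Idm K D \<star> coev) \<in> Hom K (B \<boxtimes> (D \<boxtimes> Unt K)) (B \<boxtimes> (D \<boxtimes> (X \<boxtimes> D)))"
    "Idm K (B \<boxtimes> D) \<star> coev \<in> Hom K (B \<boxtimes> D \<boxtimes> Unt K) (B \<boxtimes> D \<boxtimes> (X \<boxtimes> D))"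
    using R a ev coev b5(1) ob by (simp_all add: cat)
  let ?c = "Idm K (B \<boxtimes> D) \<star> coev"
  \<comment> \<open>The triangle identity at \<open>B \<boxtimes> D\<close>. By coherence the
    resulting map \<open>(Idm K B \<star> RUn K D) \<cdot> a7\<close> is a unitor; what matters
    below is that both of its factors are invertible.\<close>
  have "(\<epsilon> \<star> Idm K D) \<cdot> (b2 \<cdot> ?c)
    = (RUn K B \<star> Idm K D) \<cdot> ((Idm K B \<star> ev \<star> Idm K D) \<cdot> ((a1 \<star> Idm K D) \<cdot> (b2 \<cdot> ?c)))"
    unfolding \<epsilon>D using cmp_assoc[OF cmp_hom[OF h(8) b2(1)] cmp_hom[OF h(3,2)] h(1)]
      cmp_assoc[OF cmp_hom[OF h(8) b2(1)] h(3,2)] by simp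
  also have "\<dots> = (Idm K B \<star> LUn K D) \<cdot> (a6 \<cdot> ((Idm K B \<star> ev \<star> Idm K D) \<cdot> ((a1 \<star> Idm K D) \<cdot> (b2 \<cdot> ?c))))"
    unfolding E1 by (rule cmp_assoc[OF cmp_hom[OF cmp_hom[OF cmp_hom[OF h(8) b2(1)] h(3)] h(2)] a(6) h(4)])
  also have "a6 \<cdot> ((Idm K B \<star> ev \<star> Idm K D) \<cdot> ((a1 \<star> Idm K D) \<cdot> (b2 \<cdot> ?c)))
    = (Idm K B \<star> (ev \<star> Idm K D)) \<cdot> (a4 \<cdot> ((a1 \<star> Idm K D) \<cdot> (b2 \<cdot> ?c)))"
    using cmp_assoc[OF cmp_hom[OF cmp_hom[OF h(8) b2(1)] h(3)] h(2) a(6)]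
      cmp_assoc[OF cmp_hom[OF cmp_hom[OF h(8) b2(1)] h(3)] a(4) h(5)] E2 by simp
  also have "a4 \<cdot> ((a1 \<star> Idm K D) \<cdot> (b2 \<cdot> ?c)) = (Idm K B \<star> b5) \<cdot> ((a3 \<cdot> a2) \<cdot> (b2 \<cdot> ?c))"
    using cmp_assoc[OF cmp_hom[OF h(8) b2(1)] h(3) a(4)]
      cmp_assoc[OF cmp_hom[OF h(8) b2(1)] cmp_hom[OF a(2,3)] h(6)] E3 by simp
  also have "(a3 \<cdot> a2) \<cdot> (b2 \<cdot> ?c) = a3 \<cdot> ?c"
    using cmp_assoc[OF cmp_hom[OF h(8) b2(1)] a(2,3)] cmp_assoc[OF h(8) b2(1) a(2)] b2(3) idm_left[OF h(8)] by simp
  also have "\<dots> = (Idm K B \<star> (Idm K D \<star> coev)) \<cdot> a7" by (rule E5)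
  also have "(Idm K B \<star> LUn K D) \<cdot> ((Idm K B \<star> (ev \<star> Idm K D)) \<cdot> ((Idm K B \<star> b5) \<cdot>
      ((Idm K B \<star> (Idm K D \<star> coev)) \<cdot> a7))) = (Idm K B \<star> RUn K D) \<cdot> a7"
    unfolding E6[symmetric] using h a(7)
    by (simp add: cmp_assoc[OF a(7) cmp_hom[OF cmp_hom[OF h(7,6)] h(5)] h(4)]
        cmp_assoc[OF a(7) cmp_hom[OF h(7,6)] h(5)] cmp_assoc[OF a(7) h(7,6)])
  finally have key: "(\<epsilon> \<star> Idm K D) \<cdot> (b2 \<cdot> ?c) = (Idm K B \<star> RUn K D) \<cdot> a7" .
  define r where "r = Inv K (RUn K D)"
  note r = Inv_props[OF R(2,6), folded r_def]
  define b7 where "b7 = Inv K a7"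
  note b7 = Inv_props[OF a(7) iso(3), folded b7_def]
  have Br: "Idm K B \<star> r \<in> Hom K (B \<boxtimes> D) (B \<boxtimes> (D \<boxtimes> Unt K))"
    "Idm K B \<star> RUn K D \<in> Hom K (B \<boxtimes> (D \<boxtimes> Unt K)) (B \<boxtimes> D)"
    using r(1) R(2) ob by (simp_all add: cat)
  have Brr: "(Idm K B \<star> r) \<cdot> (Idm K B \<star> RUn K D) = Idm K (B \<boxtimes> (D \<boxtimes> Unt K))"
    using ten_cmp_split[of "Idm K B" "Idm K B" "RUn K D" r] r R(2) ob ID by (simp add: cat)
  have "f = Zer K A (B \<boxtimes> D)" if f: "f \<in> Hom K A (B \<boxtimes> D)" for f
  proof -
    have fX: "f \<star> Idm K X \<in> Hom K (A \<boxtimes> X) (B \<boxtimes> D \<boxtimes> X)" using f ob by (simp add: cat)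
    have fXD: "f \<star> Idm K X \<star> Idm K D \<in> Hom K (A \<boxtimes> X \<boxtimes> D) (B \<boxtimes> D \<boxtimes> X \<boxtimes> D)" using f ob by (simp add: cat)
    have f1: "f \<star> Idm K (Unt K) \<in> Hom K (A \<boxtimes> Unt K) (B \<boxtimes> D \<boxtimes> Unt K)" using f U by (simp add: cat)
    have fXD': "f \<star> Idm K (X \<boxtimes> D) \<in> Hom K (A \<boxtimes> (X \<boxtimes> D)) (B \<boxtimes> D \<boxtimes> (X \<boxtimes> D))" using f ob by (simp add: cat)
    have Ac: "Idm K A \<star> coev \<in> Hom K (A \<boxtimes> Unt K) (A \<boxtimes> (X \<boxtimes> D))" using coev ob by (simp add: cat)
    have \<epsilon>D': "\<epsilon> \<star> Idm K D \<in> Hom K (B \<boxtimes> D \<boxtimes> X \<boxtimes> D) (B \<boxtimes> D)" using \<epsilon> ob by (simp add: cat)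
    \<comment> \<open>The transpose of \<open>f\<close> vanishes by hypothesis; naturality and
      \<open>key\<close> turn this into the vanishing of \<open>f\<close> tensored with the
      unit.\<close>
    have "\<epsilon> \<cdot> (f \<star> Idm K X) = Zer K (A \<boxtimes> X) B" using hom0D[OF hom] cmp_hom[OF fX \<epsilon>] by blast
    then have "(\<epsilon> \<star> Idm K D) \<cdot> (f \<star> Idm K X \<star> Idm K D) = Zer K (A \<boxtimes> X) B \<star> Idm K D"
      using ten_cmp_split[of "f \<star> Idm K X" \<epsilon> "Idm K D" "Idm K D"] fX \<epsilon> ob ID by (simp add: cat)
    also have "\<dots> = Zer K (A \<boxtimes> X \<boxtimes> D) (B \<boxtimes> D)"
      using add_endo_zer[OF ten_additive_left[OF ob(1)]] ob T by blast
    finally have 0: "(\<epsilon> \<star> Idm K D) \<cdot> (f \<star> Idm K X \<star> Idm K D) = Zer K (A \<boxtimes> X \<boxtimes> D) (B \<boxtimes> D)" .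
    have nat: "a2 \<cdot> (f \<star> Idm K X \<star> Idm K D) = (f \<star> Idm K (X \<boxtimes> D)) \<cdot> a8"
      unfolding a2_def a8_def using asc_nat[OF f idm_hom[OF ob(2)] idm_hom[OF ob(1)]] ten_idm[OF ob(2,1)] by simp
    have 1: "(f \<star> Idm K X \<star> Idm K D) \<cdot> b8 = b2 \<cdot> (f \<star> Idm K (X \<boxtimes> D))"
    proof -
      have "(f \<star> Idm K X \<star> Idm K D) \<cdot> b8 = b2 \<cdot> ((a2 \<cdot> (f \<star> Idm K X \<star> Idm K D)) \<cdot> b8)"
        using cmp_assoc[OF b8(1) fXD a(2)] cmp_assoc[OF cmp_hom[OF b8(1) fXD] a(2) b2(1)] b2(2)
          idm_left[OF cmp_hom[OF b8(1) fXD]] by simp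
      then show ?thesis unfolding nat using cmp_assoc[OF b8(1) a(8) fXD'] b8(3) idm_right[OF fXD'] by simp
    qed
    have 2: "(f \<star> Idm K (X \<boxtimes> D)) \<cdot> (Idm K A \<star> coev) = ?c \<cdot> (f \<star> Idm K (Unt K))"
      using ten_cmp[OF idm_hom[OF ob(3)] f coev idm_hom[OF T[OF ob(2,1)]]]
        ten_cmp[OF f idm_hom[OF T[OF ob(4,1)]] idm_hom[OF U] coev]
        idm_left[OF f] idm_right[OF f] idm_left[OF coev] idm_right[OF coev] by simp
    have "((Idm K B \<star> RUn K D) \<cdot> a7) \<cdot> (f \<star> Idm K (Unt K)) = (\<epsilon> \<star> Idm K D) \<cdot> (b2 \<cdot> (?c \<cdot> (f \<star> Idm K (Unt K))))"
      unfolding key[symmetric]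
      using cmp_assoc[OF f1 cmp_hom[OF h(8) b2(1)] \<epsilon>D'] cmp_assoc[OF f1 h(8) b2(1)] by simp
    also have "\<dots> = (\<epsilon> \<star> Idm K D) \<cdot> ((f \<star> Idm K X \<star> Idm K D) \<cdot> (b8 \<cdot> (Idm K A \<star> coev)))"
      unfolding 2[symmetric] using cmp_assoc[OF Ac fXD' b2(1)] cmp_assoc[OF Ac b8(1) fXD] 1 by simp
    also have "\<dots> = Zer K (A \<boxtimes> Unt K) (B \<boxtimes> D)"
      using cmp_assoc[OF cmp_hom[OF Ac b8(1)] fXD \<epsilon>D'] 0 cmp_zer_left[OF cmp_hom[OF Ac b8(1)] T[OF ob(4,1)]] by simp
    finally have "((Idm K B \<star> RUn K D) \<cdot> a7) \<cdot> (f \<star> Idm K (Unt K)) = Zer K (A \<boxtimes> Unt K) (B \<boxtimes> D)" .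
    then have "(Idm K B \<star> RUn K D) \<cdot> (a7 \<cdot> (f \<star> Idm K (Unt K))) = Zer K (A \<boxtimes> Unt K) (B \<boxtimes> D)"
      using cmp_assoc[OF f1 a(7) Br(2)] by simp
    then have "(Idm K B \<star> r) \<cdot> ((Idm K B \<star> RUn K D) \<cdot> (a7 \<cdot> (f \<star> Idm K (Unt K))))
        = Zer K (A \<boxtimes> Unt K) (B \<boxtimes> (D \<boxtimes> Unt K))"
      using cmp_zer_right[OF Br(1) T[OF ob(3) U]] by simp
    then have "a7 \<cdot> (f \<star> Idm K (Unt K)) = Zer K (A \<boxtimes> Unt K) (B \<boxtimes> (D \<boxtimes> Unt K))"
      using cmp_assoc[OF cmp_hom[OF f1 a(7)] Br(2,1)] Brr idm_left[OF cmp_hom[OF f1 a(7)]] by simp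
    then have "b7 \<cdot> (a7 \<cdot> (f \<star> Idm K (Unt K))) = Zer K (A \<boxtimes> Unt K) (B \<boxtimes> D \<boxtimes> Unt K)"
      using cmp_zer_right[OF b7(1) T[OF ob(3) U]] by simp
    then have "f \<star> Idm K (Unt K) = Zer K (A \<boxtimes> Unt K) (B \<boxtimes> D \<boxtimes> Unt K)"
      using cmp_assoc[OF f1 a(7) b7(1)] b7(2) idm_left[OF f1] by simp
    then have "f \<cdot> RUn K A = Zer K (A \<boxtimes> Unt K) (B \<boxtimes> D)"
      using run_nat[OF f] cmp_zer_right[OF _ T[OF ob(3) U]] run_hom[OF T[OF ob(4,1)]] by metis
    then have "(f \<cdot> RUn K A) \<cdot> Inv K (RUn K A) = Zer K A (B \<boxtimes> D)"
      using cmp_zer_left[OF Inv_props(1)[OF R(4,5)] T[OF ob(4,1)]] by simp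
    then show ?thesis
      using cmp_assoc[OF Inv_props(1)[OF R(4,5)] R(4) f] Inv_props(3)[OF R(4,5)] idm_right[OF f] by simp
  qed
  then show ?thesis unfolding hom0_def by blast
qed

text \<open>By the first zigzag identity and naturality, every \<open>f\<close> from
  \<open>X\<close> to \<open>Y\<close> factors, up to a unitor, through
  \<open>f \<star> Idm K D \<star> Idm K X\<close>, and \<open>f \<star> Idm K D\<close> is zero
  because its target is.\<close>

lemma left_dual_detect:
  assumes dual: "is_left_dual K D X" and ob: "D \<in> Ob K" "X \<in> Ob K" "Y \<in> Ob K"
    and zero: "is_zero K (Y \<boxtimes> D)"
  shows "hom0 K X Y"
proof -
  obtain ev coev where ev: "ev \<in> Hom K (D \<boxtimes> X) (Unt K)" and coev: "coev \<in> Hom K (Unt K) (X \<boxtimes> D)"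
    and z1: "RUn K X \<cdot> (Idm K X \<star> ev) \<cdot> Asc K X D X \<cdot> (coev \<star> Idm K X) = LUn K X"
    using left_dualE[OF dual] .
  note U = unt_ob and T = ten_ob
  have R: "RUn K X \<in> Hom K (X \<boxtimes> Unt K) X" "RUn K Y \<in> Hom K (Y \<boxtimes> Unt K) Y"
    "LUn K X \<in> Hom K (Unt K \<boxtimes> X) X" "is_iso K (LUn K X)" using run_hom lun_hom ob by auto
  have a: "Asc K X D X \<in> Hom K (X \<boxtimes> D \<boxtimes> X) (X \<boxtimes> (D \<boxtimes> X))" "Asc K Y D X \<in> Hom K (Y \<boxtimes> D \<boxtimes> X) (Y \<boxtimes> (D \<boxtimes> X))"
    using asc_hom ob by auto
  have "f = Zer K X Y" if f: "f \<in> Hom K X Y" for f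
  proof -
    have h: "Idm K X \<star> ev \<in> Hom K (X \<boxtimes> (D \<boxtimes> X)) (X \<boxtimes> Unt K)" "coev \<star> Idm K X \<in> Hom K (Unt K \<boxtimes> X) (X \<boxtimes> D \<boxtimes> X)"
      "f \<star> Idm K (Unt K) \<in> Hom K (X \<boxtimes> Unt K) (Y \<boxtimes> Unt K)" "Idm K Y \<star> ev \<in> Hom K (Y \<boxtimes> (D \<boxtimes> X)) (Y \<boxtimes> Unt K)"
      "f \<star> Idm K (D \<boxtimes> X) \<in> Hom K (X \<boxtimes> (D \<boxtimes> X)) (Y \<boxtimes> (D \<boxtimes> X))"
      "f \<star> Idm K D \<star> Idm K X \<in> Hom K (X \<boxtimes> D \<boxtimes> X) (Y \<boxtimes> D \<boxtimes> X)"
      "f \<star> Idm K D \<in> Hom K (X \<boxtimes> D) (Y \<boxtimes> D)"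
      using f ev coev ob U by (simp_all add: cat)
    note h' = cmp_hom[OF cmp_hom[OF h(2) a(1)] h(1)]
    have "f \<star> Idm K D = Zer K (X \<boxtimes> D) (Y \<boxtimes> D)" using is_zero_into[OF zero h(7)] .
    then have 0: "f \<star> Idm K D \<star> Idm K X = Zer K (X \<boxtimes> D \<boxtimes> X) (Y \<boxtimes> D \<boxtimes> X)"
      using add_endo_zer[OF ten_additive_left[OF ob(2)] T[OF ob(2,1)] T[OF ob(3,1)]] by simp
    have 1: "(f \<star> Idm K (Unt K)) \<cdot> (Idm K X \<star> ev) = (Idm K Y \<star> ev) \<cdot> (f \<star> Idm K (D \<boxtimes> X))"
      using ten_cmp[OF idm_hom[OF ob(2)] f ev idm_hom[OF U]]
        ten_cmp[OF f idm_hom[OF ob(3)] idm_hom[OF T[OF ob(1,2)]] ev]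
        idm_left[OF f] idm_right[OF f] idm_left[OF ev] idm_right[OF ev] by simp
    have 2: "(f \<star> Idm K (D \<boxtimes> X)) \<cdot> Asc K X D X = Asc K Y D X \<cdot> (f \<star> Idm K D \<star> Idm K X)"
      using asc_nat[OF f idm_hom[OF ob(1)] idm_hom[OF ob(2)]] ten_idm[OF ob(1,2)] by simp
    have "f \<cdot> LUn K X = (f \<cdot> RUn K X) \<cdot> ((Idm K X \<star> ev) \<cdot> Asc K X D X \<cdot> (coev \<star> Idm K X))"
      unfolding z1[symmetric] using cmp_assoc[OF h' R(1) f] by simp
    also have "\<dots> = RUn K Y \<cdot> ((f \<star> Idm K (Unt K)) \<cdot> ((Idm K X \<star> ev) \<cdot> (Asc K X D X \<cdot> (coev \<star> Idm K X))))"
      unfolding run_nat[OF f, symmetric] using cmp_assoc[OF h' h(3) R(2)] .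
    also have "(f \<star> Idm K (Unt K)) \<cdot> ((Idm K X \<star> ev) \<cdot> (Asc K X D X \<cdot> (coev \<star> Idm K X)))
      = (Idm K Y \<star> ev) \<cdot> ((f \<star> Idm K (D \<boxtimes> X)) \<cdot> (Asc K X D X \<cdot> (coev \<star> Idm K X)))"
      using cmp_assoc[OF cmp_hom[OF h(2) a(1)] h(1,3)] cmp_assoc[OF cmp_hom[OF h(2) a(1)] h(5,4)] 1 by simp
    also have "(f \<star> Idm K (D \<boxtimes> X)) \<cdot> (Asc K X D X \<cdot> (coev \<star> Idm K X))
      = Asc K Y D X \<cdot> ((f \<star> Idm K D \<star> Idm K X) \<cdot> (coev \<star> Idm K X))"
      using cmp_assoc[OF h(2) a(1) h(5)] cmp_assoc[OF h(2) h(6) a(2)] 2 by simp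
    also have "(f \<star> Idm K D \<star> Idm K X) \<cdot> (coev \<star> Idm K X) = Zer K (Unt K \<boxtimes> X) (Y \<boxtimes> D \<boxtimes> X)"
      unfolding 0 using cmp_zer_left[OF h(2)] T ob by blast
    also have "RUn K Y \<cdot> ((Idm K Y \<star> ev) \<cdot> (Asc K Y D X \<cdot> Zer K (Unt K \<boxtimes> X) (Y \<boxtimes> D \<boxtimes> X))) = Zer K (Unt K \<boxtimes> X) Y"
      using R(2) h(4) a(2) ob U by (simp add: cat)
    finally have "(f \<cdot> LUn K X) \<cdot> Inv K (LUn K X) = Zer K X Y"
      using cmp_zer_left[OF Inv_props(1)[OF R(3,4)] ob(3)] by simp
    then show ?thesis
      using cmp_assoc[OF Inv_props(1)[OF R(3,4)] R(3) f] Inv_props(3)[OF R(3,4)] idm_right[OF f] by simp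
  qed
  then show ?thesis unfolding hom0_def by blast
qed

end

section \<open>Tensor ideals, their localizing closures and their orthogonals\<close>

context rigidly_compactly_generated begin

lemma localizing_ten_right:
  "localizing \<kappa> K T \<Longrightarrow> X \<in> Ob K \<Longrightarrow> localizing \<kappa> K {Y \<in> Ob K. X \<boxtimes> Y \<in> T}"
  using localizing_preimage[OF ten_exact_right] ten_coproduct_right by blast

lemma localizing_ten_left:
  "localizing \<kappa> K T \<Longrightarrow> X \<in> Ob K \<Longrightarrow> localizing \<kappa> K {Y \<in> Ob K. Y \<boxtimes> X \<in> T}"
  using localizing_preimage[OF ten_exact_left] ten_coproduct_left by blast

lemma generated_by_compacts: "localizing \<kappa> K T \<Longrightarrow> compacts \<kappa> K \<subseteq> T \<Longrightarrow> X \<in> Ob K \<Longrightarrow> X \<in> T"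
  using Loc_least generated by blast

lemma thick_idealD:
  assumes "thick_ideal \<kappa> K I"
  shows "I \<subseteq> compacts \<kappa> K" "thick K I" "I \<subseteq> Ob K"
    "A \<in> I \<Longrightarrow> C \<in> compacts \<kappa> K \<Longrightarrow> A \<boxtimes> C \<in> I" "A \<in> I \<Longrightarrow> C \<in> compacts \<kappa> K \<Longrightarrow> C \<boxtimes> A \<in> I"
  using assms compact_ob unfolding thick_ideal_def by blast+

text \<open>Generation is used twice: first for an object of \<open>I\<close>, to pass from compact
  \<open>Y\<close> to all \<open>Y\<close>, then with \<open>Y\<close> fixed, to pass from
  \<open>I\<close> to its localizing closure.\<close>

lemma Loc_ten:
  assumes I: "thick_ideal \<kappa> K I" and X: "X \<in> Loc \<kappa> K I" and Y: "Y \<in> Ob K"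
  shows "X \<boxtimes> Y \<in> Loc \<kappa> K I" "Y \<boxtimes> X \<in> Loc \<kappa> K I"
proof -
  have loc: "localizing \<kappa> K (Loc \<kappa> K I)" using localizing_Loc thick_idealD(3)[OF I] .
  have D: "D \<boxtimes> Y \<in> Loc \<kappa> K I \<and> Y \<boxtimes> D \<in> Loc \<kappa> K I" if "D \<in> I" for D
  proof -
    have ob: "D \<in> Ob K" using that thick_idealD(3)[OF I] by blast
    have "Y \<in> {Y \<in> Ob K. D \<boxtimes> Y \<in> Loc \<kappa> K I}"
      by (rule generated_by_compacts[OF localizing_ten_right[OF loc ob] _ Y])
        (use thick_idealD[OF I] Loc_subset[of I \<kappa>] compact_ob that in blast)
    moreover have "Y \<in> {Y \<in> Ob K. Y \<boxtimes> D \<in> Loc \<kappa> K I}"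
      by (rule generated_by_compacts[OF localizing_ten_left[OF loc ob] _ Y])
        (use thick_idealD[OF I] Loc_subset[of I \<kappa>] compact_ob that in blast)
    ultimately show ?thesis by blast
  qed
  have "Loc \<kappa> K I \<subseteq> {X \<in> Ob K. X \<boxtimes> Y \<in> Loc \<kappa> K I}"
    by (rule Loc_least[OF localizing_ten_left[OF loc Y]]) (use D thick_idealD(3)[OF I] in blast)
  then show "X \<boxtimes> Y \<in> Loc \<kappa> K I" using X by blast
  have "Loc \<kappa> K I \<subseteq> {X \<in> Ob K. Y \<boxtimes> X \<in> Loc \<kappa> K I}"
    by (rule Loc_least[OF localizing_ten_right[OF loc Y]]) (use D thick_idealD(3)[OF I] in blast)
  then show "Y \<boxtimes> X \<in> Loc \<kappa> K I" using X by blast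
qed

text \<open>For compact \<open>C\<close>, a map from \<open>s\<close> to
  \<open>L \<boxtimes> C\<close> transposes to a map from \<open>s \<boxtimes> D\<close> to
  \<open>L\<close>, where \<open>C\<close> is a left dual of \<open>D\<close>; the source stays in
  \<open>I\<close>. Arbitrary \<open>Y\<close> follow because the right orthogonal of
  \<open>I\<close> is localizing.\<close>

lemma perp_right_ten:
  assumes I: "thick_ideal \<kappa> K I" and L: "L \<in> perp_right K I" and Y: "Y \<in> Ob K"
  shows "L \<boxtimes> Y \<in> perp_right K I"
proof -
  have Lob: "L \<in> Ob K" using L unfolding perp_right_def by blast
  have "L \<boxtimes> C \<in> perp_right K I" if C: "C \<in> compacts \<kappa> K" for C
  proof -
    obtain D where D: "D \<in> compacts \<kappa> K" "is_left_dual K C D" using right_duals[OF C] by blast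
    have "hom0 K s (L \<boxtimes> C)" if s: "s \<in> I" for s
      using left_dual_hom0[OF D(2) compact_ob[OF C] compact_ob[OF D(1)] _ Lob] s L
        thick_idealD(3,4)[OF I] D(1) unfolding perp_right_def by blast
    then show ?thesis unfolding perp_right_def using ten_ob Lob compact_ob[OF C] by blast
  qed
  then have "Y \<in> {Y \<in> Ob K. L \<boxtimes> Y \<in> perp_right K I}"
    using generated_by_compacts[OF localizing_ten_right[OF localizing_perp_right[OF thick_idealD(2,1)[OF I]] Lob] _ Y]
      compact_ob by blast
  then show ?thesis by blast
qed

text \<open>Third claim: \<open>L \<boxtimes> Y\<close> lies in \<open>Loc \<kappa> K I\<close> and
  is orthogonal to \<open>I\<close>. Fourth claim: if the map from \<open>Y\<close> to
  \<open>L \<boxtimes> Y\<close> is zero, then \<open>Y\<close> splits off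
  \<open>G \<boxtimes> Y\<close>, where \<open>G\<close> completes the triangle of
  \<open>L\<close>.\<close>

lemma Lcl_unit:
  assumes I: "thick_ideal \<kappa> K I"
  defines "L \<equiv> Lcl \<kappa> K I (Unt K)"
  shows "L \<in> Ob K" "L \<in> perp_right K I" "\<And>Y. Y \<in> Loc \<kappa> K I \<Longrightarrow> is_zero K (L \<boxtimes> Y)"
    "\<And>Y. Y \<in> Ob K \<Longrightarrow> hom0 K Y (L \<boxtimes> Y) \<Longrightarrow> Y \<in> Loc \<kappa> K I"
proof -
  have loc: "localizing \<kappa> K (Loc \<kappa> K I)" using localizing_Loc thick_idealD(3)[OF I] .
  obtain G where "rickard_triangle \<kappa> K I (Unt K) G L"
    unfolding L_def using Lcl_rickard[OF thick_idealD(2,1)[OF I] unt_ob] .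
  then obtain f g h where t: "Tri K f g h" "f \<in> Hom K G (Unt K)" "g \<in> Hom K (Unt K) L" "h \<in> Hom K L (Sh K G)"
    "G \<in> Loc \<kappa> K I" "L \<in> perp_right K I" "G \<in> Ob K" "L \<in> Ob K"
    using rickard_triangleE[OF _ thick_idealD(3)[OF I]] by metis
  show "L \<in> Ob K" "L \<in> perp_right K I" using t by auto
  show "is_zero K (L \<boxtimes> Y)" if Y: "Y \<in> Loc \<kappa> K I" for Y
  proof -
    have "Y \<in> Ob K" using thick_ob[OF localizing_thick[OF loc] Y] .
    then show ?thesis
      using Loc_perp_zero[OF thick_idealD(2,1)[OF I] Loc_ten(2)[OF I Y t(8)] perp_right_ten[OF I t(6)]] by blast
  qed
  show "Y \<in> Loc \<kappa> K I" if Y: "Y \<in> Ob K" and h0: "hom0 K Y (L \<boxtimes> Y)" for Y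
  proof -
    have ex: "is_exact_endofunctor K (\<lambda>X. X \<boxtimes> Y) (\<lambda>f. f \<star> Idm K Y)" using ten_exact_left[OF Y] .
    then obtain \<theta> where "Tri K (f \<star> Idm K Y) (g \<star> Idm K Y) (\<theta> (Dom K f) \<cdot> (h \<star> Idm K Y))"
      using t(1) unfolding is_exact_endofunctor_def by blast
    note tY = this ten_hom[OF t(2) idm_hom[OF Y]] ten_hom[OF t(3) idm_hom[OF Y]]
    have "hom0 K (Unt K \<boxtimes> Y) (L \<boxtimes> Y)"
      using hom0_retract_left[OF isomorphic_retract[OF unt_isomorphic[OF Y]] h0] .
    then have "(g \<star> Idm K Y) \<cdot> Idm K (Unt K \<boxtimes> Y) = Zer K (Unt K \<boxtimes> Y) (L \<boxtimes> Y)"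
      using hom0D tY(3) idm_right[OF tY(3)] by metis
    then obtain s where "s \<in> Hom K (Unt K \<boxtimes> Y) (G \<boxtimes> Y)" "(f \<star> Idm K Y) \<cdot> s = Idm K (Unt K \<boxtimes> Y)"
      using tri_lift[OF tY idm_hom[OF ten_ob[OF unt_ob Y]]] by blast
    then have "retract K (Unt K \<boxtimes> Y) (G \<boxtimes> Y)" unfolding retract_def using tY(2) by blast
    then have "Unt K \<boxtimes> Y \<in> Loc \<kappa> K I"
      using thick_retract[OF localizing_thick[OF loc] Loc_ten(1)[OF I t(5) Y]] by blast
    then show ?thesis using thick_iso[OF localizing_thick[OF loc] unt_isomorphic[OF Y]] by blast
  qed
qed

text \<open>Third claim: the triangle tensored with \<open>Y\<close> presents \<open>Y\<close> as an
  extension of \<open>L \<boxtimes> Y\<close>, orthogonal by \<open>perp_right_ten\<close>, by the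
  zero object \<open>G \<boxtimes> Y\<close>.\<close>

lemma Gamma_unit:
  assumes I: "thick_ideal \<kappa> K I"
  defines "G \<equiv> Gamma \<kappa> K I (Unt K)"
  shows "G \<in> Ob K" "G \<in> Loc \<kappa> K I" "\<And>Y. Y \<in> Ob K \<Longrightarrow> is_zero K (G \<boxtimes> Y) \<Longrightarrow> Y \<in> perp_right K I"
proof -
  obtain L where "rickard_triangle \<kappa> K I (Unt K) G L"
    unfolding G_def using Gamma_rickard[OF thick_idealD(2,1)[OF I] unt_ob] .
  then obtain f g h where t: "Tri K f g h" "f \<in> Hom K G (Unt K)" "g \<in> Hom K (Unt K) L" "h \<in> Hom K L (Sh K G)"
    "G \<in> Loc \<kappa> K I" "L \<in> perp_right K I" "G \<in> Ob K" "L \<in> Ob K"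
    using rickard_triangleE[OF _ thick_idealD(3)[OF I]] by metis
  show "G \<in> Ob K" "G \<in> Loc \<kappa> K I" using t by auto
  show "Y \<in> perp_right K I" if Y: "Y \<in> Ob K" and z: "is_zero K (G \<boxtimes> Y)" for Y
  proof -
    have ex: "is_exact_endofunctor K (\<lambda>X. X \<boxtimes> Y) (\<lambda>f. f \<star> Idm K Y)" using ten_exact_left[OF Y] .
    then obtain \<theta> where "Tri K (f \<star> Idm K Y) (g \<star> Idm K Y) (\<theta> (Dom K f) \<cdot> (h \<star> Idm K Y))"
      using t(1) unfolding is_exact_endofunctor_def by blast
    note tY = this ten_hom[OF t(2) idm_hom[OF Y]] ten_hom[OF t(3) idm_hom[OF Y]]
    have th: "thick K (perp_right K I)" using thick_perp_right thick_shift_closed thick_idealD(2)[OF I] by blast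
    have "Unt K \<boxtimes> Y \<in> perp_right K I"
      using thick_ext[OF th tY thick_zero[OF th z] perp_right_ten[OF I t(6) Y]] .
    then show ?thesis using thick_iso[OF th unt_isomorphic[OF Y]] by blast
  qed
qed

end

section \<open>Prime ideals\<close>

context rigidly_compactly_generated begin

lemma thick_ten_right: "thick K T \<Longrightarrow> X \<in> Ob K \<Longrightarrow> thick K {Y \<in> Ob K. X \<boxtimes> Y \<in> T}"
  using thick_preimage[OF ten_exact_right] .

lemma thick_ten_left: "thick K T \<Longrightarrow> X \<in> Ob K \<Longrightarrow> thick K {Y \<in> Ob K. Y \<boxtimes> X \<in> T}"
  using thick_preimage[OF ten_exact_left] .

lemma thick_ideal_compacts: "thick_ideal \<kappa> K (compacts \<kappa> K)"
  unfolding thick_ideal_def using thick_compacts ten_compact by blast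

lemma thick_ideal_Inter:
  assumes "\<And>I. I \<in> M \<Longrightarrow> thick_ideal \<kappa> K I" "M \<noteq> {}" shows "thick_ideal \<kappa> K (\<Inter>M)"
proof -
  have "thick K (\<Inter>M)" using thick_Inter assms unfolding thick_ideal_def by blast
  then show ?thesis using assms unfolding thick_ideal_def by blast
qed

text \<open>The middle factor \<open>C\<close> makes annihilators two-sided ideals in the absence of
  a braiding.\<close>

definition left_ann :: "'o set \<Rightarrow> 'o set \<Rightarrow> 'o set" where
  "left_ann T N = {X \<in> compacts \<kappa> K. \<forall>C \<in> compacts \<kappa> K. \<forall>Y \<in> N. X \<boxtimes> C \<boxtimes> Y \<in> T}"

definition right_ann :: "'o set \<Rightarrow> 'o set \<Rightarrow> 'o set" where
  "right_ann T N = {Y \<in> compacts \<kappa> K. \<forall>X \<in> N. \<forall>C \<in> compacts \<kappa> K. X \<boxtimes> C \<boxtimes> Y \<in> T}"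

text \<open>An intersection of preimages of \<open>T\<close> under tensor functors, hence thick. A
  factor to the right of \<open>X\<close> is absorbed into \<open>C\<close>; a factor to the left is
  absorbed by \<open>T\<close>.\<close>

lemma thick_ideal_left_ann:
  assumes T: "thick_ideal \<kappa> K T" and N: "N \<subseteq> Ob K" shows "thick_ideal \<kappa> K (left_ann T N)"
proof -
  \<comment> \<open>The compact objects join the family so that the intersection consists of compact
    objects.\<close>
  define M where "M = insert (compacts \<kappa> K)
    ((\<lambda>(C, Y). {X \<in> Ob K. X \<boxtimes> C \<in> {W \<in> Ob K. W \<boxtimes> Y \<in> T}}) ` (compacts \<kappa> K \<times> N))"
  have "thick K (\<Inter>M)"
  proof (rule thick_Inter)
    fix U assume "U \<in> M"
    then consider "U = compacts \<kappa> K" | C Y where "C \<in> compacts \<kappa> K" "Y \<in> N"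
      "U = {X \<in> Ob K. X \<boxtimes> C \<in> {W \<in> Ob K. W \<boxtimes> Y \<in> T}}" unfolding M_def by auto
    then show "thick K U"
    proof cases
      case 1 then show ?thesis using thick_compacts by simp
    next
      case 2 then show ?thesis
        using thick_ten_left[OF thick_ten_left[OF thick_idealD(2)[OF T]]] N compact_ob by blast
    qed
  qed (auto simp: M_def)
  moreover have "left_ann T N = \<Inter>M"
    unfolding M_def left_ann_def using compact_ob ten_ob by auto
  ultimately have th: "thick K (left_ann T N)" by simp
  have "X \<boxtimes> D \<in> left_ann T N \<and> D \<boxtimes> X \<in> left_ann T N"
    if X: "X \<in> left_ann T N" and D: "D \<in> compacts \<kappa> K" for X D
  proof -
    have Xc: "X \<in> compacts \<kappa> K" using X unfolding left_ann_def by blast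
    have "X \<boxtimes> D \<boxtimes> C \<boxtimes> Y \<in> T \<and> D \<boxtimes> X \<boxtimes> C \<boxtimes> Y \<in> T" if C: "C \<in> compacts \<kappa> K" and Y: "Y \<in> N" for C Y
    proof -
      note ob = compact_ob[OF Xc] compact_ob[OF D] compact_ob[OF C]
      have Yo: "Y \<in> Ob K" using Y N by blast
      have "isomorphic K (X \<boxtimes> D \<boxtimes> C \<boxtimes> Y) (X \<boxtimes> (D \<boxtimes> C) \<boxtimes> Y)"
        using ten_isomorphic_left[OF ten_assoc_isomorphic[OF ob] Yo] .
      moreover have "X \<boxtimes> (D \<boxtimes> C) \<boxtimes> Y \<in> T" using X ten_compact[OF D C] Y unfolding left_ann_def by blast
      ultimately have 1: "X \<boxtimes> D \<boxtimes> C \<boxtimes> Y \<in> T" using thick_iso[OF thick_idealD(2)[OF T]] by blast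
      have "isomorphic K (D \<boxtimes> X \<boxtimes> C \<boxtimes> Y) (D \<boxtimes> (X \<boxtimes> C \<boxtimes> Y))"
        using isomorphic_trans[OF ten_isomorphic_left[OF ten_assoc_isomorphic[OF ob(2,1,3)] Yo]
          ten_assoc_isomorphic[OF ob(2) ten_ob[OF ob(1,3)] Yo]] .
      moreover have "D \<boxtimes> (X \<boxtimes> C \<boxtimes> Y) \<in> T"
        using X C Y D thick_idealD(5)[OF T] unfolding left_ann_def by blast
      ultimately show ?thesis using 1 thick_iso[OF thick_idealD(2)[OF T]] by blast
    qed
    then show ?thesis using ten_compact[OF Xc D] ten_compact[OF D Xc] unfolding left_ann_def by blast
  qed
  then show ?thesis unfolding thick_ideal_def using th unfolding left_ann_def by blast
qed

text \<open>The mirror image of \<open>thick_ideal_left_ann\<close>. The hypotheses on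
  \<open>T\<close> are met by thick ideals and also by the class of all zero objects, the case that
  concerns supports.\<close>

lemma thick_ideal_right_ann:
  assumes T: "thick K T" "\<And>W D. W \<in> T \<Longrightarrow> D \<in> compacts \<kappa> K \<Longrightarrow> W \<boxtimes> D \<in> T" and N: "N \<subseteq> Ob K"
  shows "thick_ideal \<kappa> K (right_ann T N)"
proof -
  define M where "M = insert (compacts \<kappa> K)
    ((\<lambda>(X, C). {Y \<in> Ob K. X \<boxtimes> C \<boxtimes> Y \<in> T}) ` (N \<times> compacts \<kappa> K))"
  have "thick K (\<Inter>M)"
  proof (rule thick_Inter)
    fix U assume "U \<in> M"
    then consider "U = compacts \<kappa> K" | C X where "C \<in> compacts \<kappa> K" "X \<in> N"
      "U = {Y \<in> Ob K. X \<boxtimes> C \<boxtimes> Y \<in> T}" unfolding M_def by auto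
    then show "thick K U"
    proof cases
      case 1 then show ?thesis using thick_compacts by simp
    next
      case 2 then show ?thesis using thick_ten_right[OF T(1) ten_ob] N compact_ob by blast
    qed
  qed (auto simp: M_def)
  moreover have "right_ann T N = \<Inter>M"
    unfolding M_def right_ann_def using compact_ob by auto
  ultimately have th: "thick K (right_ann T N)" by simp
  have "Y \<boxtimes> D \<in> right_ann T N \<and> D \<boxtimes> Y \<in> right_ann T N"
    if Y: "Y \<in> right_ann T N" and D: "D \<in> compacts \<kappa> K" for Y D
  proof -
    have Yc: "Y \<in> compacts \<kappa> K" using Y unfolding right_ann_def by blast
    have "X \<boxtimes> C \<boxtimes> (Y \<boxtimes> D) \<in> T \<and> X \<boxtimes> C \<boxtimes> (D \<boxtimes> Y) \<in> T" if C: "C \<in> compacts \<kappa> K" and X: "X \<in> N" for C X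
    proof -
      note ob = compact_ob[OF Yc] compact_ob[OF D] compact_ob[OF C]
      have Xo: "X \<in> Ob K" using X N by blast
      have XC: "X \<boxtimes> C \<in> Ob K" using ten_ob Xo ob by blast
      have "X \<boxtimes> C \<boxtimes> Y \<boxtimes> D \<in> T" using Y X C D T(2) unfolding right_ann_def by blast
      then have 1: "X \<boxtimes> C \<boxtimes> (Y \<boxtimes> D) \<in> T"
        using thick_iso[OF T(1) ten_assoc_isomorphic[OF XC ob(1,2)]] by blast
      have "isomorphic K (X \<boxtimes> (C \<boxtimes> D) \<boxtimes> Y) (X \<boxtimes> C \<boxtimes> (D \<boxtimes> Y))"
        using isomorphic_trans[OF isomorphic_sym[OF ten_isomorphic_left[OF ten_assoc_isomorphic[OF Xo ob(3,2)] ob(1)]]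
          ten_assoc_isomorphic[OF XC ob(2,1)]] .
      moreover have "X \<boxtimes> (C \<boxtimes> D) \<boxtimes> Y \<in> T" using Y X ten_compact[OF C D] unfolding right_ann_def by blast
      ultimately show ?thesis using 1 thick_iso[OF T(1)] by blast
    qed
    then show ?thesis using ten_compact[OF Yc D] ten_compact[OF D Yc] unfolding right_ann_def by blast
  qed
  then show ?thesis unfolding thick_ideal_def using th unfolding right_ann_def by blast
qed

lemma ten_unt_mem:
  assumes "thick K T" "X \<in> Ob K" "Y \<in> Ob K" shows "X \<boxtimes> Unt K \<boxtimes> Y \<in> T \<longleftrightarrow> X \<boxtimes> Y \<in> T"
proof -
  have "isomorphic K (X \<boxtimes> Unt K) X" unfolding isomorphic_def using run_hom[OF assms(2)] by blast
  then show ?thesis using thick_iso[OF assms(1) ten_isomorphic_left[OF _ assms(3)]] by blast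
qed

lemma prime_idealD:
  assumes "P \<in> Spc \<kappa> K"
  shows "thick_ideal \<kappa> K P" "P \<noteq> compacts \<kappa> K"
    "thick_ideal \<kappa> K I \<Longrightarrow> thick_ideal \<kappa> K J \<Longrightarrow> \<forall>A \<in> I. \<forall>B \<in> J. A \<boxtimes> B \<in> P \<Longrightarrow> I \<subseteq> P \<or> J \<subseteq> P"
  using assms unfolding Spc_def prime_ideal_def by blast+

text \<open>Primeness for ideals turned into primeness for objects. If all
  \<open>A \<boxtimes> C \<boxtimes> B\<close> lay in \<open>P\<close>, then \<open>A\<close> would
  lie in \<open>I\<close> and \<open>B\<close> in \<open>J\<close>, two ideals whose products lie in
  \<open>P\<close> by the choice of \<open>Unt K\<close> as the middle factor.\<close>

lemma prime_ten:
  assumes P: "P \<in> Spc \<kappa> K" and A: "A \<in> compacts \<kappa> K" "A \<notin> P" and B: "B \<in> compacts \<kappa> K" "B \<notin> P"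
  obtains C where "C \<in> compacts \<kappa> K" "A \<boxtimes> C \<boxtimes> B \<notin> P"
proof (rule ccontr)
  assume "\<not> thesis"
  then have all: "\<forall>C \<in> compacts \<kappa> K. A \<boxtimes> C \<boxtimes> B \<in> P" using that by blast
  note PI = prime_idealD(1)[OF P]
  define I where "I = left_ann P {B}"
  define J where "J = right_ann P I"
  have I: "thick_ideal \<kappa> K I" unfolding I_def using thick_ideal_left_ann[OF PI] compact_ob B by blast
  have J: "thick_ideal \<kappa> K J" unfolding J_def
    using thick_ideal_right_ann[OF thick_idealD(2,4)[OF PI] thick_idealD(3)[OF I]] .
  have "A \<in> I" unfolding I_def left_ann_def using A all by blast
  moreover have "B \<in> J" unfolding J_def right_ann_def using B unfolding I_def left_ann_def by blast
  moreover have "X \<boxtimes> Y \<in> P" if "X \<in> I" "Y \<in> J" for X Y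
    using that unit_compact ten_unt_mem[OF thick_idealD(2)[OF PI], of X Y] thick_idealD(3)[OF I] thick_idealD(3)[OF J]
    unfolding J_def right_ann_def by blast
  ultimately show False using prime_idealD(3)[OF P I J] A B by blast
qed

text \<open>Only extensions involve two members of the family at once; comparability puts both ends
  into one of them.\<close>

lemma thick_ideal_chain_Union:
  assumes "\<And>I. I \<in> M \<Longrightarrow> thick_ideal \<kappa> K I" "M \<noteq> {}" "\<And>I J. I \<in> M \<Longrightarrow> J \<in> M \<Longrightarrow> I \<subseteq> J \<or> J \<subseteq> I"
  shows "thick_ideal \<kappa> K (\<Union>M)"
proof -
  have th: "thick K I" if "I \<in> M" for I using assms(1)[OF that] unfolding thick_ideal_def by blast
  have "thick K (\<Union>M)"
  proof (rule thickI)
    show "\<Union>M \<subseteq> Ob K" using th thick_ob by blast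
    show "\<Union>M \<noteq> {}" using assms(2) th thick_zero zero_object by blast
    show "X \<in> \<Union>M" if "retract K X S" "S \<in> \<Union>M" for X S using that th thick_retract by blast
    show "Sh K X \<in> \<Union>M \<longleftrightarrow> X \<in> \<Union>M" if "X \<in> Ob K" for X using thick_sh[OF th that] by blast
    fix f g h X Y Z
    assume t: "Tri K f g h" "f \<in> Hom K X Y" "g \<in> Hom K Y Z" and X: "X \<in> \<Union>M" and Z: "Z \<in> \<Union>M"
    obtain I J where IJ: "I \<in> M" "X \<in> I" "J \<in> M" "Z \<in> J" using X Z by blast
    then show "Y \<in> \<Union>M" using assms(3)[of I J] thick_ext[OF th t] by blast
  qed
  then show ?thesis using assms(1) unfolding thick_ideal_def by blast
qed

text \<open>By rigidity, \<open>D\<close> is a retract of \<open>D \<boxtimes> D\<^sup>* \<boxtimes> D\<close>, so the sequence iterating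
  this operation is an m-system; a thick ideal maximal among those avoiding it is prime.\<close>

lemma thick_ideal_semiprime:
  assumes I: "thick_ideal \<kappa> K I" and D: "D \<in> compacts \<kappa> K" "D \<notin> I"
  obtains Q where "Q \<in> Spc \<kappa> K" "I \<subseteq> Q" "D \<notin> Q"
proof -
  obtain du where du: "\<forall>X \<in> compacts \<kappa> K. du X \<in> compacts \<kappa> K \<and> is_left_dual K (du X) X"
    using left_duals by metis
  define E where "E = rec_nat D (\<lambda>_ X. X \<boxtimes> du X \<boxtimes> X)"
  have E: "E 0 = D" "\<And>n. E (Suc n) = E n \<boxtimes> du (E n) \<boxtimes> E n" unfolding E_def by simp_all
  have Ec: "E n \<in> compacts \<kappa> K" for n
    by (induction n) (use D du ten_compact E in auto)
  have Er: "retract K (E n) (E (Suc n))" for n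
    unfolding E(2) using left_dual_retract(1) du Ec compact_ob by blast
  have down: "E n \<in> J \<Longrightarrow> D \<in> J" if J: "thick_ideal \<kappa> K J" for n J
    by (induction n) (use thick_retract[OF thick_idealD(2)[OF J] _ Er] E(1) in auto)
  have up: "E n \<in> J \<Longrightarrow> E (n + k) \<in> J" if J: "thick_ideal \<kappa> K J" for n k J
  proof (induction k)
    case (Suc k)
    then show ?case using E(2)[of "n + k"] thick_idealD(4)[OF J] Ec du by simp
  qed simp
  \<comment> \<open>Avoiding \<open>D\<close> is the same as avoiding the whole sequence
    \<open>E\<close>, since each \<open>E n\<close> has \<open>D\<close> as a retract.\<close>
  define M where "M = {J. thick_ideal \<kappa> K J \<and> I \<subseteq> J \<and> D \<notin> J}"
  have "\<exists>Q \<in> M. \<forall>J \<in> M. Q \<subseteq> J \<longrightarrow> J = Q"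
  proof (rule subset_Zorn_nonempty)
    show "M \<noteq> {}" unfolding M_def using I D by blast
    fix C assume C: "C \<noteq> {}" "subset.chain M C"
    then have CM: "C \<subseteq> M" "\<And>I J. I \<in> C \<Longrightarrow> J \<in> C \<Longrightarrow> I \<subseteq> J \<or> J \<subseteq> I"
      unfolding subset.chain_def by blast+
    then have "thick_ideal \<kappa> K (\<Union>C)" using thick_ideal_chain_Union[of C] C(1) unfolding M_def by blast
    then show "\<Union>C \<in> M" using CM(1) C(1) unfolding M_def by blast
  qed
  then obtain Q where QM: "Q \<in> M" and Qmax: "\<forall>J \<in> M. Q \<subseteq> J \<longrightarrow> J = Q" by blast
  have Q: "thick_ideal \<kappa> K Q" "I \<subseteq> Q" "D \<notin> Q" using QM unfolding M_def by auto
  have max: "J = Q" if "thick_ideal \<kappa> K J" "Q \<subseteq> J" "D \<notin> J" for J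
  proof -
    have "J \<in> M" unfolding M_def using that Q(2) by simp
    then show ?thesis using Qmax that(2) by simp
  qed
  have "J1 \<subseteq> Q \<or> J2 \<subseteq> Q"
    if J: "thick_ideal \<kappa> K J1" "thick_ideal \<kappa> K J2" and JJ: "\<forall>A \<in> J1. \<forall>B \<in> J2. A \<boxtimes> B \<in> Q" for J1 J2
  proof (rule ccontr)
    assume n: "\<not> (J1 \<subseteq> Q \<or> J2 \<subseteq> Q)"
    \<comment> \<open>\<open>K1\<close> contains \<open>Q\<close> and \<open>J1\<close>, so by
      maximality it contains \<open>D\<close>; likewise \<open>K2\<close>, with \<open>J2\<close>
      for \<open>J1\<close>. Then \<open>D \<boxtimes> du D \<boxtimes> D\<close> lies in
      \<open>Q\<close>, and with it the retract \<open>D\<close>.\<close>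
    define K1 where "K1 = left_ann Q J2"
    define K2 where "K2 = right_ann Q K1"
    have K1: "thick_ideal \<kappa> K K1" unfolding K1_def using thick_ideal_left_ann[OF Q(1) thick_idealD(3)[OF J(2)]] .
    have K2: "thick_ideal \<kappa> K K2" unfolding K2_def
      using thick_ideal_right_ann[OF thick_idealD(2,4)[OF Q(1)] thick_idealD(3)[OF K1]] .
    have "J1 \<subseteq> K1" unfolding K1_def left_ann_def using thick_idealD(1,4)[OF J(1)] JJ by blast
    moreover have "Q \<subseteq> K1" unfolding K1_def left_ann_def
      using thick_idealD(1,4)[OF Q(1)] thick_idealD(1)[OF J(2)] by blast
    ultimately have D1: "D \<in> K1" using max[OF K1] n by blast
    have "J2 \<subseteq> K2" unfolding K2_def right_ann_def using thick_idealD(1)[OF J(2)] unfolding K1_def left_ann_def by blast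
    moreover have "Q \<subseteq> K2" unfolding K2_def right_ann_def
      using thick_idealD(1,5)[OF Q(1)] thick_idealD(1)[OF K1] ten_compact by blast
    ultimately have D2: "D \<in> K2" using max[OF K2] n by blast
    have "D \<boxtimes> du D \<boxtimes> D \<in> Q" using D1 D2 du D(1) unfolding K2_def right_ann_def by blast
    then have "E (Suc 0) \<in> Q" using E by simp
    then show False using down[OF Q(1)] Q(3) by blast
  qed
  then have "Q \<in> Spc \<kappa> K" unfolding Spc_def prime_ideal_def using Q D(1) by blast
  then show ?thesis using that Q by blast
qed

end

section \<open>Supports\<close>

context rigidly_compactly_generated begin

text \<open>The complement of the closed set attached to \<open>S\<close>; for \<open>S\<close> a
  set of compact objects these are exactly the open sets.\<close>

definition spc_open :: "'o set \<Rightarrow> 'o set set" where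
  "spc_open S = {P \<in> Spc \<kappa> K. P \<inter> S \<noteq> {}}"

text \<open>A prime contains a biproduct exactly when it contains both summands, so \<open>R\<close>
  collects the compact biproducts of an object of \<open>S\<close> with one of
  \<open>T\<close>.\<close>

lemma spc_open_Int:
  assumes S: "S \<subseteq> compacts \<kappa> K" and T: "T \<subseteq> compacts \<kappa> K"
  obtains R where "R \<subseteq> compacts \<kappa> K" "spc_open S \<inter> spc_open T = spc_open R"
proof -
  define R where "R = {W \<in> compacts \<kappa> K. \<exists>A \<in> S. \<exists>B \<in> T. is_biproduct K A B W}"
  have iff: "P \<inter> R \<noteq> {} \<longleftrightarrow> P \<inter> S \<noteq> {} \<and> P \<inter> T \<noteq> {}" if "P \<in> Spc \<kappa> K" for P
  proof
    note th = thick_idealD(2)[OF prime_idealD(1)[OF that]]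
    show "P \<inter> S \<noteq> {} \<and> P \<inter> T \<noteq> {}" if "P \<inter> R \<noteq> {}"
      using that thick_biproduct[OF th] unfolding R_def by blast
    assume "P \<inter> S \<noteq> {} \<and> P \<inter> T \<noteq> {}"
    then obtain A B where AB: "A \<in> P" "A \<in> S" "B \<in> P" "B \<in> T" by blast
    then have ob: "A \<in> Ob K" "B \<in> Ob K" using thick_ob[OF th] by auto
    obtain W where W: "is_biproduct K A B W" using biproducts[OF ob] by blast
    have "W \<in> P" using thick_biproduct[OF th W] AB by blast
    moreover have "W \<in> compacts \<kappa> K" using thick_biproduct[OF thick_compacts W] AB S T by blast
    ultimately show "P \<inter> R \<noteq> {}" unfolding R_def using W AB by blast
  qed
  have "spc_open S \<inter> spc_open T = spc_open R"
    unfolding spc_open_def by (rule Set.set_eqI) (use iff in simp, blast)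
  moreover have "R \<subseteq> compacts \<kappa> K" unfolding R_def by blast
  ultimately show ?thesis using that by blast
qed

lemma spc_open_Union:
  "(\<Union>S \<in> \<S>. spc_open S) = spc_open (\<Union>\<S>)"
  unfolding spc_open_def by blast

text \<open>\<open>topology\<close> is sure to have the intended open sets only when the given
  family satisfies the axioms of a topology; they are verified here.\<close>

lemma openin_Spc: "openin (Spc_topology \<kappa> K) U \<longleftrightarrow> U \<in> spc_open ` Pow (compacts \<kappa> K)"
proof -
  define L where "L = (\<lambda>U. U \<in> spc_open ` Pow (compacts \<kappa> K))"
  have "L (U \<inter> V)" if "L U" "L V" for U V
  proof -
    obtain S T where S: "S \<subseteq> compacts \<kappa> K" "U = spc_open S" and T: "T \<subseteq> compacts \<kappa> K" "V = spc_open T"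
      using \<open>L U\<close> \<open>L V\<close> unfolding L_def by auto
    obtain R where "R \<subseteq> compacts \<kappa> K" "spc_open S \<inter> spc_open T = spc_open R"
      using spc_open_Int[OF S(1) T(1)] .
    then show ?thesis unfolding L_def S(2) T(2) by (intro image_eqI[of _ _ R]) auto
  qed
  moreover have "L (\<Union>\<U>)" if "\<forall>U \<in> \<U>. L U" for \<U>
  proof -
    have "\<U> \<subseteq> spc_open ` Pow (compacts \<kappa> K)" using that unfolding L_def by blast
    then obtain \<S> where \<S>: "\<S> \<subseteq> Pow (compacts \<kappa> K)" "\<U> = spc_open ` \<S>" unfolding subset_image_iff by blast
    have "\<Union>\<U> = spc_open (\<Union>\<S>)" unfolding \<S>(2) by (rule spc_open_Union)
    then show ?thesis unfolding L_def using \<S>(1) by (intro image_eqI[of _ _ "\<Union>\<S>"]) auto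
  qed
  ultimately have "istopology L" unfolding istopology_def by blast
  then have *: "openin (topology L) = L" by (rule topology_inverse')
  have "Spc \<kappa> K - {P \<in> Spc \<kappa> K. P \<inter> S = {}} = spc_open S" for S unfolding spc_open_def by auto
  then have "Spc_topology \<kappa> K = topology L"
    unfolding Spc_topology_def L_def by (intro arg_cong[of _ _ topology]) (auto simp: image_iff)
  then show ?thesis using * unfolding L_def by simp
qed

lemma openin_spc_open: "S \<subseteq> compacts \<kappa> K \<Longrightarrow> openin (Spc_topology \<kappa> K) (spc_open S)"
  unfolding openin_Spc by blast

lemma topspace_Spc: "topspace (Spc_topology \<kappa> K) = Spc \<kappa> K"
proof
  have "spc_open (compacts \<kappa> K) = Spc \<kappa> K"
    unfolding spc_open_def using prime_idealD(1) thick_idealD(1,2) thick_zero zero_object by blast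
  then show "Spc \<kappa> K \<subseteq> topspace (Spc_topology \<kappa> K)"
    using openin_subset[OF openin_spc_open[of "compacts \<kappa> K"]] by simp
  have "topspace (Spc_topology \<kappa> K) \<in> spc_open ` Pow (compacts \<kappa> K)"
    using openin_topspace[of "Spc_topology \<kappa> K"] unfolding openin_Spc .
  then show "topspace (Spc_topology \<kappa> K) \<subseteq> Spc \<kappa> K" unfolding spc_open_def by auto
qed

text \<open>The open sets \<open>spc_open {A}\<close> decide membership in the closure.
  Specialization goes to smaller primes, opposite to the prime spectrum of a ring.\<close>

lemma closure_of_point:
  assumes "P \<in> Spc \<kappa> K"
  shows "Q \<in> Spc_topology \<kappa> K closure_of {P} \<longleftrightarrow> Q \<in> Spc \<kappa> K \<and> Q \<subseteq> P"
proof
  assume h: "Q \<in> Spc_topology \<kappa> K closure_of {P}"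
  then have Q: "Q \<in> Spc \<kappa> K" unfolding in_closure_of topspace_Spc by (rule conjunct1)
  have cl: "P \<in> T" if "Q \<in> T" "openin (Spc_topology \<kappa> K) T" for T
    using h that unfolding in_closure_of by simp
  have "A \<in> P" if A: "A \<in> Q" for A
  proof -
    have "{A} \<subseteq> compacts \<kappa> K" using A thick_idealD(1)[OF prime_idealD(1)[OF Q]] by blast
    then have "P \<in> spc_open {A}"
      by (intro cl openin_spc_open) (use A Q in \<open>simp_all add: spc_open_def\<close>)
    then show ?thesis by (simp add: spc_open_def)
  qed
  with Q show "Q \<in> Spc \<kappa> K \<and> Q \<subseteq> P" by blast
next
  assume h: "Q \<in> Spc \<kappa> K \<and> Q \<subseteq> P"
  have "P \<in> T" if T: "Q \<in> T" "openin (Spc_topology \<kappa> K) T" for T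
  proof -
    obtain S where "T = spc_open S" using T(2) unfolding openin_Spc by blast
    then show ?thesis using T(1) h assms unfolding spc_open_def by auto
  qed
  then show "Q \<in> Spc_topology \<kappa> K closure_of {P}" unfolding in_closure_of topspace_Spc using h by simp
qed

lemma VP_iff: "P \<in> Spc \<kappa> K \<Longrightarrow> Q \<in> VP \<kappa> K P \<longleftrightarrow> Q \<in> Spc \<kappa> K \<and> Q \<subseteq> P"
  unfolding VP_def by (rule closure_of_point)

text \<open>\<open>ZP \<kappa> K P\<close> consists of the primes \<open>Q\<close> for which
  \<open>P\<close> is not a subset of \<open>Q\<close>. An object of \<open>P\<close> is missing
  only from such primes, and a compact object outside \<open>P\<close> has \<open>P\<close> itself
  in its support.\<close>

lemma Theta_ZP:
  assumes P: "P \<in> Spc \<kappa> K" shows "Theta \<kappa> K (ZP \<kappa> K P) = P"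
proof -
  have "Q \<in> ZP \<kappa> K P \<longleftrightarrow> Q \<in> Spc \<kappa> K \<and> \<not> P \<subseteq> Q" for Q
    unfolding ZP_def using closure_of_point P by blast
  then show ?thesis unfolding Theta_def supp_def using P thick_idealD(1)[OF prime_idealD(1)[OF P]] by blast
qed

lemma thick_ideal_Theta: "thick_ideal \<kappa> K (Theta \<kappa> K S)"
proof -
  have "Theta \<kappa> K S = \<Inter>(insert (compacts \<kappa> K) (Spc \<kappa> K - S))"
    unfolding Theta_def supp_def by blast
  moreover have "thick_ideal \<kappa> K (\<Inter>(insert (compacts \<kappa> K) (Spc \<kappa> K - S)))"
    by (rule thick_ideal_Inter) (use thick_ideal_compacts prime_idealD(1) in blast)+
  ultimately show ?thesis by simp
qed

lemma closedin_supp: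
  assumes "A \<in> compacts \<kappa> K" shows "closedin (Spc_topology \<kappa> K) (supp \<kappa> K A)"
proof -
  have "Spc \<kappa> K - supp \<kappa> K A = spc_open {A}" unfolding supp_def spc_open_def by auto
  then have "openin (Spc_topology \<kappa> K) (Spc \<kappa> K - supp \<kappa> K A)" using openin_spc_open[of "{A}"] assms by simp
  moreover have "supp \<kappa> K A \<subseteq> Spc \<kappa> K" unfolding supp_def by blast
  ultimately show ?thesis unfolding closedin_def topspace_Spc by simp
qed

text \<open>In the Noetherian case a compact object outside \<open>P\<close> of minimal support has support
  \<open>VP P\<close>.\<close>

lemma noetherian_point:
  assumes noeth: "noetherian_space (Spc_topology \<kappa> K)" and P: "P \<in> Spc \<kappa> K"
  obtains D where "D \<in> Theta \<kappa> K (VP \<kappa> K P)" "D \<notin> P"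
proof (rule ccontr)
  note found = that
  assume "\<not> thesis"
  then have "D \<in> P" if "D \<in> Theta \<kappa> K (VP \<kappa> K P)" for D using that found by blast
  then have no: "\<not> supp \<kappa> K D \<subseteq> VP \<kappa> K P" if "D \<in> compacts \<kappa> K" "D \<notin> P" for D
    using that unfolding Theta_def by blast
  \<comment> \<open>Otherwise supports shrink forever: a prime \<open>Q\<close> in the support of
    \<open>D\<close> but not below \<open>P\<close> contains some \<open>A\<close> outside
    \<open>P\<close>, and \<open>D \<boxtimes> C \<boxtimes> A\<close> stays outside
    \<open>P\<close> for a suitable \<open>C\<close> while its support loses
    \<open>Q\<close>.\<close>
  have "\<exists>D. \<forall>n. (D n \<in> compacts \<kappa> K \<and> D n \<notin> P) \<and> supp \<kappa> K (D (Suc n)) \<subset> supp \<kappa> K (D n)"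
  proof (rule dependent_nat_choice)
    show "\<exists>D. D \<in> compacts \<kappa> K \<and> D \<notin> P"
      using prime_idealD(2)[OF P] thick_idealD(1)[OF prime_idealD(1)[OF P]] by blast
  next
    fix D and n :: nat assume D: "D \<in> compacts \<kappa> K \<and> D \<notin> P"
    then obtain Q where Q: "Q \<in> Spc \<kappa> K" "D \<notin> Q" "\<not> Q \<subseteq> P"
      using no[of D] VP_iff[OF P] unfolding supp_def by blast
    then obtain A where A: "A \<in> Q" "A \<notin> P" by blast
    have Ac: "A \<in> compacts \<kappa> K" using A thick_idealD(1)[OF prime_idealD(1)[OF Q(1)]] by blast
    obtain C where C: "C \<in> compacts \<kappa> K" "D \<boxtimes> C \<boxtimes> A \<notin> P" using prime_ten[OF P _ _ Ac A(2)] D by blast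
    have "supp \<kappa> K (D \<boxtimes> C \<boxtimes> A) \<subseteq> supp \<kappa> K D"
      unfolding supp_def using thick_idealD(4)[OF prime_idealD(1)] C(1) Ac by blast
    moreover have "Q \<in> supp \<kappa> K D" "Q \<notin> supp \<kappa> K (D \<boxtimes> C \<boxtimes> A)"
      using Q thick_idealD(5)[OF prime_idealD(1)[OF Q(1)] A(1)] ten_compact D C(1) unfolding supp_def by auto
    ultimately have "supp \<kappa> K (D \<boxtimes> C \<boxtimes> A) \<subset> supp \<kappa> K D" by blast
    then show "\<exists>y. (y \<in> compacts \<kappa> K \<and> y \<notin> P) \<and> supp \<kappa> K y \<subset> supp \<kappa> K D"
      using C(2) ten_compact[OF ten_compact[OF conjunct1[OF D] C(1)] Ac]
      by (intro exI[of _ "D \<boxtimes> C \<boxtimes> A"]) simp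
  qed
  then obtain D where D: "\<And>n. D n \<in> compacts \<kappa> K" "\<And>n. supp \<kappa> K (D (Suc n)) \<subset> supp \<kappa> K (D n)" by blast
  have "\<forall>n. closedin (Spc_topology \<kappa> K) (supp \<kappa> K (D n)) \<and> supp \<kappa> K (D (Suc n)) \<subseteq> supp \<kappa> K (D n)"
    using closedin_supp D by blast
  with noeth[unfolded noetherian_space_def, THEN spec, of "\<lambda>n. supp \<kappa> K (D n)"]
  obtain N where N: "\<forall>n \<ge> N. supp \<kappa> K (D n) = supp \<kappa> K (D N)" by (rule mp[THEN exE])
  have "supp \<kappa> K (D (Suc N)) = supp \<kappa> K (D N)" by (rule N[rule_format]) simp
  then show False using D(2)[of N] by blast
qed

section \<open>The extended support of tensor products\<close>

lemma Supp_iff: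
  assumes "P \<in> Spc \<kappa> K"
  shows "P \<in> Supp \<kappa> K X \<longleftrightarrow>
    \<not> is_zero K (Gamma \<kappa> K (Theta \<kappa> K (VP \<kappa> K P)) (Unt K) \<boxtimes> Lcl \<kappa> K P (Unt K) \<boxtimes> X)"
  using assms by (simp add: Supp_def Gamma_pt_def Theta_ZP)

text \<open>\<open>A \<boxtimes> C\<close> lies in the localizing closure of \<open>P\<close>, which
  \<open>L\<close> annihilates.\<close>

lemma not_Supp_ten_prime:
  assumes P: "P \<in> Spc \<kappa> K" and A: "A \<in> Ob K" and C: "C \<in> P"
  shows "P \<notin> Supp \<kappa> K (A \<boxtimes> C)"
proof -
  define G where "G = Gamma \<kappa> K (Theta \<kappa> K (VP \<kappa> K P)) (Unt K)"
  define L where "L = Lcl \<kappa> K P (Unt K)"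
  note PI = prime_idealD(1)[OF P]
  have G: "G \<in> Ob K" unfolding G_def using Gamma_unit(1)[OF thick_ideal_Theta] .
  have L: "L \<in> Ob K" unfolding L_def using Lcl_unit(1)[OF PI] .
  have ob: "A \<boxtimes> C \<in> Ob K" using ten_ob A C thick_idealD(3)[OF PI] by blast
  have "A \<boxtimes> C \<in> Loc \<kappa> K P" using Loc_ten(2)[OF PI _ A] Loc_subset C by blast
  then have "is_zero K (G \<boxtimes> (L \<boxtimes> (A \<boxtimes> C)))" using Lcl_unit(3)[OF PI] ten_zero(2)[OF _ G] unfolding L_def by blast
  then have "is_zero K (G \<boxtimes> L \<boxtimes> (A \<boxtimes> C))"
    using is_zero_isomorphic[OF ten_assoc_isomorphic[OF G L ob]] by blast
  then show ?thesis using Supp_iff[OF P] unfolding G_def L_def by blast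
qed

lemma Supp_compact:
  assumes noeth: "noetherian_space (Spc_topology \<kappa> K)" and P: "P \<in> Spc \<kappa> K"
    and C: "C \<in> compacts \<kappa> K" "C \<notin> P"
  shows "P \<in> Supp \<kappa> K C"
proof (rule ccontr)
  assume "P \<notin> Supp \<kappa> K C"
  define V where "V = Theta \<kappa> K (VP \<kappa> K P)"
  define G where "G = Gamma \<kappa> K V (Unt K)"
  define L where "L = Lcl \<kappa> K P (Unt K)"
  note PI = prime_idealD(1)[OF P]
  have V: "thick_ideal \<kappa> K V" unfolding V_def by (rule thick_ideal_Theta)
  have G: "G \<in> Ob K" unfolding G_def using Gamma_unit(1)[OF V] .
  have L: "L \<in> Ob K" unfolding L_def using Lcl_unit(1)[OF PI] .
  note Co = compact_ob[OF C(1)]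
  have "is_zero K (G \<boxtimes> L \<boxtimes> C)"
    using \<open>P \<notin> Supp \<kappa> K C\<close> Supp_iff[OF P] unfolding G_def L_def V_def by blast
  then have "is_zero K (G \<boxtimes> (L \<boxtimes> C))" using is_zero_isomorphic[OF ten_assoc_isomorphic[OF G L Co]] by blast
  then have LC: "L \<boxtimes> C \<in> perp_right K V" using Gamma_unit(3)[OF V ten_ob[OF L Co]] unfolding G_def by blast
  obtain D where D: "D \<in> V" "D \<notin> P" unfolding V_def using noetherian_point[OF noeth P] .
  have Dc: "D \<in> compacts \<kappa> K" using D thick_idealD(1)[OF V] by blast
  obtain F where F: "F \<in> compacts \<kappa> K" "C \<boxtimes> F \<boxtimes> D \<notin> P" using prime_ten[OF P C Dc D(2)] .
  note ob = Co compact_ob[OF F(1)] compact_ob[OF Dc]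
  have YV: "C \<boxtimes> F \<boxtimes> D \<in> V" using thick_idealD(5)[OF V D(1)] ten_compact[OF C(1) F(1)] by blast
  have FD: "F \<boxtimes> D \<in> Ob K" using ten_ob ob by blast
  \<comment> \<open>\<open>perp_right_ten\<close> adds factors on the right, so
    \<open>F \<boxtimes> D\<close> is attached to the right of \<open>L \<boxtimes> C\<close> and
    then rebracketed.\<close>
  have "isomorphic K (L \<boxtimes> C \<boxtimes> (F \<boxtimes> D)) (L \<boxtimes> (C \<boxtimes> F \<boxtimes> D))"
    using isomorphic_trans[OF ten_assoc_isomorphic[OF L ob(1) FD]
        ten_isomorphic_right[OF isomorphic_sym[OF ten_assoc_isomorphic[OF ob]] L]] .
  moreover have "L \<boxtimes> C \<boxtimes> (F \<boxtimes> D) \<in> perp_right K V" using perp_right_ten[OF V LC FD] .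
  ultimately have "L \<boxtimes> (C \<boxtimes> F \<boxtimes> D) \<in> perp_right K V"
    using thick_iso[OF thick_perp_right[OF thick_shift_closed[OF thick_idealD(2)[OF V]]]] by blast
  then have "hom0 K (C \<boxtimes> F \<boxtimes> D) (L \<boxtimes> (C \<boxtimes> F \<boxtimes> D))" using YV unfolding perp_right_def by blast
  then have "C \<boxtimes> F \<boxtimes> D \<in> Loc \<kappa> K P"
    using Lcl_unit(4)[OF PI] thick_idealD(3)[OF V] YV unfolding L_def by blast
  then have "C \<boxtimes> F \<boxtimes> D \<in> P"
    using compact_in_Loc[OF thick_idealD(2,1)[OF PI]] thick_idealD(1)[OF V] YV by blast
  then show False using F(2) by blast
qed

lemma Supp_ten_compact:
  assumes P: "P \<in> Spc \<kappa> K" and A: "A \<in> Ob K" "P \<in> Supp \<kappa> K A" and C: "C \<in> compacts \<kappa> K" "C \<notin> P"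
  obtains B where "B \<in> compacts \<kappa> K" "P \<in> Supp \<kappa> K (A \<boxtimes> B \<boxtimes> C)"
proof (rule ccontr)
  note found = that
  assume "\<not> thesis"
  then have none: "P \<notin> Supp \<kappa> K (A \<boxtimes> B \<boxtimes> C)" if "B \<in> compacts \<kappa> K" for B using that found by blast
  define V where "V = Theta \<kappa> K (VP \<kappa> K P)"
  define G where "G = Gamma \<kappa> K V (Unt K)"
  define L where "L = Lcl \<kappa> K P (Unt K)"
  note PI = prime_idealD(1)[OF P]
  have V: "thick_ideal \<kappa> K V" unfolding V_def by (rule thick_ideal_Theta)
  have G: "G \<in> Ob K" "G \<in> Loc \<kappa> K V" unfolding G_def using Gamma_unit(1,2)[OF V] .
  have L: "L \<in> Ob K" unfolding L_def using Lcl_unit(1)[OF PI] .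
  have GL: "G \<boxtimes> L \<in> Ob K" using ten_ob G L by blast
  define N where "N = G \<boxtimes> L \<boxtimes> A"
  have N: "N \<in> Ob K" unfolding N_def using ten_ob GL A(1) by blast
  have S: "P \<in> Supp \<kappa> K X \<longleftrightarrow> \<not> is_zero K (G \<boxtimes> L \<boxtimes> X)" for X
    using Supp_iff[OF P] unfolding G_def L_def V_def .
  have iso: "isomorphic K (N \<boxtimes> B \<boxtimes> X) (G \<boxtimes> L \<boxtimes> (A \<boxtimes> B \<boxtimes> X))" if "B \<in> Ob K" "X \<in> Ob K" for B X
    unfolding N_def
    using isomorphic_trans[OF ten_isomorphic_left[OF ten_assoc_isomorphic[OF GL A(1) that(1)] that(2)]
        ten_assoc_isomorphic[OF GL ten_ob[OF A(1) that(1)] that(2)]] .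
  \<comment> \<open>The compact annihilator of the single object \<open>N\<close>, which need not be
    compact.\<close>
  define I where "I = right_ann {Z. is_zero K Z} {N}"
  have I: "thick_ideal \<kappa> K I" unfolding I_def
    by (rule thick_ideal_right_ann[OF thick_is_zero]) (use ten_zero(1) compact_ob N in auto)
  have memI: "X \<in> I" if X: "X \<in> compacts \<kappa> K" and h: "\<And>B. B \<in> compacts \<kappa> K \<Longrightarrow> P \<notin> Supp \<kappa> K (A \<boxtimes> B \<boxtimes> X)" for X
    unfolding I_def right_ann_def
    using X h S is_zero_isomorphic[OF iso[OF compact_ob compact_ob[OF X]]] by blast
  have "C \<in> I" using memI[OF C(1)] none by blast
  have "P \<subseteq> I"
    using memI not_Supp_ten_prime[OF P ten_ob[OF A(1) compact_ob]] thick_idealD(1)[OF PI] by blast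
  have VI: "V \<subseteq> I"
  proof (rule ccontr)
    assume "\<not> V \<subseteq> I"
    then obtain D where D: "D \<in> V" "D \<notin> I" by blast
    \<comment> \<open>The object \<open>D\<close> of \<open>V\<close> is missing from
      \<open>Q\<close>, which puts \<open>Q\<close> below \<open>P\<close>; but \<open>Q\<close>
      contains \<open>C\<close>.\<close>
    obtain Q where Q: "Q \<in> Spc \<kappa> K" "I \<subseteq> Q" "D \<notin> Q"
      using thick_ideal_semiprime[OF I _ D(2)] D(1) thick_idealD(1)[OF V] by blast
    then have "Q \<in> VP \<kappa> K P" using D(1) unfolding V_def Theta_def supp_def by blast
    then have "Q \<subseteq> P" using VP_iff[OF P] by blast
    then show False using \<open>C \<in> I\<close> Q(2) C(2) by blast
  qed
  have "N \<in> Loc \<kappa> K V" unfolding N_def using Loc_ten(1)[OF V Loc_ten(1)[OF V G(2) L] A(1)] .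
  moreover have "N \<in> perp_right K V"
  proof -
    have "hom0 K D N" if D: "D \<in> V" for D
    proof -
      have Dc: "D \<in> compacts \<kappa> K" using D thick_idealD(1)[OF V] by blast
      obtain E where E: "E \<in> compacts \<kappa> K" "is_left_dual K E D" using left_duals[OF Dc] by blast
      \<comment> \<open>The dual \<open>E\<close> lies in \<open>V\<close> as a retract of this
        object, hence annihilates \<open>N\<close>, and \<open>left_dual_detect\<close> turns that
        into orthogonality.\<close>
      have "E \<boxtimes> D \<boxtimes> E \<in> V" using thick_idealD(4)[OF V thick_idealD(5)[OF V D E(1)] E(1)] .
      then have "E \<in> I"
        using thick_retract[OF thick_idealD(2)[OF V]] left_dual_retract(2)[OF E(2) compact_ob[OF E(1)] compact_ob[OF Dc]]
          VI by blast
      then have "is_zero K (N \<boxtimes> Unt K \<boxtimes> E)" unfolding I_def right_ann_def using unit_compact by blast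
      then have "is_zero K (N \<boxtimes> E)" using ten_unt_mem[OF thick_is_zero N compact_ob[OF E(1)]] by blast
      then show ?thesis using left_dual_detect[OF E(2) compact_ob[OF E(1)] compact_ob[OF Dc] N] by blast
    qed
    then show ?thesis unfolding perp_right_def using N by blast
  qed
  ultimately have "is_zero K N" using Loc_perp_zero[OF thick_idealD(2,1)[OF V]] by blast
  then show False using A(2) S unfolding N_def by blast
qed

lemma Supp_tensorial:
  assumes noeth: "noetherian_space (Spc_topology \<kappa> K)" and A: "A \<in> Ob K" and C: "C \<in> compacts \<kappa> K"
  shows "(\<Union>B \<in> compacts \<kappa> K. Supp \<kappa> K (A \<boxtimes> B \<boxtimes> C)) = Supp \<kappa> K A \<inter> Supp \<kappa> K C"
proof (intro equalityI subsetI)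
  fix P assume "P \<in> (\<Union>B \<in> compacts \<kappa> K. Supp \<kappa> K (A \<boxtimes> B \<boxtimes> C))"
  then obtain B where B: "B \<in> compacts \<kappa> K" "P \<in> Supp \<kappa> K (A \<boxtimes> B \<boxtimes> C)" by blast
  have P: "P \<in> Spc \<kappa> K" using B(2) unfolding Supp_def by blast
  note ob = compact_ob[OF B(1)] compact_ob[OF C]
  have "C \<notin> P" using not_Supp_ten_prime[OF P ten_ob[OF A ob(1)]] B(2) by blast
  then have "P \<in> Supp \<kappa> K C" using Supp_compact[OF noeth P C] by blast
  moreover have "P \<in> Supp \<kappa> K A"
  proof (rule ccontr)
    define M where "M = Gamma \<kappa> K (Theta \<kappa> K (VP \<kappa> K P)) (Unt K) \<boxtimes> Lcl \<kappa> K P (Unt K)"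
    have M: "M \<in> Ob K" unfolding M_def
      using ten_ob Gamma_unit(1)[OF thick_ideal_Theta] Lcl_unit(1)[OF prime_idealD(1)[OF P]] by blast
    assume "P \<notin> Supp \<kappa> K A"
    then have "is_zero K (M \<boxtimes> A \<boxtimes> B \<boxtimes> C)" using Supp_iff[OF P] ten_zero(1) ob unfolding M_def by blast
    then have "is_zero K (M \<boxtimes> (A \<boxtimes> B \<boxtimes> C))"
      using is_zero_isomorphic[OF isomorphic_trans[OF ten_isomorphic_left[OF ten_assoc_isomorphic[OF M A ob(1)] ob(2)]
          ten_assoc_isomorphic[OF M ten_ob[OF A ob(1)] ob(2)]]] by blast
    then show False using B(2) Supp_iff[OF P] unfolding M_def by blast
  qed
  ultimately show "P \<in> Supp \<kappa> K A \<inter> Supp \<kappa> K C" by blast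
next
  fix P assume h: "P \<in> Supp \<kappa> K A \<inter> Supp \<kappa> K C"
  then have P: "P \<in> Spc \<kappa> K" unfolding Supp_def by blast
  have "C \<notin> P"
  proof
    assume "C \<in> P"
    \<comment> \<open>\<open>not_Supp_ten_prime\<close> speaks of tensor products, so
      \<open>C\<close> is written as \<open>Unt K \<boxtimes> C\<close>.\<close>
    then have "P \<notin> Supp \<kappa> K (Unt K \<boxtimes> C)" using not_Supp_ten_prime[OF P unt_ob] by blast
    moreover have "P \<in> Supp \<kappa> K (Unt K \<boxtimes> C) \<longleftrightarrow> P \<in> Supp \<kappa> K C"
      unfolding Supp_iff[OF P]
      using is_zero_isomorphic[OF ten_isomorphic_right[OF unt_isomorphic[OF compact_ob[OF C]]]]
        ten_ob Gamma_unit(1)[OF thick_ideal_Theta] Lcl_unit(1)[OF prime_idealD(1)[OF P]] by blast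
    ultimately show False using h by blast
  qed
  then show "P \<in> (\<Union>B \<in> compacts \<kappa> K. Supp \<kappa> K (A \<boxtimes> B \<boxtimes> C))"
    using Supp_ten_compact[OF P A _ C] h by blast
qed

end

theorem proposition4p4:
  fixes \<kappa> :: "'u rel" and K :: "('o, 'm) mtcat" and A C :: 'o
  assumes "rigidly_compactly_generated \<kappa> K"
    and "noetherian_space (Spc_topology \<kappa> K)"
    and "A \<in> Ob K" and "C \<in> compacts \<kappa> K"
  shows "(\<Union>B \<in> compacts \<kappa> K. Supp \<kappa> K (A \<boxtimes>\<^bsub>K\<^esub> B \<boxtimes>\<^bsub>K\<^esub> C)) = Supp \<kappa> K A \<inter> Supp \<kappa> K C"
  using rigidly_compactly_generated.Supp_tensorial[OF assms] .

end
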